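(* Let $\Omega\subset\mathbb{R}^n$ be a bounded open set, and let $1<p<\infty$, $\theta>0$, $\alpha\geqslant0$ and $0<\lambda<1$. Let $T$ be a Calderón-Zygmund operator on $\Omega$ (in the sense defined in the context). Then $T$ is bounded in the grand grand Morrey space $L^{p),\lambda)}_{\theta,\alpha}(\Omega)$; that is, there is a constant $C$ such that $\|Tf\|_{L^{p),\lambda)}_{\theta,\alpha}(\Omega)}\leqslant C\|f\|_{L^{p),\lambda)}_{\theta,\alpha}(\Omega)}$ for all $f\in L^{p),\lambda)}_{\theta,\alpha}(\Omega)$.
   Context: Notation: $\mathsf{d}=\operatorname{diam}\Omega$, $B(x,r)=\{y\in\mathbb{R}^n:|y-x|<r\}$, $\widetilde B(x,r)=B(x,r)\cap\Omega$, and $|A|$ is the Lebesgue measure of $A$. Morrey space: for $1\leqslant q<\infty$ and $0\leqslant\mu<1$, $L^{q,\mu}(\Omega)$ is the set of measurable functions $f$ on $\Omega$ with $$\|f\|_{L^{q,\mu}(\Omega)}:=\sup_{x\in\Omega,\;0<r\leqslant\mathsf{d}}\left(\frac{1}{|B(x,r)|^{\mu}}\int_{\widetilde B(x,r)}|f(y)|^{q}\,\mathrm{d}y\right)^{1/q}<\infty.$$ Grand grand Morrey space: for $1<p<\infty$, $\theta>0$, $\alpha\geqslant0$, $0\leqslant\lambda<1$, $L^{p),\lambda)}_{\theta,\alpha}(\Omega)$ is the set of measurable functions $f$ on $\Omega$ with $$\|f\|_{L^{p),\lambda)}_{\theta,\alpha}(\Omega)}:=\sup_{0<\varepsilon<s_{\max}}\varepsilon^{\frac{\theta}{p-\varepsilon}}\|f\|_{L^{p-\varepsilon,\lambda-\alpha\varepsilon}(\Omega)}<\infty,\qquad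 s_{\max}=\min\left\{p-1,\frac{\lambda}{\alpha}\right\}.$$ Convention: when $\alpha=0$, the quotient $\lambda/\alpha$ is understood as $+\infty$. Calderón-Zygmund operator: an integral operator $$Tf(x)=\mathrm{p.v.}\int_\Omega K(x,y)f(y)\,\mathrm{d}y$$ whose kernel $K:\Omega\times\Omega\setminus\{(x,x):x\in\Omega\}\to\mathbb{R}$ satisfies, for some constant $C>0$, $$|K(x,y)|\leqslant\frac{C}{|x-y|^n},\qquad x,y\in\Omega,\ x\neq y,$$ and $$|K(x_1,y)-K(x_2,y)|+|K(y,x_1)-K(y,x_2)|\leqslant C\,w\!\left(\frac{|x_2-x_1|}{|x_2-y|}\right)\frac{1}{|x_2-y|^n}$$ for all $x_1,x_2,y\in\Omega$ with $|x_2-y|>C|x_1-x_2|$, where $w$ is a positive non-decreasing function on $(0,\infty)$ satisfying the doubling condition $w(2t)\leqslant c\,w(t)$ for all $t>0$ (for some constant $c$) and the Dini condition $\int_0^1\frac{w(t)}{t}\,\mathrm{d}t<\infty$. It is also assumed that $Tf$ exists almost everywhere on $\Omega$ in the principal value sense for all $f\in L^2(\Omega)$ and that $T$ is bounded in $L^2(\Omega)$. (The symbol $C$ denotes constants which may differ from one occurrence to another.) *)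

theory Defs
  imports "HOL-Analysis.Analysis"
begin

text \<open>Real powers on \<^typ>\<open>ennreal\<close>; only positive exponents are used below.\<close>

definition ennreal_powr :: "ennreal \<Rightarrow> real \<Rightarrow> ennreal" where
  "ennreal_powr a s = (if a = \<infinity> then \<infinity> else ennreal (enn2real a powr s))"

text \<open>Functions on \<open>\<Omega>\<close> are represented by total functions whose values outside \<open>\<Omega>\<close> are never
  used. All norms take values in \<^typ>\<open>ennreal\<close>, so that they are defined for every function and
  membership in the space is finiteness of the norm.\<close>

definition morrey_norm :: "(real ^ 'n) set \<Rightarrow> real \<Rightarrow> real \<Rightarrow> (real ^ 'n \<Rightarrow> real) \<Rightarrow> ennreal" where
  "morrey_norm \<Omega> q \<mu> f =
     (SUP x\<in>\<Omega>. SUP r\<in>{0<..diameter \<Omega>}.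
        ennreal_powr
          (ennreal (1 / measure lebesgue (ball x r) powr \<mu>) *
             (\<integral>\<^sup>+ y \<in> ball x r \<inter> \<Omega>. ennreal (\<bar>f y\<bar> powr q) \<partial>lebesgue))
          (1 / q))"

text \<open>The quotient \<open>\<lambda>/\<alpha>\<close> is read as \<open>+\<infinity>\<close> for \<open>\<alpha> = 0\<close>, whereas division by zero in HOL yields \<open>0\<close>.\<close>

definition s_max :: "real \<Rightarrow> real \<Rightarrow> real \<Rightarrow> real" where
  "s_max p lam \<alpha> = (if \<alpha> = 0 then p - 1 else min (p - 1) (lam / \<alpha>))"

definition grand_morrey_norm ::
  "(real ^ 'n) set \<Rightarrow> real \<Rightarrow> real \<Rightarrow> real \<Rightarrow> real \<Rightarrow> (real ^ 'n \<Rightarrow> real) \<Rightarrow> ennreal" where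
  "grand_morrey_norm \<Omega> p lam \<theta> \<alpha> f =
     (SUP \<epsilon>\<in>{0<..<s_max p lam \<alpha>}.
        ennreal (\<epsilon> powr (\<theta> / (p - \<epsilon>))) * morrey_norm \<Omega> (p - \<epsilon>) (lam - \<alpha> * \<epsilon>) f)"

definition grand_morrey_space ::
  "(real ^ 'n) set \<Rightarrow> real \<Rightarrow> real \<Rightarrow> real \<Rightarrow> real \<Rightarrow> (real ^ 'n \<Rightarrow> real) set" where
  "grand_morrey_space \<Omega> p lam \<theta> \<alpha> =
     {f \<in> borel_measurable (lebesgue_on \<Omega>). grand_morrey_norm \<Omega> p lam \<theta> \<alpha> f < \<infinity>}"

definition L2_space :: "(real ^ 'n) set \<Rightarrow> (real ^ 'n \<Rightarrow> real) set" where
  "L2_space \<Omega> = {f \<in> borel_measurable (lebesgue_on \<Omega>). integrable (lebesgue_on \<Omega>) (\<lambda>x. (f x)\<^sup>2)}"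

definition L2_norm :: "(real ^ 'n) set \<Rightarrow> (real ^ 'n \<Rightarrow> real) \<Rightarrow> real" where
  "L2_norm \<Omega> f = sqrt (\<integral>x. (f x)\<^sup>2 \<partial>lebesgue_on \<Omega>)"

text \<open>\<open>has_pv \<Omega> K f x L\<close>: the principal value of \<open>\<integral>\<^sub>\<Omega> K(x,y) f(y) dy\<close> exists and equals \<open>L\<close>. The Bochner
  integral of a non-integrable function is \<open>0\<close>, hence integrability of the truncations is
  required explicitly.\<close>

definition has_pv ::
  "(real ^ 'n) set \<Rightarrow> (real ^ 'n \<Rightarrow> real ^ 'n \<Rightarrow> real) \<Rightarrow> (real ^ 'n \<Rightarrow> real) \<Rightarrow> real ^ 'n \<Rightarrow> real \<Rightarrow> bool" where
  "has_pv \<Omega> K f x L \<longleftrightarrow>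
     (\<forall>\<epsilon>>0. set_integrable lebesgue (\<Omega> - ball x \<epsilon>) (\<lambda>y. K x y * f y)) \<and>
     ((\<lambda>\<epsilon>. set_lebesgue_integral lebesgue (\<Omega> - ball x \<epsilon>) (\<lambda>y. K x y * f y)) \<longlongrightarrow> L) (at_right 0)"

text \<open>At points where the principal value does not exist, the value is arbitrary.\<close>

definition pv_operator ::
  "(real ^ 'n) set \<Rightarrow> (real ^ 'n \<Rightarrow> real ^ 'n \<Rightarrow> real) \<Rightarrow> (real ^ 'n \<Rightarrow> real) \<Rightarrow> real ^ 'n \<Rightarrow> real" where
  "pv_operator \<Omega> K f x = (THE L. has_pv \<Omega> K f x L)"

definition dini_modulus :: "(real \<Rightarrow> real) \<Rightarrow> bool" where
  "dini_modulus w \<longleftrightarrow>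
     (\<forall>t>0. w t > 0) \<and> mono_on {0<..} w \<and>
     (\<exists>c. \<forall>t>0. w (2 * t) \<le> c * w t) \<and>
     (\<integral>\<^sup>+ t \<in> {0<..<1}. ennreal (w t / t) \<partial>lborel) < \<infinity>"

text \<open>A kernel is only meaningful off the diagonal, so \<open>x\<^sub>1 \<noteq> y\<close> has to be imposed (it is not implied
  by the threshold if \<open>C < 1\<close>), while \<open>x\<^sub>2 \<noteq> y\<close> is implied; for \<open>x\<^sub>1 = x\<^sub>2\<close>
  the regularity condition is void and \<open>w\<close> would be evaluated at \<open>0\<close>, outside its domain.
  Using one \<open>C\<close> throughout loses no generality, since both conditions get weaker as \<open>C\<close>
  increases.\<close>

definition cz_kernel :: "(real ^ 'n) set \<Rightarrow> (real ^ 'n \<Rightarrow> real ^ 'n \<Rightarrow> real) \<Rightarrow> bool" where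
  "cz_kernel \<Omega> K \<longleftrightarrow>
     (\<exists>C>0. \<exists>w. dini_modulus w \<and>
        (\<forall>x\<in>\<Omega>. \<forall>y\<in>\<Omega>. x \<noteq> y \<longrightarrow> \<bar>K x y\<bar> \<le> C / norm (x - y) ^ CARD('n)) \<and>
        (\<forall>x\<^sub>1\<in>\<Omega>. \<forall>x\<^sub>2\<in>\<Omega>. \<forall>y\<in>\<Omega>.
           x\<^sub>1 \<noteq> x\<^sub>2 \<longrightarrow> x\<^sub>1 \<noteq> y \<longrightarrow> norm (x\<^sub>2 - y) > C * norm (x\<^sub>1 - x\<^sub>2) \<longrightarrow>
           \<bar>K x\<^sub>1 y - K x\<^sub>2 y\<bar> + \<bar>K y x\<^sub>1 - K y x\<^sub>2\<bar>
             \<le> C * w (norm (x\<^sub>2 - x\<^sub>1) / norm (x\<^sub>2 - y)) * (1 / norm (x\<^sub>2 - y) ^ CARD('n))))"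

definition calderon_zygmund_operator ::
  "(real ^ 'n) set \<Rightarrow> (real ^ 'n \<Rightarrow> real ^ 'n \<Rightarrow> real) \<Rightarrow>
     ((real ^ 'n \<Rightarrow> real) \<Rightarrow> (real ^ 'n \<Rightarrow> real)) \<Rightarrow> bool" where
  "calderon_zygmund_operator \<Omega> K T \<longleftrightarrow>
     T = pv_operator \<Omega> K \<and> cz_kernel \<Omega> K \<and>
     (\<forall>f\<in>L2_space \<Omega>. AE x in lebesgue_on \<Omega>. \<exists>L. has_pv \<Omega> K f x L) \<and>
     (\<exists>C. \<forall>f\<in>L2_space \<Omega>. T f \<in> L2_space \<Omega> \<and> L2_norm \<Omega> (T f) \<le> C * L2_norm \<Omega> f)"

end

theory Submission
  imports Defs
begin

text \<open>
  The theorem follows from a bound in the ordinary Morrey spaces \<open>L\<^sup>q\<^sup>,\<^sup>\<mu>\<close> whose constant is uniform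
  for \<open>q\<close> in a compact subinterval of \<open>(1,\<infinity>)\<close> that ends at \<open>p\<close> and for \<open>0 \<le> \<mu> \<le> \<lambda> < 1\<close>
  (\<open>morrey_operator_bound\<close>). It handles all \<open>\<epsilon>\<close> up to a small \<open>\<sigma>\<close>; for \<open>\<epsilon> > \<sigma>\<close>, Hoelder's
  inequality on each ball bounds the norm with parameter \<open>\<epsilon>\<close> by the one with parameter \<open>\<sigma>\<close>
  (\<open>morrey_norm_embedding\<close>), because \<open>(1 - \<lambda> + \<alpha> \<epsilon>) / (p - \<epsilon>)\<close> increases with \<open>\<epsilon>\<close>.

  The Morrey bound follows from an \<open>L\<^sup>q\<close> bound: on a ball \<open>B(x,r)\<close> the function is split into its
  restriction to \<open>B(x,2r)\<close>, to which the \<open>L\<^sup>q\<close> bound applies, and the rest, for which the size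
  \<open>|x - y|\<^sup>-\<^sup>n\<close> of the kernel suffices since \<open>\<mu> < 1\<close> makes the sum over dyadic annuli converge.

  The real difficulty is the \<open>L\<^sup>q\<close> bound. The set \<open>\<Omega>\<close> is an arbitrary bounded open set, so
  Lebesgue measure on it satisfies the growth condition \<open>|B(x,r) \<inter> \<Omega>| \<le> V r\<^sup>n\<close> but need not be
  doubling, and the classical Calderon-Zygmund decomposition fails: the mean of a bad part cannot be
  spread over a cube of which \<open>\<Omega>\<close> occupies only a small fraction. The proof follows the method of
  Nazarov, Treil and Volberg for such measures, applied to the truncated operators
  \<open>T\<^sub>e f(x) = \<integral> K(x,y) f(y) dy\<close> over \<open>{y \<in> \<Omega>. |x - y| \<ge> e}\<close>. They have bounded kernels, so
  Fubini and duality are unproblematic, and all constants are independent of \<open>e\<close>. It rests on the following facts.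

  \<^item> Boundedness of the principal value operator on \<open>L\<^sup>2\<close> gives boundedness of all \<open>T\<^sub>e\<close> on \<open>L\<^sup>2\<close>,
    uniformly in \<open>e\<close>, by localising to a grid of cubes of side \<open>e\<close> (\<open>strong_type_2_of_pv\<close>).
    By duality the same holds for the transposed kernel.

  \<^item> Cotlar's inequality bounds the maximal truncation by maximal functions whose denominators use
    dilated balls and which are therefore of weak type without doubling (\<open>cotlar_pointwise\<close>,
    \<open>maximal_weak_type\<close>).

  \<^item> Weak type (1,1): \<open>f\<close> is approximated by point masses, and a mass \<open>\<alpha>\<close> at \<open>x\<close> is compared with
    a function of constant modulus on a set \<open>E \<subseteq> B(x,\<rho>)\<close> of measure proportional to \<open>|\<alpha>|\<close>. The sets
    are chosen greedily and disjoint, so that \<open>B(x,\<rho>)\<close> is used up (\<open>sweeping\<close>). If the sets do not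
    fit into \<open>\<Omega>\<close>, the estimate is trivial. Off the union of the sets the error is controlled by the
    smoothness of the kernel (\<open>point_mass_transfer\<close>), and the spread-out part by duality and the
    maximal truncation of the transpose (\<open>swept_tail_level\<close>).

  \<^item> Marcinkiewicz interpolation and duality give all \<open>q\<close>; interpolating once more between \<open>1\<close> and
    \<open>p + 1\<close> gives constants that are uniform near \<open>p\<close>, also when \<open>p = 2\<close> (\<open>strong_type_uniform\<close>).

  \<^item> The weak type bound for the maximal truncation and the density of bounded functions give the
    almost everywhere existence of principal values on \<open>L\<^sup>q\<close> for \<open>q < 2\<close> (\<open>pv_exists\<close>). Fatou's lemma
    then carries the bounds from \<open>T\<^sub>e\<close> to \<open>T\<close>.
\<close>

section \<open>Power integrals and layer cakes\<close>

text \<open>The \<open>q\<close>-th power of the \<open>L\<^sup>q\<close> norm. Leaving out the root keeps it additive and defined, with values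
  in \<^typ>\<open>ennreal\<close>, for every function.\<close>

definition powint :: "'a measure \<Rightarrow> real \<Rightarrow> ('a \<Rightarrow> real) \<Rightarrow> ennreal" where
  "powint M q f = (\<integral>\<^sup>+x. ennreal (\<bar>f x\<bar> powr q) \<partial>M)"

lemma nn_integral_powr_below:
  assumes "a \<ge> 0" "e > (-1::real)"
  shows "(\<integral>\<^sup>+t\<in>{0<..<a}. ennreal (t powr e) \<partial>lborel) = ennreal (a powr (e+1) / (e+1))"
proof -
  have "(\<integral>\<^sup>+t\<in>{0..a}. ennreal (t powr e) \<partial>lborel) = ennreal (a powr (e+1) / (e+1))"
    by (rule nn_integral_has_integral_lebesgue') (use has_integral_powr_from_0 assms in auto)
  moreover have "(\<integral>\<^sup>+t\<in>{0<..<a}. ennreal (t powr e) \<partial>lborel)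
      = (\<integral>\<^sup>+t\<in>{0..a}. ennreal (t powr e) \<partial>lborel)"
    by (rule nn_integral_cong_AE, use AE_lborel_singleton[of 0] AE_lborel_singleton[of a] in eventually_elim)
      (auto simp: indicator_def)
  ultimately show ?thesis by simp
qed

lemma nn_integral_powr_above:
  assumes "a > 0" "e < (-1::real)"
  shows "(\<integral>\<^sup>+t\<in>{a..}. ennreal (t powr e) \<partial>lborel) = ennreal (a powr (e+1) / (- e - 1))"
proof -
  have "- (a powr (e+1)) / (e+1) = a powr (e+1) / (- e - 1)"
    using assms by (simp add: field_simps)
  then show ?thesis
    using nn_integral_has_integral_lebesgue'[of "{a..}" "\<lambda>t. t powr e", OF _ has_integral_powr_to_inf] assms
    by auto
qed

text \<open>Tonelli on the region \<open>{(x,t). 0 < t < |f x|}\<close> with the weight \<open>q t\<^sup>q\<^sup>-\<^sup>1\<close>.\<close>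

lemma powint_layer_cake:
  assumes "sigma_finite_measure M" "f \<in> borel_measurable M" "q > 0"
  shows "powint M q f = (\<integral>\<^sup>+t. ennreal (q * t powr (q-1)) * emeasure M {x\<in>space M. \<bar>f x\<bar> > t}
            * indicator {0<..} t \<partial>lborel)"
proof -
  interpret sigma_finite_measure M by fact
  interpret P: pair_sigma_finite M lborel ..
  note [measurable] = assms(2)
  have "powint M q f = (\<integral>\<^sup>+x. (\<integral>\<^sup>+t\<in>{0<..<\<bar>f x\<bar>}. ennreal (q * t powr (q-1)) \<partial>lborel) \<partial>M)"
    unfolding powint_def
  proof (intro nn_integral_cong)
    fix x
    have "(\<integral>\<^sup>+t\<in>{0<..<\<bar>f x\<bar>}. ennreal (q * t powr (q-1)) \<partial>lborel)
        = (\<integral>\<^sup>+t. ennreal q * (ennreal (t powr (q-1)) * indicator {0<..<\<bar>f x\<bar>} t) \<partial>lborel)"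
      using assms(3) by (intro nn_integral_cong) (simp add: ennreal_mult mult_ac)
    also have "\<dots> = ennreal q * ennreal (\<bar>f x\<bar> powr q / q)"
      using assms(3) by (subst nn_integral_cmult) (simp_all add: nn_integral_powr_below)
    also have "\<dots> = ennreal (\<bar>f x\<bar> powr q)"
      using assms(3) by (simp flip: ennreal_mult')
    finally show "ennreal (\<bar>f x\<bar> powr q)
       = (\<integral>\<^sup>+t\<in>{0<..<\<bar>f x\<bar>}. ennreal (q * t powr (q-1)) \<partial>lborel)" by simp
  qed
  also have "\<dots> = (\<integral>\<^sup>+x. (\<integral>\<^sup>+t. ennreal (q * t powr (q-1)) * indicator {0<..} t
        * indicator {z. snd z < \<bar>f (fst z)\<bar>} (x,t) \<partial>lborel) \<partial>M)"
    by (intro nn_integral_cong) (auto simp: indicator_def)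
  also have "\<dots> = (\<integral>\<^sup>+t. (\<integral>\<^sup>+x. ennreal (q * t powr (q-1)) * indicator {0<..} t
        * indicator {z. snd z < \<bar>f (fst z)\<bar>} (x,t) \<partial>M) \<partial>lborel)"
    by (rule P.Fubini'[symmetric]) (simp add: indicator_def, measurable)
  also have "\<dots> = (\<integral>\<^sup>+t. ennreal (q * t powr (q-1)) * emeasure M {x\<in>space M. \<bar>f x\<bar> > t}
            * indicator {0<..} t \<partial>lborel)"
  proof (intro nn_integral_cong)
    fix t :: real
    have "(\<integral>\<^sup>+x. ennreal (q * t powr (q-1)) * indicator {0<..} t
        * indicator {z. snd z < \<bar>f (fst z)\<bar>} (x,t) \<partial>M)
      = (\<integral>\<^sup>+x. (ennreal (q * t powr (q-1)) * indicator {0<..} t)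
        * indicator {x\<in>space M. \<bar>f x\<bar> > t} x \<partial>M)"
      by (intro nn_integral_cong) (auto simp: indicator_def)
    also have "\<dots> = ennreal (q * t powr (q-1)) * indicator {0<..} t * emeasure M {x\<in>space M. \<bar>f x\<bar> > t}"
      by (subst nn_integral_cmult_indicator) auto
    finally show "(\<integral>\<^sup>+x. ennreal (q * t powr (q-1)) * indicator {0<..} t
        * indicator {z. snd z < \<bar>f (fst z)\<bar>} (x,t) \<partial>M)
        = ennreal (q * t powr (q-1)) * emeasure M {x\<in>space M. \<bar>f x\<bar> > t} * indicator {0<..} t"
      by (simp add: mult_ac)
  qed
  finally show ?thesis .
qed

lemma powint_one: "powint M 1 f = (\<integral>\<^sup>+x. ennreal \<bar>f x\<bar> \<partial>M)"
  by (simp add: powint_def)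

lemma powint_Markov:
  assumes "f \<in> borel_measurable M" "t > 0" "q > 0"
  shows "emeasure M {x\<in>space M. \<bar>f x\<bar> > t} \<le> ennreal (1 / t powr q) * powint M q f"
proof -
  have "emeasure M {x\<in>space M. \<bar>f x\<bar> > t}
      \<le> emeasure M {x\<in>space M. 1 \<le> ennreal (1 / t powr q) * ennreal (\<bar>f x\<bar> powr q)}"
  proof (rule emeasure_mono)
    show "{x\<in>space M. \<bar>f x\<bar> > t} \<subseteq> {x\<in>space M. 1 \<le> ennreal (1 / t powr q) * ennreal (\<bar>f x\<bar> powr q)}"
    proof safe
      fix x assume "t < \<bar>f x\<bar>"
      then have "t powr q \<le> \<bar>f x\<bar> powr q" using assms by (intro powr_mono2) auto
      then have "1 \<le> (1 / t powr q) * \<bar>f x\<bar> powr q" using assms by (simp add: field_simps)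
      then show "1 \<le> ennreal (1 / t powr q) * ennreal (\<bar>f x\<bar> powr q)"
        by (simp flip: ennreal_mult)
    qed
  qed (use assms in measurable)
  also have "\<dots> \<le> ennreal (1 / t powr q) * (\<integral>\<^sup>+x\<in>space M. ennreal (\<bar>f x\<bar> powr q) \<partial>M)"
    using nn_integral_Markov_inequality[of "\<lambda>x. ennreal (\<bar>f x\<bar> powr q)" "space M" M "ennreal (1 / t powr q)"] assms(1)
    by measurable
  also have "(\<integral>\<^sup>+x\<in>space M. ennreal (\<bar>f x\<bar> powr q) \<partial>M) = powint M q f"
    unfolding powint_def by (intro nn_integral_cong) auto
  finally show ?thesis .
qed

text \<open>Interpolation between weak type \<open>(1,1)\<close> and weak type \<open>(s,s)\<close>. For an operator of both types the
  hypothesis on \<open>g\<close> results from splitting \<open>f\<close> at the height \<open>t\<close>. Multiplied by \<open>q t\<^sup>q\<^sup>-\<^sup>1\<close> and integrated, the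
  first term converges near \<open>0\<close> because \<open>1 < q\<close>, the second near infinity because \<open>q < s\<close>.\<close>

lemma marcinkiewicz:
  assumes "sigma_finite_measure M" and [measurable]: "f \<in> borel_measurable M" "g \<in> borel_measurable M"
    and qs: "1 < q" "q < s" and AB: "A \<ge> 0" "B \<ge> 0"
    and weak: "\<And>t. t > 0 \<Longrightarrow> emeasure M {x\<in>space M. \<bar>g x\<bar> > t}
      \<le> ennreal (A / t) * (\<integral>\<^sup>+x\<in>{x. \<bar>f x\<bar> > t}. ennreal \<bar>f x\<bar> \<partial>M)
       + ennreal (B / t powr s) * (\<integral>\<^sup>+x\<in>{x. \<bar>f x\<bar> \<le> t}. ennreal (\<bar>f x\<bar> powr s) \<partial>M)"
  shows "powint M q g \<le> ennreal (A * q / (q - 1) + B * q / (s - q)) * powint M q f"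
proof -
  interpret sigma_finite_measure M by fact
  interpret P: pair_sigma_finite M lborel ..
  let ?u = "\<lambda>t x. ennreal (A * q * t powr (q-2)) * indicator {0<..} t * (ennreal \<bar>f x\<bar> * indicator {z. snd z < \<bar>f (fst z)\<bar>} (x,t))"
  let ?v = "\<lambda>t x. ennreal (B * q * t powr (q-1-s)) * indicator {0<..} t * (ennreal (\<bar>f x\<bar> powr s) * indicator {z. snd z \<ge> \<bar>f (fst z)\<bar>} (x,t))"
  have mu: "(\<lambda>(x,t). ?u t x) \<in> borel_measurable (M \<Otimes>\<^sub>M lborel)"
    by (simp add: indicator_def split_beta', measurable)
  have mv: "(\<lambda>(x,t). ?v t x) \<in> borel_measurable (M \<Otimes>\<^sub>M lborel)"
    by (simp add: indicator_def split_beta', measurable)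
  have "powint M q g \<le> (\<integral>\<^sup>+t. (\<integral>\<^sup>+x. ?u t x \<partial>M) + (\<integral>\<^sup>+x. ?v t x \<partial>M) \<partial>lborel)"
    unfolding powint_layer_cake[OF assms(1,3) order.strict_trans[OF zero_less_one qs(1)]]
  proof (intro nn_integral_mono)
    fix t :: real
    show "ennreal (q * t powr (q-1)) * emeasure M {x\<in>space M. \<bar>g x\<bar> > t} * indicator {0<..} t
       \<le> (\<integral>\<^sup>+x. ?u t x \<partial>M) + (\<integral>\<^sup>+x. ?v t x \<partial>M)"
    proof (cases "t > 0")
      case t: True
      let ?I = "\<integral>\<^sup>+x. ennreal \<bar>f x\<bar> * indicator {x. \<bar>f x\<bar> > t} x \<partial>M"
      let ?J = "\<integral>\<^sup>+x. ennreal (\<bar>f x\<bar> powr s) * indicator {x. \<bar>f x\<bar> \<le> t} x \<partial>M"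
      have e1: "ennreal (q * t powr (q-1)) * ennreal (A / t) = ennreal (A * q * t powr (q-2))"
      proof -
        have "t powr (q-1) / t = t powr (q-2)" using t powr_diff[of t "q-1" 1] by simp
        then have "(q * t powr (q-1)) * (A / t) = A * q * t powr (q-2)"
          by (metis (no_types, lifting) mult.commute mult.left_commute times_divide_eq_right)
        then show ?thesis using AB qs t by (simp flip: ennreal_mult)
      qed
      have e2: "ennreal (q * t powr (q-1)) * ennreal (B / t powr s) = ennreal (B * q * t powr (q-1-s))"
      proof -
        have "(q * t powr (q-1)) * (B / t powr s) = B * q * t powr (q-1-s)" by (simp add: powr_diff)
        then show ?thesis using AB qs t by (simp flip: ennreal_mult)
      qed
      have "ennreal (q * t powr (q-1)) * emeasure M {x\<in>space M. \<bar>g x\<bar> > t}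
         \<le> ennreal (q * t powr (q-1)) * (ennreal (A / t) * ?I + ennreal (B / t powr s) * ?J)"
        by (intro mult_left_mono weak t) auto
      also have "\<dots> = ennreal (A * q * t powr (q-2)) * ?I + ennreal (B * q * t powr (q-1-s)) * ?J"
        by (simp add: distrib_left mult.assoc[symmetric] e1 e2)
      also have "\<dots> = (\<integral>\<^sup>+x. ?u t x \<partial>M) + (\<integral>\<^sup>+x. ?v t x \<partial>M)"
        using t by (subst (1 2) nn_integral_cmult[symmetric]) (auto simp: indicator_def intro!: arg_cong2[where f="(+)"] nn_integral_cong)
      finally show ?thesis using t by simp
    qed auto
  qed
  also have "\<dots> = (\<integral>\<^sup>+t. (\<integral>\<^sup>+x. ?u t x \<partial>M) \<partial>lborel) + (\<integral>\<^sup>+t. (\<integral>\<^sup>+x. ?v t x \<partial>M) \<partial>lborel)"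
    by (intro nn_integral_add borel_measurable_nn_integral) (simp_all add: indicator_def split_beta', measurable)
  also have "(\<integral>\<^sup>+t. (\<integral>\<^sup>+x. ?u t x \<partial>M) \<partial>lborel) = (\<integral>\<^sup>+x. (\<integral>\<^sup>+t. ?u t x \<partial>lborel) \<partial>M)"
    by (rule P.Fubini'[OF mu])
  also have "(\<integral>\<^sup>+t. (\<integral>\<^sup>+x. ?v t x \<partial>M) \<partial>lborel) = (\<integral>\<^sup>+x. (\<integral>\<^sup>+t. ?v t x \<partial>lborel) \<partial>M)"
    by (rule P.Fubini'[OF mv])
  also have "(\<integral>\<^sup>+x. (\<integral>\<^sup>+t. ?u t x \<partial>lborel) \<partial>M) = ennreal (A * q / (q - 1)) * powint M q f"
  proof -
    have "(\<integral>\<^sup>+t. ?u t x \<partial>lborel) = ennreal (A * q / (q - 1)) * ennreal (\<bar>f x\<bar> powr q)" for x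
    proof -
      have "(\<integral>\<^sup>+t. ?u t x \<partial>lborel)
          = (\<integral>\<^sup>+t. ennreal (A * q * \<bar>f x\<bar>) * (ennreal (t powr (q-2)) * indicator {0<..<\<bar>f x\<bar>} t) \<partial>lborel)"
        using AB qs by (intro nn_integral_cong) (auto simp: indicator_def ennreal_mult mult_ac simp flip: ennreal_mult)
      also have "\<dots> = ennreal (A * q * \<bar>f x\<bar>) * ennreal (\<bar>f x\<bar> powr (q-1) / (q-1))"
        using qs by (subst nn_integral_cmult) (simp_all add: nn_integral_powr_below)
      also have "\<dots> = ennreal (A * q / (q-1) * (\<bar>f x\<bar> * \<bar>f x\<bar> powr (q-1)))"
        using AB qs by (simp flip: ennreal_mult add: field_simps)
      also have "\<bar>f x\<bar> * \<bar>f x\<bar> powr (q-1) = \<bar>f x\<bar> powr q"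
        by (subst powr_mult_base) auto
      finally show ?thesis using AB qs by (simp flip: ennreal_mult)
    qed
    then show ?thesis unfolding powint_def by (simp add: nn_integral_cmult)
  qed
  also have "(\<integral>\<^sup>+x. (\<integral>\<^sup>+t. ?v t x \<partial>lborel) \<partial>M) \<le> ennreal (B * q / (s - q)) * powint M q f"
  proof -
    have "(\<integral>\<^sup>+t. ?v t x \<partial>lborel) \<le> ennreal (B * q / (s - q)) * ennreal (\<bar>f x\<bar> powr q)" for x
    proof (cases "f x = 0")
      case True
      then have "(\<lambda>t. ?v t x) = (\<lambda>_. 0)" using qs by (auto simp: fun_eq_iff)
      then show ?thesis by (simp only: nn_integral_const) simp
    next
      case False
      have "(\<integral>\<^sup>+t. ?v t x \<partial>lborel)
          = (\<integral>\<^sup>+t. ennreal (B * q * \<bar>f x\<bar> powr s) * (ennreal (t powr (q-1-s)) * indicator {\<bar>f x\<bar>..} t) \<partial>lborel)"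
        using AB qs False by (intro nn_integral_cong) (auto simp: indicator_def ennreal_mult mult_ac simp flip: ennreal_mult)
      also have "\<dots> = ennreal (B * q * \<bar>f x\<bar> powr s) * ennreal (\<bar>f x\<bar> powr (q-s) / (s-q))"
        using qs False by (subst nn_integral_cmult) (simp_all add: nn_integral_powr_above)
      also have "\<dots> = ennreal (B * q / (s-q) * (\<bar>f x\<bar> powr s * \<bar>f x\<bar> powr (q-s)))"
        using AB qs by (simp flip: ennreal_mult add: field_simps)
      also have "\<bar>f x\<bar> powr s * \<bar>f x\<bar> powr (q-s) = \<bar>f x\<bar> powr q"
        by (simp flip: powr_add)
      finally show ?thesis using AB qs by (simp flip: ennreal_mult)
    qed
    then have "(\<integral>\<^sup>+x. (\<integral>\<^sup>+t. ?v t x \<partial>lborel) \<partial>M) \<le> (\<integral>\<^sup>+x. ennreal (B * q / (s - q)) * ennreal (\<bar>f x\<bar> powr q) \<partial>M)"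
      by (intro nn_integral_mono)
    then show ?thesis unfolding powint_def by (simp add: nn_integral_cmult)
  qed
  finally show ?thesis
    using AB qs by (subst ennreal_plus) (auto simp: distrib_right add_left_mono intro: order_trans)
qed

text \<open>Kolmogorov's inequality. In applications \<open>a\<close> is the measure of a set outside of which \<open>g\<close> vanishes; it
  bounds the levels below \<open>s\<close>, and the weak type bound takes care of those above.\<close>

lemma kolmogorov_weak_L2:
  assumes "sigma_finite_measure M" "g \<in> borel_measurable M" "s > 0" "D \<ge> 0" "a \<ge> 0"
    and a: "\<And>t. t > 0 \<Longrightarrow> emeasure M {x\<in>space M. \<bar>g x\<bar> > t} \<le> ennreal a"
    and weak: "\<And>t. t > 0 \<Longrightarrow> emeasure M {x\<in>space M. \<bar>g x\<bar> > t} \<le> ennreal (D / t\<^sup>2)"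
  shows "(\<integral>\<^sup>+x. ennreal \<bar>g x\<bar> \<partial>M) \<le> ennreal (s * a + D / s)"
proof -
  have "(\<integral>\<^sup>+x. ennreal \<bar>g x\<bar> \<partial>M) = (\<integral>\<^sup>+t. ennreal (1 * t powr (1-1)) * emeasure M {x\<in>space M. \<bar>g x\<bar> > t}
            * indicator {0<..} t \<partial>lborel)"
    using powint_layer_cake[OF assms(1,2), of 1] by (simp add: powint_one)
  also have "\<dots> \<le> (\<integral>\<^sup>+t. ennreal a * indicator {0<..<s} t + ennreal D * (ennreal (t powr (-2)) * indicator {s..} t) \<partial>lborel)"
  proof (intro nn_integral_mono)
    fix t :: real
    have "ennreal (D / t\<^sup>2) = ennreal D * ennreal (t powr (-2))" if "t > 0"
      using that assms(4) by (simp flip: ennreal_mult add: powr_minus divide_inverse)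
    then show "ennreal (1 * t powr (1-1)) * emeasure M {x\<in>space M. \<bar>g x\<bar> > t} * indicator {0<..} t
        \<le> ennreal a * indicator {0<..<s} t + ennreal D * (ennreal (t powr (-2)) * indicator {s..} t)"
      using a[of t] weak[of t] assms(3) by (auto simp: indicator_def)
  qed
  also have "\<dots> = ennreal a * ennreal s + ennreal D * ennreal (1 / s)"
    using assms(3,4) nn_integral_powr_above[of s "-2"]
    by (subst nn_integral_add) (auto simp: nn_integral_cmult powr_minus divide_inverse)
  also have "\<dots> = ennreal (s * a + D / s)"
    using assms(3-5) by (simp add: mult.commute flip: ennreal_mult ennreal_plus)
  finally show ?thesis .
qed

text \<open>Young's inequality for \<open>|f| / a\<close> and \<open>|g| / b\<close>; stating the norms through upper bounds \<open>a\<close> and \<open>b\<close>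
  avoids roots of \<^typ>\<open>ennreal\<close> values.\<close>

lemma Holder_powint:
  assumes "1 < q" and r: "r = q / (q - 1)" and [measurable]: "f \<in> borel_measurable M" "g \<in> borel_measurable M"
    and "a \<ge> 0" "b \<ge> 0" and f: "powint M q f \<le> ennreal (a powr q)" and g: "powint M r g \<le> ennreal (b powr r)"
  shows "(\<integral>\<^sup>+x. ennreal (\<bar>f x\<bar> * \<bar>g x\<bar>) \<partial>M) \<le> ennreal (a * b)"
proof -
  have r1: "r > 1" "1/q + 1/r = 1" using assms(1) by (auto simp: r field_simps)
  have zero: "AE x in M. h x = 0" if "powint M p h \<le> ennreal (0 powr p)" "h \<in> borel_measurable M" for h :: "'a \<Rightarrow> real" and p
    using that unfolding powint_def by (auto simp: nn_integral_0_iff_AE)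
  show ?thesis
  proof (cases "a = 0 \<or> b = 0")
    case True
    have "AE x in M. ennreal (\<bar>f x\<bar> * \<bar>g x\<bar>) = 0"
      using True
    proof
      assume "a = 0" then have "AE x in M. f x = 0" using zero f by auto
      then show ?thesis by eventually_elim auto
    next
      assume "b = 0" then have "AE x in M. g x = 0" using zero g by auto
      then show ?thesis by eventually_elim auto
    qed
    then have "(\<integral>\<^sup>+x. ennreal (\<bar>f x\<bar> * \<bar>g x\<bar>) \<partial>M) = 0"
      by (subst nn_integral_0_iff_AE) auto
    then show ?thesis by simp
  next
    case False
    then have ab: "a > 0" "b > 0" using assms by auto
    let ?c = "a * b / (q * a powr q)" and ?d = "a * b / (r * b powr r)"
    have "(\<integral>\<^sup>+x. ennreal (\<bar>f x\<bar> * \<bar>g x\<bar>) \<partial>M)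
        \<le> (\<integral>\<^sup>+x. ennreal ?c * ennreal (\<bar>f x\<bar> powr q) + ennreal ?d * ennreal (\<bar>g x\<bar> powr r) \<partial>M)"
    proof (intro nn_integral_mono)
      fix x
      have "\<bar>f x\<bar> / a * (\<bar>g x\<bar> / b) \<le> (\<bar>f x\<bar> / a) powr q / q + (\<bar>g x\<bar> / b) powr r / r"
        using ab by (intro Youngs_inequality assms r1) auto
      then have "a * b * (\<bar>f x\<bar> / a * (\<bar>g x\<bar> / b)) \<le> a * b * ((\<bar>f x\<bar> / a) powr q / q + (\<bar>g x\<bar> / b) powr r / r)"
        using ab by (intro mult_left_mono) auto
      moreover have "a * b * (\<bar>f x\<bar> / a * (\<bar>g x\<bar> / b)) = \<bar>f x\<bar> * \<bar>g x\<bar>"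
        using ab by simp
      moreover have "a * b * ((\<bar>f x\<bar> / a) powr q / q + (\<bar>g x\<bar> / b) powr r / r) = ?c * \<bar>f x\<bar> powr q + ?d * \<bar>g x\<bar> powr r"
        using ab by (simp add: powr_divide distrib_left mult_ac)
      ultimately have "\<bar>f x\<bar> * \<bar>g x\<bar> \<le> ?c * \<bar>f x\<bar> powr q + ?d * \<bar>g x\<bar> powr r" by simp
      then show "ennreal (\<bar>f x\<bar> * \<bar>g x\<bar>) \<le> ennreal ?c * ennreal (\<bar>f x\<bar> powr q) + ennreal ?d * ennreal (\<bar>g x\<bar> powr r)"
        using ab assms(1) r1 by (simp flip: ennreal_mult ennreal_plus)
    qed
    also have "\<dots> = ennreal ?c * powint M q f + ennreal ?d * powint M r g"
      unfolding powint_def by (subst nn_integral_add) (auto simp: nn_integral_cmult)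
    also have "\<dots> \<le> ennreal ?c * ennreal (a powr q) + ennreal ?d * ennreal (b powr r)"
      by (intro add_mono mult_left_mono f g) auto
    also have "\<dots> = ennreal (?c * a powr q + ?d * b powr r)"
      using ab assms(1) r1 by (simp flip: ennreal_mult ennreal_plus)
    also have "?c * a powr q + ?d * b powr r = a * b * (1/q + 1/r)"
      using ab assms(1) r1(1) by (simp add: distrib_left)
    finally show ?thesis using r1 by simp
  qed
qed

lemma powr_add_le:
  assumes "a \<ge> 0" "b \<ge> 0" "q > (0::real)"
  shows "(a + b) powr q \<le> 2 powr q * (a powr q + b powr q)"
proof -
  have "(a + b) powr q \<le> (2 * max a b) powr q" using assms by (intro powr_mono2) auto
  also have "\<dots> = 2 powr q * (max a b) powr q" using assms by (simp add: powr_mult)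
  also have "(max a b) powr q \<le> a powr q + b powr q" by (auto simp: max_def)
  finally show ?thesis by simp
qed

section \<open>Bounded domains and the maximal function\<close>

text \<open>The number \<open>b\<close> is the dilation factor of the maximal function and the ratio of the scales that are
  used to decompose kernels. Vitali's covering lemma asks for \<open>b \<ge> 5\<close>; a kernel may force a larger
  value, since its smoothness is only known beyond a threshold.\<close>

locale bounded_domain =
  fixes \<Omega> :: "'a::euclidean_space set" and b V :: real and n :: nat
  assumes open_dom: "open \<Omega>" and bounded_dom: "bounded \<Omega>" and b_ge: "b \<ge> 5"
    and n_def: "n = DIM('a)" and V_def: "V = unit_ball_vol (real n)"
begin

abbreviation M :: "'a measure" where "M \<equiv> lebesgue_on \<Omega>"

lemma n_pos: "n \<ge> 1" by (simp add: n_def Suc_leI)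

lemma V_pos: "V > 0" by (simp add: V_def)

lemma b_simps [simp]: "b > 0" "b \<ge> 1" "b > 1" "b \<noteq> 0" "b \<ge> 0" using b_ge by auto

lemma dom_sets [measurable]: "\<Omega> \<in> sets lebesgue" "\<Omega> \<in> sets borel"
  using open_dom by (simp_all add: borel_open)

lemma space_M [simp]: "space M = \<Omega>" by simp

lemma id_measurable_M [measurable]: "(\<lambda>x. x) \<in> borel_measurable M"
  by (rule measurable_restrict_space1, rule measurable_completion) simp

lemma indicator_borel_M [measurable]:
  assumes "A \<in> sets borel"
  shows "(indicator A :: 'a \<Rightarrow> ennreal) \<in> borel_measurable M" "(indicator A :: 'a \<Rightarrow> real) \<in> borel_measurable M"
  using assms by (auto intro!: measurable_restrict_space1 borel_measurable_indicator)

lemma sets_M_ball [measurable]: "ball x r \<inter> \<Omega> \<in> sets M" "- ball x r \<inter> \<Omega> \<in> sets M"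
  by (simp_all add: sets_restrict_space_iff sets.Int Compl_in_sets_lebesgue)

lemma sets_M_open: "open S \<Longrightarrow> S \<subseteq> \<Omega> \<Longrightarrow> S \<in> sets M"
  by (simp add: sets_restrict_space_iff)

lemma finite_M: "finite_measure M"
proof
  have "emeasure lebesgue \<Omega> < \<infinity>"
    using emeasure_bounded_finite[OF bounded_dom] dom_sets by simp
  then show "emeasure M (space M) \<noteq> \<infinity>" by (simp add: emeasure_restrict_space)
qed

sublocale M: finite_measure M by (rule finite_M)

sublocale MM: pair_sigma_finite M M ..

definition dm :: "'a \<Rightarrow> real \<Rightarrow> real" where "dm x r = measure M (ball x r \<inter> \<Omega>)"

lemma emeasure_dm: "emeasure M (ball x r \<inter> \<Omega>) = ennreal (dm x r)"
  by (simp add: dm_def M.emeasure_eq_measure)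

lemma dm_nonneg [simp]: "dm x r \<ge> 0" by (simp add: dm_def)

lemma dm_mono: "ball x r \<inter> \<Omega> \<subseteq> ball y s \<Longrightarrow> dm x r \<le> dm y s"
  unfolding dm_def by (rule M.finite_measure_mono) auto

lemma dm_mono_radius: "r \<le> s \<Longrightarrow> dm x r \<le> dm x s"
  by (rule dm_mono) auto

text \<open>The growth condition, which takes the place of a doubling property.\<close>

lemma emeasure_M_ball_le: "r \<ge> 0 \<Longrightarrow> A \<in> sets M \<Longrightarrow> A \<subseteq> ball x r \<Longrightarrow> emeasure M A \<le> ennreal (V * r ^ n)"
proof -
  assume r: "r \<ge> 0" and A: "A \<in> sets M" "A \<subseteq> ball x r"
  have "emeasure M A = emeasure lebesgue A"
    using A sets.sets_into_space[OF A(1)] by (intro emeasure_restrict_space) auto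
  also have "\<dots> \<le> emeasure lebesgue (ball x r)"
    by (intro emeasure_mono A) auto
  also have "\<dots> = emeasure lborel (ball x r)" by simp
  also have "\<dots> = ennreal (V * r ^ n)" using r by (simp add: emeasure_ball V_def n_def)
  finally show ?thesis .
qed

lemma dm_le: "r \<ge> 0 \<Longrightarrow> dm x r \<le> V * r ^ n"
  using emeasure_M_ball_le[of r "ball x r \<inter> \<Omega>" x] V_pos
  by (simp add: emeasure_dm)

lemma dm_pos: "x \<in> \<Omega> \<Longrightarrow> r > 0 \<Longrightarrow> dm x r > 0"
proof -
  assume x: "x \<in> \<Omega>" and r: "r > 0"
  have "open (ball x r \<inter> \<Omega>)" "x \<in> ball x r \<inter> \<Omega>" using x r open_dom by auto
  then have "emeasure lebesgue (ball x r \<inter> \<Omega>) \<noteq> 0"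
    using open_not_negligible[of "ball x r \<inter> \<Omega>"] x r centre_in_ball[of x r] by (force simp: negligible_iff_emeasure0 borel_open)
  then have "emeasure M (ball x r \<inter> \<Omega>) \<noteq> 0"
    by (simp add: emeasure_restrict_space)
  then show ?thesis by (simp add: emeasure_dm order.strict_iff_order) 
qed

lemma null_sphere: "AE y in M. dist x y \<noteq> r"
proof -
  have "AE y in lebesgue. y \<notin> sphere x r"
    by (rule AE_not_in) (simp add: negligible_iff_null_sets[symmetric] negligible_sphere)
  then have "AE y in lebesgue. y \<in> \<Omega> \<longrightarrow> dist x y \<noteq> r" by eventually_elim auto
  then show ?thesis by (subst AE_restrict_space_iff) auto
qed

lemma powint_finite_imp_integrable:
  assumes [measurable]: "f \<in> borel_measurable M" and "powint M q f < \<infinity>" "q \<ge> 1"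
  shows "integrable M f"
proof (rule integrableI_bounded)
  have "(\<integral>\<^sup>+x. ennreal (norm (f x)) \<partial>M) \<le> (\<integral>\<^sup>+x. 1 + ennreal (\<bar>f x\<bar> powr q) \<partial>M)"
  proof (intro nn_integral_mono)
    fix x
    have "\<bar>f x\<bar> \<le> 1 + \<bar>f x\<bar> powr q"
    proof (cases "\<bar>f x\<bar> \<le> 1")
      case False
      then have "\<bar>f x\<bar> powr 1 \<le> \<bar>f x\<bar> powr q" using assms(3) by (intro powr_mono) auto
      then show ?thesis using False by simp
    qed (simp add: add_increasing2)
    then have "ennreal \<bar>f x\<bar> \<le> ennreal (1 + \<bar>f x\<bar> powr q)" by (rule ennreal_leI)
    then show "ennreal (norm (f x)) \<le> 1 + ennreal (\<bar>f x\<bar> powr q)"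
      by (simp add: ennreal_plus)
  qed
  also have "\<dots> = emeasure M \<Omega> + powint M q f"
    unfolding powint_def by (subst nn_integral_add) auto
  also have "\<dots> < \<infinity>" using assms(2) M.emeasure_finite[of \<Omega>] by (simp add: less_top[symmetric])
  finally show "(\<integral>\<^sup>+x. ennreal (norm (f x)) \<partial>M) < \<infinity>" .
qed fact

text \<open>The denominator uses the ball of radius \<open>b r\<close>. With the ball of radius \<open>r\<close> the covering argument
  would need a doubling measure.\<close>

definition maximal :: "('a \<Rightarrow> ennreal) \<Rightarrow> 'a \<Rightarrow> ennreal" where
  "maximal h x = (SUP r\<in>{0<..}. (\<integral>\<^sup>+y\<in>ball x r. h y \<partial>M) / ennreal (dm x (b * r)))"

lemma less_divide_iff_mult: "m > 0 \<Longrightarrow> t < I / ennreal m \<longleftrightarrow> t * ennreal m < I" for I t :: ennreal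
proof
  assume m: "m > 0" and "t < I / ennreal m"
  then have "\<not> I / ennreal m \<le> t" by simp
  then show "t * ennreal m < I"
    using m divide_le_posI_ennreal[of "ennreal m" I t] by (auto simp: mult.commute not_le[symmetric])
next
  assume m: "m > 0" and "t * ennreal m < I"
  moreover have "I / ennreal m * ennreal m = I"
    using m by (simp add: ennreal_divide_times ennreal_times_divide mult_divide_eq_ennreal)
  ultimately show "t < I / ennreal m"
    by (metis linorder_not_le mult_right_mono zero_le)
qed

lemma maximal_bound:
  assumes "x \<in> \<Omega>" "r > 0"
  shows "(\<integral>\<^sup>+y\<in>ball x r. h y \<partial>M) \<le> maximal h x * ennreal (dm x (b * r))"
proof (rule ccontr)
  assume "\<not> ?thesis"
  then have "maximal h x * ennreal (dm x (b * r)) < (\<integral>\<^sup>+y\<in>ball x r. h y \<partial>M)" by simp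
  then have "maximal h x < (\<integral>\<^sup>+y\<in>ball x r. h y \<partial>M) / ennreal (dm x (b * r))"
    using dm_pos[of x "b * r"] assms by (simp add: less_divide_iff_mult)
  also have "\<dots> \<le> maximal h x" unfolding maximal_def by (rule SUP_upper) (use assms in auto)
  finally show False by simp
qed

text \<open>Balls of radius above the diameter contain \<open>\<Omega>\<close>, so they all give the same quotient. The bound on
  the radii is what the Vitali covering lemma needs.\<close>

lemma less_maximalD:
  assumes "x \<in> \<Omega>" "t < maximal h x"
  obtains r where "r > 0" "r \<le> diameter \<Omega> + 1"
    "t * ennreal (dm x (b * r)) < (\<integral>\<^sup>+y\<in>ball x r. h y \<partial>M)"
proof -
  let ?I = "\<lambda>r. \<integral>\<^sup>+y. h y * indicator (ball x r) y \<partial>M" and ?D = "diameter \<Omega> + 1"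
  obtain r where r: "r > 0" "t < ?I r / ennreal (dm x (b * r))"
    using assms(2) unfolding maximal_def less_SUP_iff by auto
  then have *: "t * ennreal (dm x (b * r)) < ?I r"
    using dm_pos[of x "b * r"] assms(1) by (simp add: less_divide_iff_mult)
  have D: "\<Omega> \<subseteq> ball x ?D"
    using diameter_bounded_bound[OF bounded_dom assms(1)] by fastforce
  have "?D > 0" using diameter_ge_0[OF bounded_dom] by simp
  show thesis
  proof (cases "r \<le> ?D")
    case True then show thesis using r * that by blast
  next
    case False
    have eq: "?I r = ?I ?D"
      using D False by (intro nn_integral_cong) (auto simp: indicator_def)
    have "dm x (b * ?D) \<le> dm x (b * r)"
      using False by (intro dm_mono_radius) auto
    moreover have "t * ennreal (dm x (b * ?D)) \<le> t * ennreal (dm x (b * r))"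
      by (intro mult_left_mono ennreal_leI \<open>dm x (b * ?D) \<le> dm x (b * r)\<close>) auto
    ultimately have "t * ennreal (dm x (b * ?D)) < ?I ?D"
      using order_le_less_trans[OF _ *, of "t * ennreal (dm x (b * ?D))"] by (simp add: eq)
    then show thesis using that[of ?D] \<open>?D > 0\<close> by simp
  qed
qed

text \<open>A ball that witnesses a value above \<open>t\<close> still does so after shrinking its radius slightly; the room
  gained absorbs a small displacement of the centre.\<close>

lemma open_maximal_levels:
  assumes [measurable]: "h \<in> borel_measurable M"
  shows "open {x\<in>\<Omega>. t < maximal h x}"
proof (subst open_contains_ball, safe)
  fix x assume x: "x \<in> \<Omega>" and t: "t < maximal h x"
  obtain r where r: "r > 0" "t * ennreal (dm x (b * r)) < (\<integral>\<^sup>+y\<in>ball x r. h y \<partial>M)"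
    using less_maximalD[OF x t] by metis
  let ?r = "\<lambda>k::nat. r * (1 - 1 / (k + 1))"
  have mono: "?r k \<le> ?r l" if "k \<le> l" for k l
    using r that by (auto simp: frac_le)
  have "(\<Union>k. ball x (?r k)) = ball x r"
  proof safe
    fix y k assume "y \<in> ball x (?r k)"
    moreover have "?r k \<le> r" using r by (simp add: mult_le_cancel_left1 field_simps)
    ultimately show "y \<in> ball x r" by simp
  next
    fix y assume y: "y \<in> ball x r"
    have "?r \<longlonglongrightarrow> r * (1 - 0)"
      using LIMSEQ_inverse_real_of_nat by (intro tendsto_intros) (simp add: inverse_eq_divide add.commute)
    then have "\<forall>\<^sub>F k in sequentially. dist x y < ?r k"
      using y by (intro order_tendstoD) auto
    then show "y \<in> (\<Union>k. ball x (?r k))"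
      by (auto simp: eventually_sequentially)
  qed
  then have "ball x r \<inter> \<Omega> = (\<Union>k. ball x (?r k) \<inter> \<Omega>)" by auto
  then have "emeasure (density M h) (ball x r \<inter> \<Omega>) = (SUP k. emeasure (density M h) (ball x (?r k) \<inter> \<Omega>))"
    using mono by (subst SUP_emeasure_incseq) (auto simp: incseq_def intro!: sets_M_ball, force)
  moreover have I: "emeasure (density M h) (ball x s \<inter> \<Omega>) = (\<integral>\<^sup>+y\<in>ball x s. h y \<partial>M)" for s
    by (subst emeasure_density) (auto intro!: nn_integral_cong sets_M_ball simp: indicator_def)
  ultimately obtain k where k: "t * ennreal (dm x (b * r)) < (\<integral>\<^sup>+y\<in>ball x (?r k). h y \<partial>M)"
    using r(2) by (auto simp: less_SUP_iff)
  define s where "s = ?r k"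
  have "s < r" using r by (simp add: s_def field_simps)
  have "s \<ge> 0" using r by (simp add: s_def field_simps)
  \<comment> \<open>With this displacement \<open>b (s + \<eta>) + b \<eta> = b r\<close>.\<close>
  define \<eta> where "\<eta> = (r - s) / 2"
  have \<eta>: "\<eta> > 0" using \<open>s < r\<close> by (simp add: \<eta>_def)
  obtain \<delta> where \<delta>: "\<delta> > 0" "ball x \<delta> \<subseteq> \<Omega>" using x open_dom open_contains_ball by blast
  show "\<exists>e>0. ball x e \<subseteq> {x \<in> \<Omega>. t < maximal h x}"
  proof (intro exI conjI subsetI)
    show "min \<eta> \<delta> > 0" using \<eta> \<delta> by simp
    fix z assume z: "z \<in> ball x (min \<eta> \<delta>)"
    then have z\<Omega>: "z \<in> \<Omega>" using \<delta> by auto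
    have "dm z (b * (s + \<eta>)) \<le> dm x (b * r)"
    proof (rule dm_mono, rule subsetI)
      fix y assume y: "y \<in> ball z (b * (s + \<eta>)) \<inter> \<Omega>"
      have "dist x y \<le> dist x z + dist z y" by (rule dist_triangle)
      also have "\<dots> < \<eta> + b * (s + \<eta>)" using y z by (intro add_strict_mono) auto
      also have "\<dots> \<le> b * \<eta> + b * (s + \<eta>)" using \<eta> by simp
      also have "\<dots> = b * r" by (simp add: \<eta>_def field_simps)
      finally show "y \<in> ball x (b * r)" by simp
    qed
    then have "t * ennreal (dm z (b * (s + \<eta>))) \<le> t * ennreal (dm x (b * r))"
      by (intro mult_left_mono ennreal_leI) auto
    also have "\<dots> < (\<integral>\<^sup>+y\<in>ball x s. h y \<partial>M)" using k by (simp add: s_def)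
    also have "\<dots> \<le> (\<integral>\<^sup>+y\<in>ball z (s + \<eta>). h y \<partial>M)"
    proof (intro nn_integral_mono mult_left_mono)
      fix y
      have "dist z y < s + \<eta>" if "dist x y < s"
        using dist_triangle[of z y x] that z by (simp add: dist_commute)
      then show "indicator (ball x s) y \<le> (indicator (ball z (s + \<eta>)) y :: ennreal)"
        by (auto simp: indicator_def)
    qed simp
    finally have "t < (\<integral>\<^sup>+y\<in>ball z (s + \<eta>). h y \<partial>M) / ennreal (dm z (b * (s + \<eta>)))"
      using dm_pos[OF z\<Omega>, of "b * (s + \<eta>)"] \<eta> \<open>s \<ge> 0\<close> by (simp add: less_divide_iff_mult)
    also have "\<dots> \<le> maximal h z" unfolding maximal_def
      using \<eta> \<open>s \<ge> 0\<close> by (intro SUP_upper) auto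
    finally show "z \<in> {x \<in> \<Omega>. t < maximal h x}" using z\<Omega> by simp
  qed
qed

text \<open>Vitali: disjoint balls \<open>B(x\<^sub>i,r\<^sub>i)\<close> carry mass more than \<open>t |B(x\<^sub>i, b r\<^sub>i) \<inter> \<Omega>|\<close> each, and the balls
  \<open>B(x\<^sub>i, 5 r\<^sub>i)\<close> cover the level set.\<close>

lemma maximal_weak_type:
  assumes [measurable]: "h \<in> borel_measurable M"
  shows "t * emeasure M {x\<in>\<Omega>. t < maximal h x} \<le> (\<integral>\<^sup>+y. h y \<partial>M)"
proof -
  define S where "S = {x\<in>\<Omega>. t < maximal h x}"
  have S: "S \<in> sets M" unfolding S_def
    by (intro sets_M_open open_maximal_levels) auto
  have "\<forall>x\<in>S. \<exists>r. r > 0 \<and> r \<le> diameter \<Omega> + 1 \<and>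
     t * ennreal (dm x (b * r)) < (\<integral>\<^sup>+y\<in>ball x r. h y \<partial>M)"
    unfolding S_def by (auto elim: less_maximalD)
  then obtain r where r: "\<And>x. x \<in> S \<Longrightarrow> r x > 0" "\<And>x. x \<in> S \<Longrightarrow> r x \<le> diameter \<Omega> + 1"
     "\<And>x. x \<in> S \<Longrightarrow> t * ennreal (dm x (b * r x)) < (\<integral>\<^sup>+y\<in>ball x (r x). h y \<partial>M)"
    by metis
  have "S \<subseteq> (\<Union>i\<in>S. ball i (r i))" using r(1) by auto
  then obtain C where C: "countable C" "C \<subseteq> S"
    "pairwise (\<lambda>i j. disjnt (ball i (r i)) (ball j (r j))) C" "S \<subseteq> (\<Union>i\<in>C. ball i (5 * r i))"
    by (rule Vitali_covering_lemma_balls[where B="diameter \<Omega> + 1"]) (auto intro: r)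
  have "t * emeasure M S = t * (\<integral>\<^sup>+y. indicator S y \<partial>M)" using S by simp
  also have "\<dots> \<le> t * (\<integral>\<^sup>+y. (\<integral>\<^sup>+i. indicator (ball i (b * r i) \<inter> \<Omega>) y \<partial>count_space C) \<partial>M)"
  proof (intro mult_left_mono nn_integral_mono)
    fix y assume "y \<in> space M"
    show "indicator S y \<le> (\<integral>\<^sup>+i. indicator (ball i (b * r i) \<inter> \<Omega>) y \<partial>count_space C)"
    proof (cases "y \<in> S")
      case True
      then obtain i where i: "i \<in> C" "y \<in> ball i (5 * r i)" using C by auto
      have "5 * r i \<le> b * r i" using b_ge r(1)[of i] i C by (intro mult_right_mono) auto
      then have "y \<in> ball i (b * r i) \<inter> \<Omega>" using i True S_def by auto
      then have "1 \<le> (indicator (ball i (b * r i) \<inter> \<Omega>) y :: ennreal)" by simp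
      also have "\<dots> \<le> (\<integral>\<^sup>+i. indicator (ball i (b * r i) \<inter> \<Omega>) y \<partial>count_space C)"
        by (rule nn_integral_ge_point[OF i(1)])
      finally show ?thesis using True by simp
    qed simp
  qed simp
  also have "\<dots> = t * (\<integral>\<^sup>+i. ennreal (dm i (b * r i)) \<partial>count_space C)"
    by (subst nn_integral_count_space_nn_integral) (simp_all add: C sets_M_ball emeasure_dm)
  also have "\<dots> = (\<integral>\<^sup>+i. t * ennreal (dm i (b * r i)) \<partial>count_space C)"
    by (rule nn_integral_cmult[symmetric]) simp
  also have "\<dots> \<le> (\<integral>\<^sup>+i. (\<integral>\<^sup>+y\<in>ball i (r i) \<inter> \<Omega>. h y \<partial>M) \<partial>count_space C)"
  proof (intro nn_integral_mono)
    fix i assume "i \<in> space (count_space C)"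
    then have "t * ennreal (dm i (b * r i)) \<le> (\<integral>\<^sup>+y\<in>ball i (r i). h y \<partial>M)"
      using r(3)[of i] C by auto
    also have "\<dots> = (\<integral>\<^sup>+y\<in>ball i (r i) \<inter> \<Omega>. h y \<partial>M)"
      by (intro nn_integral_cong) (auto simp: indicator_def)
    finally show "t * ennreal (dm i (b * r i)) \<le> (\<integral>\<^sup>+y\<in>ball i (r i) \<inter> \<Omega>. h y \<partial>M)" .
  qed
  also have "\<dots> = (\<integral>\<^sup>+i. emeasure (density M h) (ball i (r i) \<inter> \<Omega>) \<partial>count_space C)"
    by (intro nn_integral_cong) (simp add: emeasure_density sets_M_ball)
  also have "\<dots> = emeasure (density M h) (\<Union>i\<in>C. ball i (r i) \<inter> \<Omega>)"
    using C by (intro emeasure_UN_countable[symmetric])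
       (auto simp: disjoint_family_on_def pairwise_def disjnt_def intro!: sets_M_ball)
  also have "\<dots> \<le> emeasure (density M h) (space (density M h))" by (rule emeasure_space)
  also have "\<dots> = (\<integral>\<^sup>+y. h y \<partial>M)"
    by (subst emeasure_density) (auto intro!: nn_integral_cong simp: sets.top)
  finally show ?thesis by (simp add: S_def)
qed

text \<open>Tails of kernels are estimated in this way: the exterior of \<open>B(x,\<rho>)\<close> is cut into geometric annuli, and
  on each the kernel is replaced by a constant.\<close>

lemma annuli_sum_bound:
  assumes [measurable]: "h \<in> borel_measurable M" and \<rho>: "\<rho> > 0" and \<beta>: "\<beta> > 1"
    and g: "\<And>j y. y \<in> \<Omega> \<Longrightarrow> \<beta> ^ j * \<rho> \<le> dist x y \<Longrightarrow> dist x y < \<beta> ^ Suc j * \<rho> \<Longrightarrow> g y \<le> u j * h y"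
  shows "(\<integral>\<^sup>+y\<in>{y. \<rho> \<le> dist x y}. g y \<partial>M)
     \<le> (\<Sum>j. u j * (\<integral>\<^sup>+y\<in>ball x (\<beta> ^ Suc j * \<rho>). h y \<partial>M))"
proof -
  have "(\<integral>\<^sup>+y\<in>{y. \<rho> \<le> dist x y}. g y \<partial>M)
     \<le> (\<integral>\<^sup>+y. (\<Sum>j. u j * (h y * indicator (ball x (\<beta> ^ Suc j * \<rho>)) y)) \<partial>M)"
  proof (intro nn_integral_mono)
    fix y assume "y \<in> space M"
    then have y: "y \<in> \<Omega>" by simp
    show "g y * indicator {y. \<rho> \<le> dist x y} y \<le> (\<Sum>j. u j * (h y * indicator (ball x (\<beta> ^ Suc j * \<rho>)) y))"
    proof (cases "\<rho> \<le> dist x y")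
      case True
      obtain m where "dist x y / \<rho> < \<beta> ^ m" using real_arch_pow[OF \<beta>] by blast
      then have "dist x y < \<beta> ^ m * \<rho>" using \<rho> by (simp add: field_simps)
      moreover have "\<beta> ^ m \<le> \<beta> ^ Suc m" using \<beta> by (intro power_increasing) auto
      ultimately have ex: "dist x y < \<beta> ^ Suc m * \<rho>"
        using \<rho> by (meson less_le_not_le mult_right_mono order_less_le_trans order_less_imp_le)
      define j where "j = (LEAST j. dist x y < \<beta> ^ Suc j * \<rho>)"
      have j: "dist x y < \<beta> ^ Suc j * \<rho>" unfolding j_def by (rule LeastI[of _ m]) fact
      have "\<beta> ^ j * \<rho> \<le> dist x y"
      proof (cases j)
        case 0 then show ?thesis using True by simp
      next
        case (Suc i)
        then have "i < (LEAST j. dist x y < \<beta> ^ Suc j * \<rho>)" by (simp add: j_def)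
        then show ?thesis using not_less_Least Suc by fastforce
      qed
      then have "g y * indicator {y. \<rho> \<le> dist x y} y \<le> u j * (h y * indicator (ball x (\<beta> ^ Suc j * \<rho>)) y)"
        using g[OF y _ j] True j by (simp add: indicator_def)
      also have "\<dots> \<le> (\<Sum>j. u j * (h y * indicator (ball x (\<beta> ^ Suc j * \<rho>)) y))"
        using sum_le_suminf[of "\<lambda>j. u j * (h y * indicator (ball x (\<beta> ^ Suc j * \<rho>)) y)" "{j}"] by simp
      finally show ?thesis .
    qed simp
  qed
  also have "\<dots> = (\<Sum>j. u j * (\<integral>\<^sup>+y\<in>ball x (\<beta> ^ Suc j * \<rho>). h y \<partial>M))"
    by (subst nn_integral_suminf) (auto simp: nn_integral_cmult)
  finally show ?thesis .
qed

end

section \<open>Calderon-Zygmund kernels and their truncations\<close>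

text \<open>The number \<open>\<omega> k\<close> bounds the oscillation of the kernel when the displacement is at most \<open>b\<^sup>-\<^sup>(\<^sup>k\<^sup>+\<^sup>1\<^sup>)\<close> times
  the distance; summability of \<open>\<omega>\<close> is the Dini condition. The hypotheses are symmetric in the two
  variables, so that every result also holds for the transposed kernel.\<close>

locale cz_kernel_domain = bounded_domain \<Omega> b V n
  for \<Omega> :: "'a::euclidean_space set" and b V :: real and n :: nat +
  fixes K :: "'a \<Rightarrow> 'a \<Rightarrow> real" and C :: real and \<omega> :: "nat \<Rightarrow> real"
  assumes C_pos: "C > 0" and \<omega>_nonneg: "\<And>k. \<omega> k \<ge> 0" and \<omega>_summable: "summable \<omega>"
    and size: "\<And>x y. x \<in> \<Omega> \<Longrightarrow> y \<in> \<Omega> \<Longrightarrow> x \<noteq> y \<Longrightarrow> \<bar>K x y\<bar> \<le> C / dist x y ^ n"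
    and smooth_fst: "\<And>x z y k \<rho>. x \<in> \<Omega> \<Longrightarrow> z \<in> \<Omega> \<Longrightarrow> y \<in> \<Omega> \<Longrightarrow> \<rho> > 0 \<Longrightarrow> dist x z \<le> \<rho> \<Longrightarrow>
       b ^ Suc k * \<rho> \<le> dist x y \<Longrightarrow> \<bar>K x y - K z y\<bar> \<le> \<omega> k / dist x y ^ n"
    and smooth_snd: "\<And>x z y k \<rho>. x \<in> \<Omega> \<Longrightarrow> z \<in> \<Omega> \<Longrightarrow> y \<in> \<Omega> \<Longrightarrow> \<rho> > 0 \<Longrightarrow> dist x z \<le> \<rho> \<Longrightarrow>
       b ^ Suc k * \<rho> \<le> dist x y \<Longrightarrow> \<bar>K y x - K y z\<bar> \<le> \<omega> k / dist x y ^ n"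
begin

lemma transpose: "cz_kernel_domain \<Omega> b V n (\<lambda>x y. K y x) C \<omega>"
proof unfold_locales
  fix x y assume "x \<in> \<Omega>" "y \<in> \<Omega>" "x \<noteq> y"
  then show "\<bar>K y x\<bar> \<le> C / dist x y ^ n" using size[of y x] by (simp add: dist_commute)
qed (use C_pos \<omega>_nonneg \<omega>_summable smooth_fst smooth_snd in auto)

text \<open>The constant in the Hoermander condition.\<close>

definition W :: real where "W = b ^ n * suminf \<omega>"

lemma W_nonneg: "W \<ge> 0"
  unfolding W_def using \<omega>_nonneg \<omega>_summable by (simp add: suminf_nonneg)

text \<open>This provides the joint measurability of the kernel: summability forces \<open>\<omega> k\<close> to tend to \<open>0\<close>, hence
  the kernel is continuous in each variable, locally uniformly in the other.\<close>

lemma kernel_continuous: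
  "continuous_on {p. fst p \<in> \<Omega> \<and> snd p \<in> \<Omega> \<and> fst p \<noteq> snd p} (\<lambda>p. K (fst p) (snd p))"
  unfolding continuous_on_iff
proof safe
  fix x y :: 'a and \<epsilon> :: real
  assume "\<epsilon> > 0" and xy: "fst (x, y) \<in> \<Omega>" "snd (x, y) \<in> \<Omega>" "fst (x, y) \<noteq> snd (x, y)"
  define d where "d = dist x y"
  have d: "d > 0" using xy by (simp add: d_def)
  have "\<omega> \<longlonglongrightarrow> 0" by (rule summable_LIMSEQ_zero[OF \<omega>_summable])
  then have "\<forall>\<^sub>F k in sequentially. \<omega> k < \<epsilon> / 2 * (d/2) ^ n"
    using \<open>\<epsilon> > 0\<close> d by (intro order_tendstoD(2)) auto
  then obtain k where k: "\<omega> k < \<epsilon> / 2 * (d/2) ^ n" by (auto simp: eventually_sequentially)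
  define \<rho> where "\<rho> = d / (2 * b ^ Suc k)"
  have \<rho>: "\<rho> > 0" using d by (simp add: \<rho>_def)
  have b\<rho>: "b ^ Suc k * \<rho> = d / 2" by (simp add: \<rho>_def)
  have "1 \<le> b ^ Suc k" by (intro one_le_power) simp
  then have "\<rho> \<le> d / 2" using d unfolding \<rho>_def by (intro divide_left_mono) (auto intro: mult_pos_pos)
  have small: "\<omega> k / D ^ n < \<epsilon> / 2" if "d / 2 \<le> D" for D
  proof -
    have "\<omega> k < \<epsilon> / 2 * (d/2) ^ n" by (rule k)
    also have "\<dots> \<le> \<epsilon> / 2 * D ^ n" using that d \<open>\<epsilon> > 0\<close> by (intro mult_left_mono power_mono) auto
    finally show ?thesis using that d by (simp add: divide_less_eq)
  qed
  show "\<exists>\<delta>>0. \<forall>p\<in>{p. fst p \<in> \<Omega> \<and> snd p \<in> \<Omega> \<and> fst p \<noteq> snd p}. dist p (x, y) < \<delta> \<longrightarrow>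
      dist (K (fst p) (snd p)) (K (fst (x, y)) (snd (x, y))) < \<epsilon>"
  proof (intro exI[of _ \<rho>] conjI \<rho> ballI impI)
    fix p :: "'a \<times> 'a" assume p: "p \<in> {p. fst p \<in> \<Omega> \<and> snd p \<in> \<Omega> \<and> fst p \<noteq> snd p}" "dist p (x, y) < \<rho>"
    obtain x' y' where [simp]: "p = (x', y')" by force
    have x': "dist x x' \<le> \<rho>" using p(2) dist_fst_le[of p "(x,y)"] by (simp add: dist_commute)
    have y': "dist y y' \<le> \<rho>" using p(2) dist_snd_le[of p "(x,y)"] by (simp add: dist_commute)
    have "d \<le> dist x x' + dist x' y" unfolding d_def by (rule dist_triangle)
    then have "d / 2 \<le> dist y x'" using x' \<open>\<rho> \<le> d / 2\<close> by (simp add: dist_commute)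
    have "b ^ Suc k * \<rho> \<le> dist x y" unfolding b\<rho> using d by (simp add: d_def)
    then have "\<bar>K x y - K x' y\<bar> \<le> \<omega> k / dist x y ^ n"
      using x' xy p \<rho> by (intro smooth_fst) auto
    also have "\<dots> < \<epsilon> / 2" using d by (intro small) (simp add: d_def)
    finally have 1: "\<bar>K x y - K x' y\<bar> < \<epsilon> / 2" .
    have "\<bar>K x' y - K x' y'\<bar> \<le> \<omega> k / dist y x' ^ n"
      using y' xy p \<rho> b\<rho> \<open>d / 2 \<le> dist y x'\<close> by (intro smooth_snd) auto
    also have "\<dots> < \<epsilon> / 2" by (intro small) fact
    finally have "\<bar>K x' y - K x' y'\<bar> < \<epsilon> / 2" .
    with 1 show "dist (K (fst p) (snd p)) (K (fst (x, y)) (snd (x, y))) < \<epsilon>"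
      unfolding dist_real_def by (simp only: \<open>p = (x', y')\<close> fst_conv snd_conv)
  qed
qed

text \<open>Extended by zero off \<open>\<Omega> \<times> \<Omega>\<close> and near the diagonal, the kernel is a bounded Borel function on the
  whole product space.\<close>

definition Kt :: "real \<Rightarrow> 'a \<Rightarrow> 'a \<Rightarrow> real" where
  "Kt e x y = (if x \<in> \<Omega> \<and> y \<in> \<Omega> \<and> 0 < e \<and> e \<le> dist x y then K x y else 0)"

lemma Kt_borel: "(\<lambda>p. Kt e (fst p) (snd p)) \<in> borel_measurable borel"
proof -
  let ?W = "{p. fst p \<in> \<Omega> \<and> snd p \<in> \<Omega> \<and> fst p \<noteq> snd p}"
  have "?W = (\<Omega> \<times> \<Omega>) \<inter> {p. fst p \<noteq> snd p}" by auto
  moreover have "open {p :: 'a \<times> 'a. fst p \<noteq> snd p}"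
    by (intro open_Collect_neq continuous_intros)
  ultimately have "open ?W" using open_dom by (auto intro: open_Times)
  then have m: "(\<lambda>p. if p \<in> ?W then K (fst p) (snd p) else 0) \<in> borel_measurable borel"
    by (intro borel_measurable_continuous_on_if kernel_continuous borel_open continuous_intros)
  have "{p :: 'a \<times> 'a. e \<le> dist (fst p) (snd p)} \<in> sets borel"
    by (intro borel_closed closed_Collect_le continuous_intros)
  then have "(\<lambda>p. indicator {p. e \<le> dist (fst p) (snd p)} p * of_bool (0 < e) * (if p \<in> ?W then K (fst p) (snd p) else 0)) \<in> borel_measurable borel"
    using m by (intro borel_measurable_times borel_measurable_indicator) auto
  also have "(\<lambda>p. indicator {p. e \<le> dist (fst p) (snd p)} p * of_bool (0 < e) * (if p \<in> ?W then K (fst p) (snd p) else 0))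
      = (\<lambda>p. Kt e (fst p) (snd p))"
    by (auto simp: fun_eq_iff Kt_def)
  finally show ?thesis .
qed

lemma Kt_measurable [measurable (raw)]:
  assumes "u \<in> borel_measurable N" "v \<in> borel_measurable N"
  shows "(\<lambda>z. Kt e (u z) (v z)) \<in> borel_measurable N"
proof -
  have "(\<lambda>z. (u z, v z)) \<in> borel_measurable N" using assms by measurable
  from measurable_compose[OF this Kt_borel] show ?thesis by simp
qed

lemma Kt_size: "x \<in> \<Omega> \<Longrightarrow> y \<in> \<Omega> \<Longrightarrow> 0 < r \<Longrightarrow> r \<le> dist x y \<Longrightarrow> \<bar>Kt e x y\<bar> \<le> C / r ^ n"
proof -
  assume a: "x \<in> \<Omega>" "y \<in> \<Omega>" "0 < r" "r \<le> dist x y"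
  then have "x \<noteq> y" by auto
  then have "\<bar>Kt e x y\<bar> \<le> C / dist x y ^ n"
    using a size[of x y] C_pos by (auto simp: Kt_def)
  also have "\<dots> \<le> C / r ^ n" using a C_pos \<open>x \<noteq> y\<close> by (intro divide_left_mono power_mono) auto
  finally show ?thesis .
qed

lemma Kt_bound: "e > 0 \<Longrightarrow> \<bar>Kt e x y\<bar> \<le> C / e ^ n"
  using Kt_size[of x y e e] C_pos by (auto simp: Kt_def)

definition trunc :: "real \<Rightarrow> ('a \<Rightarrow> real) \<Rightarrow> 'a \<Rightarrow> real" where
  "trunc e f x = (\<integral>y. Kt e x y * f y \<partial>M)"

lemma trunc_measurable [measurable]:
  assumes [measurable]: "f \<in> borel_measurable M"
  shows "trunc e f \<in> borel_measurable M"
  unfolding trunc_def by measurable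

lemma Kt_integrable:
  assumes f: "integrable M f"
  shows "integrable M (\<lambda>y. Kt e x y * f y)"
proof (cases "e > 0")
  case True
  have [measurable]: "f \<in> borel_measurable M" using f by auto
  have "integrable M (\<lambda>y. C / e ^ n * f y)" using f by simp
  then show ?thesis
  proof (rule Bochner_Integration.integrable_bound)
    show "AE y in M. norm (Kt e x y * f y) \<le> norm (C / e ^ n * f y)"
    proof (rule AE_I2)
      fix y show "norm (Kt e x y * f y) \<le> norm (C / e ^ n * f y)"
        using mult_right_mono[OF Kt_bound[OF True, of x y], of "\<bar>f y\<bar>"] True C_pos by (simp add: abs_mult)
    qed
  qed measurable
qed (simp add: Kt_def)

lemma trunc_add: "integrable M f \<Longrightarrow> integrable M g \<Longrightarrow> trunc e (\<lambda>y. f y + g y) x = trunc e f x + trunc e g x"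
  unfolding trunc_def by (simp add: distrib_left Kt_integrable)

lemma trunc_diff: "integrable M f \<Longrightarrow> integrable M g \<Longrightarrow> trunc e (\<lambda>y. f y - g y) x = trunc e f x - trunc e g x"
  unfolding trunc_def by (simp add: right_diff_distrib Kt_integrable)

lemma trunc_sup_bound:
  assumes "integrable M f" "e > 0"
  shows "\<bar>trunc e f x\<bar> \<le> C / e ^ n * (\<integral>y. \<bar>f y\<bar> \<partial>M)"
proof -
  have "\<bar>trunc e f x\<bar> \<le> (\<integral>y. \<bar>Kt e x y * f y\<bar> \<partial>M)" unfolding trunc_def by (rule integral_abs_bound)
  also have "\<dots> \<le> (\<integral>y. C / e ^ n * \<bar>f y\<bar> \<partial>M)"
    using assms Kt_bound[OF assms(2)]
    by (intro integral_mono integrable_abs Kt_integrable) (auto simp only: abs_mult intro!: mult_right_mono integrable_mult_right integrable_abs)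
  finally show ?thesis by simp
qed

lemma abs_integral_diff_le:
  assumes "integrable M u" "integrable M v" and "\<And>y. y \<in> \<Omega> \<Longrightarrow> ennreal \<bar>u y - v y\<bar> \<le> g y"
  shows "ennreal \<bar>(\<integral>y. u y \<partial>M) - (\<integral>y. v y \<partial>M)\<bar> \<le> (\<integral>\<^sup>+y. g y \<partial>M)"
proof -
  have "ennreal \<bar>(\<integral>y. u y \<partial>M) - (\<integral>y. v y \<partial>M)\<bar> = ennreal (norm (\<integral>y. u y - v y \<partial>M))"
    using assms by simp
  also have "\<dots> \<le> (\<integral>\<^sup>+y. ennreal (norm (u y - v y)) \<partial>M)"
    by (intro integral_norm_bound_ennreal) (use assms in auto)
  also have "\<dots> \<le> (\<integral>\<^sup>+y. g y \<partial>M)"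
    by (intro nn_integral_mono) (use assms(3) in auto)
  finally show ?thesis .
qed

lemma trunc_step:
  assumes f: "integrable M f" and e: "0 < e" "e \<le> e'"
  shows "ennreal \<bar>trunc e f x - trunc e' f x\<bar>
      \<le> ennreal (C / e ^ n) * (\<integral>\<^sup>+y\<in>ball x e'. ennreal \<bar>f y\<bar> \<partial>M)"
proof -
  have [measurable]: "f \<in> borel_measurable M" using f by auto
  have "ennreal \<bar>trunc e f x - trunc e' f x\<bar>
      \<le> (\<integral>\<^sup>+y. ennreal (C / e ^ n) * (ennreal \<bar>f y\<bar> * indicator (ball x e') y) \<partial>M)"
    unfolding trunc_def
  proof (rule abs_integral_diff_le)
    fix y assume y: "y \<in> \<Omega>"
    show "ennreal \<bar>Kt e x y * f y - Kt e' x y * f y\<bar> \<le> ennreal (C / e ^ n) * (ennreal \<bar>f y\<bar> * indicator (ball x e') y)"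
    proof (cases "dist x y < e'")
      case True
      then have "\<bar>Kt e x y * f y - Kt e' x y * f y\<bar> = \<bar>Kt e x y\<bar> * \<bar>f y\<bar>"
        by (simp add: Kt_def abs_mult)
      also have "\<dots> \<le> C / e ^ n * \<bar>f y\<bar>" by (intro mult_right_mono Kt_bound e) auto
      finally have "ennreal \<bar>Kt e x y * f y - Kt e' x y * f y\<bar> \<le> ennreal (C / e ^ n * \<bar>f y\<bar>)" by (rule ennreal_leI)
      also have "\<dots> = ennreal (C / e ^ n) * ennreal \<bar>f y\<bar>" using C_pos e by (intro ennreal_mult) auto
      finally show ?thesis using True by simp
    next
      case False
      then show ?thesis using e by (simp add: Kt_def)
    qed
  qed (use f Kt_integrable in auto)
  then show ?thesis by (simp add: nn_integral_cmult)
qed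

lemma transpose_Kt: "cz_kernel_domain.Kt \<Omega> (\<lambda>x y. K y x) e x y = Kt e y x"
  unfolding cz_kernel_domain.Kt_def[OF transpose] Kt_def by (auto simp: dist_commute)

lemma trunc_duality:
  assumes f: "integrable M f" and g: "integrable M g"
  shows "(\<integral>x. trunc e f x * g x \<partial>M) = (\<integral>y. f y * cz_kernel_domain.trunc \<Omega> (\<lambda>x y. K y x) e g y \<partial>M)"
proof -
  have [measurable]: "f \<in> borel_measurable M" "g \<in> borel_measurable M" using f g by auto
  have int: "integrable (M \<Otimes>\<^sub>M M) (\<lambda>(x,y). Kt e x y * f y * g x)"
  proof (cases "e > 0")
    case True
    have "integrable (M \<Otimes>\<^sub>M M) (\<lambda>p. C / e ^ n * (\<bar>g (fst p)\<bar> * \<bar>f (snd p)\<bar>))"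
    proof (intro integrable_mult_right MM.Fubini_integrable)
      have "integrable M (\<lambda>x. (\<integral>y. \<bar>f y\<bar> \<partial>M) * \<bar>g x\<bar>)" using g by auto
      then show "integrable M (\<lambda>x. \<integral>y. norm (\<bar>g (fst (x,y))\<bar> * \<bar>f (snd (x,y))\<bar>) \<partial>M)"
        by (simp add: abs_mult mult.commute)
    qed (use f in \<open>auto intro!: AE_I2\<close>)
    then show ?thesis
    proof (rule Bochner_Integration.integrable_bound)
      show "AE p in M \<Otimes>\<^sub>M M. norm (case p of (x,y) \<Rightarrow> Kt e x y * f y * g x) \<le> norm (C / e ^ n * (\<bar>g (fst p)\<bar> * \<bar>f (snd p)\<bar>))"
      proof (rule AE_I2)
        fix p show "norm (case p of (x,y) \<Rightarrow> Kt e x y * f y * g x) \<le> norm (C / e ^ n * (\<bar>g (fst p)\<bar> * \<bar>f (snd p)\<bar>))"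
          using mult_right_mono[OF Kt_bound[OF True, of "fst p" "snd p"], of "\<bar>g (fst p)\<bar> * \<bar>f (snd p)\<bar>"] C_pos True
          by (auto simp: split_beta abs_mult mult_ac)
      qed
    qed measurable
  qed (simp add: Kt_def case_prod_beta')
  have "(\<integral>x. trunc e f x * g x \<partial>M) = (\<integral>x. (\<integral>y. Kt e x y * f y * g x \<partial>M) \<partial>M)"
    unfolding trunc_def by (simp add: Kt_integrable f)
  also have "\<dots> = (\<integral>y. (\<integral>x. Kt e x y * f y * g x \<partial>M) \<partial>M)"
    by (rule MM.Fubini_integral[symmetric]) (rule int)
  also have "\<dots> = (\<integral>y. f y * (\<integral>x. Kt e x y * g x \<partial>M) \<partial>M)"
  proof (intro Bochner_Integration.integral_cong refl)
    fix y
    have "(\<lambda>x. Kt e x y * f y * g x) = (\<lambda>x. f y * (Kt e x y * g x))" by (auto simp: mult_ac)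
    then show "(\<integral>x. Kt e x y * f y * g x \<partial>M) = f y * (\<integral>x. Kt e x y * g x \<partial>M)"
      by simp
  qed
  finally show ?thesis
    by (simp add: cz_kernel_domain.trunc_def[OF transpose] transpose_Kt)
qed

text \<open>Hoermander's condition, tested against \<open>h\<close> instead of \<open>1\<close>: all that matters about \<open>h\<close> is that its
  mass in balls around \<open>x\<close> grows at most like \<open>m r\<^sup>n\<close>.\<close>

lemma hormander:
  assumes [measurable]: "h \<in> borel_measurable M" and x: "x \<in> \<Omega>" and z: "z \<in> \<Omega>" and R: "R > 0" "dist x z \<le> R"
    and m: "m \<ge> 0" "\<And>r. r > 0 \<Longrightarrow> (\<integral>\<^sup>+y\<in>ball x r. h y \<partial>M) \<le> ennreal (m * r ^ n)"
  shows "(\<integral>\<^sup>+y. ennreal \<bar>K x y - K z y\<bar> * h y * indicator {y. b * R \<le> dist x y} y \<partial>M) \<le> ennreal (W * m)"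
proof -
  have "(\<integral>\<^sup>+y. ennreal \<bar>K x y - K z y\<bar> * h y * indicator {y. b * R \<le> dist x y} y \<partial>M)
     \<le> (\<Sum>j. ennreal (\<omega> j / (b ^ Suc j * R) ^ n) * (\<integral>\<^sup>+y. h y * indicator (ball x (b ^ Suc j * (b * R))) y \<partial>M))"
  proof (rule annuli_sum_bound)
    fix j y assume y: "y \<in> \<Omega>" "b ^ j * (b * R) \<le> dist x y"
    have "0 < b ^ j * (b * R)" using R by simp
    then have pos: "0 < dist x y" using y(2) by linarith
    have "\<bar>K x y - K z y\<bar> \<le> \<omega> j / dist x y ^ n"
      using y R x z by (intro smooth_fst) (auto simp: mult_ac)
    also have "\<dots> \<le> \<omega> j / (b ^ Suc j * R) ^ n"
      using y R \<omega>_nonneg pos by (intro divide_left_mono power_mono mult_pos_pos zero_less_power) (auto simp: mult_ac)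
    finally show "ennreal \<bar>K x y - K z y\<bar> * h y \<le> ennreal (\<omega> j / (b ^ Suc j * R) ^ n) * h y"
      by (intro mult_right_mono ennreal_leI) auto
  qed (use R in auto)
  also have "\<dots> \<le> (\<Sum>j. ennreal (\<omega> j * (b ^ n * m)))"
  proof (intro suminf_le summableI)
    fix j
    have "ennreal (\<omega> j / (b ^ Suc j * R) ^ n) * (\<integral>\<^sup>+y. h y * indicator (ball x (b ^ Suc j * (b * R))) y \<partial>M)
       \<le> ennreal (\<omega> j / (b ^ Suc j * R) ^ n) * ennreal (m * (b ^ Suc j * (b * R)) ^ n)"
      using R by (intro mult_left_mono m) auto
    also have "\<dots> = ennreal (\<omega> j / (b ^ Suc j * R) ^ n * (m * (b ^ Suc j * (b * R)) ^ n))"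
      using \<omega>_nonneg R m by (intro ennreal_mult[symmetric]) auto
    also have "\<omega> j / (b ^ Suc j * R) ^ n * (m * (b ^ Suc j * (b * R)) ^ n) = \<omega> j * (b ^ n * m)"
    proof -
      have "(b ^ Suc j * (b * R)) ^ n = (b ^ Suc j * R) ^ n * b ^ n"
        by (simp add: power_mult_distrib mult_ac)
      then show ?thesis using R by (simp add: field_simps)
    qed
    finally show "ennreal (\<omega> j / (b ^ Suc j * R) ^ n) * (\<integral>\<^sup>+y. h y * indicator (ball x (b ^ Suc j * (b * R))) y \<partial>M)
       \<le> ennreal (\<omega> j * (b ^ n * m))" .
  qed
  also have "\<dots> = ennreal (\<Sum>j. \<omega> j * (b ^ n * m))"
    using \<omega>_nonneg m \<omega>_summable by (intro suminf_ennreal2) (auto intro: summable_mult2)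
  also have "(\<Sum>j. \<omega> j * (b ^ n * m)) = W * m"
    using suminf_mult2[OF \<omega>_summable, of "b ^ n * m"] by (simp add: W_def mult_ac)
  finally show ?thesis .
qed

lemma nn_integral_ball_indicator_le:
  assumes "r \<ge> 0"
  shows "(\<integral>\<^sup>+y. indicator (ball x r) y \<partial>M) \<le> ennreal (V * r ^ n)"
proof -
  have "(\<integral>\<^sup>+y. indicator (ball x r) y \<partial>M) = (\<integral>\<^sup>+y. indicator (ball x r \<inter> \<Omega>) y \<partial>M)"
    by (intro nn_integral_cong) (auto simp: indicator_def)
  also have "\<dots> = emeasure M (ball x r \<inter> \<Omega>)" by (simp add: sets_M_ball)
  also have "\<dots> \<le> ennreal (V * r ^ n)" using assms by (intro emeasure_M_ball_le) auto
  finally show ?thesis .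
qed

lemma far_borel [measurable]: "{y. r \<le> dist x y} \<in> sets borel" for x :: 'a
  by (intro borel_closed closed_Collect_le continuous_intros)

text \<open>Truncation destroys the smoothness of the kernel, but only where one of \<open>|x - y|\<close>, \<open>|z - y|\<close> is below \<open>e\<close>
  and the other is not. Such \<open>y\<close> lie within \<open>2 e\<close> of \<open>x\<close>, and there the kernels are at most \<open>C e\<^sup>-\<^sup>n\<close>.\<close>

lemma hormander_trunc_fst:
  assumes e: "e > 0" and x: "x \<in> \<Omega>" and z: "z \<in> \<Omega>" and R: "R > 0" "dist x z \<le> R"
  shows "(\<integral>\<^sup>+y. ennreal \<bar>Kt e x y - Kt e z y\<bar> * indicator {y. b * R \<le> dist x y} y \<partial>M)
      \<le> ennreal (W * V + C * 2 ^ n * V)"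
proof -
  have "5 * R \<le> b * R" using b_ge R by (intro mult_right_mono) auto
  have "(\<integral>\<^sup>+y. ennreal \<bar>Kt e x y - Kt e z y\<bar> * indicator {y. b * R \<le> dist x y} y \<partial>M)
     \<le> (\<integral>\<^sup>+y. ennreal \<bar>Kt (2 * R) x y - Kt (2 * R) z y\<bar> * indicator {y. b * R \<le> dist x y} y + ennreal (C / e ^ n) * indicator (ball x (2 * e)) y \<partial>M)"
  proof (intro nn_integral_mono)
    fix y assume "y \<in> space M"
    then have y: "y \<in> \<Omega>" by simp
    show "ennreal \<bar>Kt e x y - Kt e z y\<bar> * indicator {y. b * R \<le> dist x y} y
     \<le> ennreal \<bar>Kt (2 * R) x y - Kt (2 * R) z y\<bar> * indicator {y. b * R \<le> dist x y} y + ennreal (C / e ^ n) * indicator (ball x (2 * e)) y"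
    proof (cases "b * R \<le> dist x y")
      case True
      have 5: "5 * R \<le> dist x y" using True \<open>5 * R \<le> b * R\<close> by simp
      have tri: "dist x y \<le> R + dist z y" "dist z y \<le> R + dist x y"
        using dist_triangle[of x y z] dist_triangle[of z y x] R by (auto simp: dist_commute)
      have "\<bar>Kt e x y - Kt e z y\<bar> \<le> \<bar>Kt (2 * R) x y - Kt (2 * R) z y\<bar> + C / e ^ n * indicator (ball x (2 * e)) y"
      proof (cases "(e \<le> dist x y) = (e \<le> dist z y)")
        case True
        then have "\<bar>Kt e x y - Kt e z y\<bar> \<le> \<bar>Kt (2 * R) x y - Kt (2 * R) z y\<bar>"
          using 5 tri R x y z by (auto simp: Kt_def)
        moreover have "0 \<le> C / e ^ n * indicator (ball x (2 * e)) y" using C_pos e by simp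
        ultimately show ?thesis by linarith
      next
        case False
        then have "y \<in> ball x (2 * e)" using tri 5 R by auto
        moreover have "\<bar>Kt e x y - Kt e z y\<bar> \<le> C / e ^ n"
          using False Kt_bound[OF e, of x y] Kt_bound[OF e, of z y] by (auto simp: Kt_def)
        ultimately show ?thesis by (simp add: add_increasing)
      qed
      then have "ennreal \<bar>Kt e x y - Kt e z y\<bar> \<le> ennreal (\<bar>Kt (2 * R) x y - Kt (2 * R) z y\<bar> + C / e ^ n * indicator (ball x (2 * e)) y)"
        by (rule ennreal_leI)
      also have "\<dots> = ennreal \<bar>Kt (2 * R) x y - Kt (2 * R) z y\<bar> + ennreal (C / e ^ n) * indicator (ball x (2 * e)) y"
        using C_pos e by (auto simp: ennreal_plus indicator_def)
      finally show ?thesis using True by simp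
    qed simp
  qed
  also have "\<dots> = (\<integral>\<^sup>+y. ennreal \<bar>Kt (2 * R) x y - Kt (2 * R) z y\<bar> * indicator {y. b * R \<le> dist x y} y \<partial>M)
     + ennreal (C / e ^ n) * (\<integral>\<^sup>+y. indicator (ball x (2 * e)) y \<partial>M)"
    by (subst nn_integral_add) (auto simp: nn_integral_cmult)
  also have "\<dots> \<le> ennreal (W * V) + ennreal (C / e ^ n) * ennreal (V * (2 * e) ^ n)"
  proof (intro add_mono mult_left_mono nn_integral_ball_indicator_le)
    have "(\<integral>\<^sup>+y. ennreal \<bar>Kt (2 * R) x y - Kt (2 * R) z y\<bar> * indicator {y. b * R \<le> dist x y} y \<partial>M)
       = (\<integral>\<^sup>+y. ennreal \<bar>K x y - K z y\<bar> * 1 * indicator {y. b * R \<le> dist x y} y \<partial>M)"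
    proof (intro nn_integral_cong)
      fix y assume "y \<in> space M"
      then have y: "y \<in> \<Omega>" by simp
      have "Kt (2 * R) x y = K x y" "Kt (2 * R) z y = K z y" if "b * R \<le> dist x y"
        using that dist_triangle[of x y z] R x y z order_trans[OF \<open>5 * R \<le> b * R\<close> that] by (auto simp: Kt_def)
      then show "ennreal \<bar>Kt (2 * R) x y - Kt (2 * R) z y\<bar> * indicator {y. b * R \<le> dist x y} y
        = ennreal \<bar>K x y - K z y\<bar> * 1 * indicator {y. b * R \<le> dist x y} y"
        by (auto simp: indicator_def)
    qed
    also have "\<dots> \<le> ennreal (W * V)"
      by (rule hormander[OF _ x z R]) (use V_pos in \<open>auto simp: nn_integral_ball_indicator_le\<close>)
    finally show "(\<integral>\<^sup>+y. ennreal \<bar>Kt (2 * R) x y - Kt (2 * R) z y\<bar> * indicator {y. b * R \<le> dist x y} y \<partial>M) \<le> ennreal (W * V)" .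
  qed (use e in auto)
  also have "\<dots> = ennreal (W * V + C / e ^ n * (V * (2 * e) ^ n))"
    using e C_pos V_pos W_nonneg by (simp flip: ennreal_plus ennreal_mult)
  also have "C / e ^ n * (V * (2 * e) ^ n) = C * 2 ^ n * V"
    using e by (simp add: power_mult_distrib)
  finally show ?thesis .
qed

end

section \<open>Cotlar's inequality\<close>

context cz_kernel_domain
begin

text \<open>Boundedness on \<open>L\<^sup>s\<close> of all truncations at once, with norm at most \<open>A\<^sup>1\<^sup>/\<^sup>s\<close>.\<close>

definition strong_type :: "real \<Rightarrow> real \<Rightarrow> bool" where
  "strong_type s A \<longleftrightarrow> A \<ge> 0 \<and> (\<forall>e>0. \<forall>f\<in>borel_measurable M. powint M s f < \<infinity> \<longrightarrow>
     powint M s (trunc e f) \<le> ennreal A * powint M s f)"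

text \<open>The ratio is twice the one by which \<open>r\<^sup>n\<close> increases when \<open>r\<close> is multiplied by \<open>b\<^sup>2\<close>. The factor two is
  what makes the sum over the non-doubling scales geometric.\<close>

definition \<Lambda> :: real where "\<Lambda> = 2 * b ^ (2 * n)"

definition cotlar_const :: "real \<Rightarrow> real \<Rightarrow> real" where
  "cotlar_const s A = C * V * \<Lambda>\<^sup>2 + C * V * b ^ (2 * n) + W * V * b ^ n + 2 * ((1 + A) * \<Lambda>) powr (1 / s)"

lemma \<Lambda>_gt: "\<Lambda> > 1"
proof -
  have "1 \<le> b ^ (2 * n)" by (intro one_le_power) simp
  then show ?thesis unfolding \<Lambda>_def by linarith
qed

lemma cotlar_const_pos: "A \<ge> 0 \<Longrightarrow> cotlar_const s A > 0"
  unfolding cotlar_const_def using C_pos V_pos W_nonneg \<Lambda>_gt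
  by (intro add_nonneg_pos add_nonneg_nonneg mult_nonneg_nonneg) auto

text \<open>Doubling balls exist at every point above every scale: otherwise the measure of the balls would grow
  at least like \<open>\<Lambda>\<^sup>j\<close>, although the total measure is finite. Below the first doubling scale, the
  measures decrease geometrically faster than \<open>r\<^sup>n\<close>.\<close>

lemma doubling_radius:
  assumes x: "x \<in> \<Omega>" and \<epsilon>: "\<epsilon> > 0"
  obtains j where "dm x (b ^ (2 * Suc j) * \<epsilon>) \<le> \<Lambda> * dm x (b ^ (2 * j) * \<epsilon>)"
    "\<And>i. i \<le> j \<Longrightarrow> \<Lambda> ^ i * dm x (b ^ (2 * (j - i)) * \<epsilon>) \<le> dm x (b ^ (2 * j) * \<epsilon>)"
proof -
  define v where "v j = dm x (b ^ (2 * j) * \<epsilon>)" for j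
  have v0: "v 0 > 0" unfolding v_def using x \<epsilon> by (intro dm_pos) auto
  have "\<exists>j. v (Suc j) \<le> \<Lambda> * v j"
  proof (rule ccontr)
    assume "\<not> ?thesis"
    then have less: "\<Lambda> * v j < v (Suc j)" for j by (meson not_le)
    have grow: "\<Lambda> ^ j * v 0 \<le> v j" for j
    proof (induction j)
      case (Suc j)
      have "\<Lambda> ^ Suc j * v 0 = \<Lambda> * (\<Lambda> ^ j * v 0)" by simp
      also have "\<dots> \<le> \<Lambda> * v j" using Suc \<Lambda>_gt by (intro mult_left_mono) auto
      also have "\<dots> \<le> v (Suc j)" using less[of j] by simp
      finally show ?case .
    qed simp
    obtain j where "measure M \<Omega> / v 0 < \<Lambda> ^ j" using real_arch_pow[OF \<Lambda>_gt] by blast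
    then have "measure M \<Omega> < \<Lambda> ^ j * v 0" using v0 by (simp add: field_simps)
    also have "\<dots> \<le> v j" by (rule grow)
    also have "\<dots> \<le> measure M \<Omega>" unfolding v_def dm_def by (intro M.finite_measure_mono) (auto simp: sets.top[of M, simplified])
    finally show False by simp
  qed
  then obtain j0 where j0: "v (Suc j0) \<le> \<Lambda> * v j0" by blast
  define j where "j = (LEAST j. v (Suc j) \<le> \<Lambda> * v j)"
  have j: "v (Suc j) \<le> \<Lambda> * v j" unfolding j_def by (rule LeastI[of _ j0]) fact
  have less: "\<Lambda> * v i < v (Suc i)" if "i < j" for i
    using not_less_Least[of i "\<lambda>j. v (Suc j) \<le> \<Lambda> * v j"] that by (auto simp: j_def)
  have "\<Lambda> ^ i * v (j - i) \<le> v j" if "i \<le> j" for i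
    using that
  proof (induction i)
    case (Suc i)
    have "\<Lambda> ^ Suc i * v (j - Suc i) = \<Lambda> ^ i * (\<Lambda> * v (j - Suc i))" by simp
    also have "\<dots> \<le> \<Lambda> ^ i * v (Suc (j - Suc i))"
      using less[of "j - Suc i"] Suc \<Lambda>_gt by (intro mult_left_mono) auto
    also have "Suc (j - Suc i) = j - i" using Suc by simp
    also have "\<Lambda> ^ i * v (j - i) \<le> v j" using Suc by simp
    finally show ?case .
  qed simp
  then show thesis using that[of j] j unfolding v_def by blast
qed

lemma local_L1_le:
  assumes [measurable]: "f \<in> borel_measurable M" and s: "s > 1" and u: "u \<ge> 0" and r: "r > 0"
    and f: "(\<integral>\<^sup>+y\<in>ball x r. ennreal (\<bar>f y\<bar> powr s) \<partial>M) \<le> ennreal (u powr s * m)"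
    and m: "dm x r \<le> m"
  shows "(\<integral>\<^sup>+y\<in>ball x r. ennreal \<bar>f y\<bar> \<partial>M) \<le> ennreal (u * m)"
proof -
  have m0: "m \<ge> 0" using m dm_nonneg[of x r] by linarith
  let ?s' = "s / (s - 1)"
  have "(\<integral>\<^sup>+y\<in>ball x r. ennreal \<bar>f y\<bar> \<partial>M)
      = (\<integral>\<^sup>+y. ennreal (\<bar>f y * indicator (ball x r) y\<bar> * \<bar>indicator (ball x r) y\<bar>) \<partial>M)"
    by (intro nn_integral_cong) (auto simp: indicator_def)
  also have "\<dots> \<le> ennreal ((u * m powr (1 / s)) * (m powr (1 / ?s')))"
  proof (rule Holder_powint[OF s refl])
    have "powint M s (\<lambda>y. f y * indicator (ball x r) y) = (\<integral>\<^sup>+y\<in>ball x r. ennreal (\<bar>f y\<bar> powr s) \<partial>M)"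
      unfolding powint_def using s by (intro nn_integral_cong) (auto simp: indicator_def)
    also have "\<dots> \<le> ennreal (u powr s * m)" by fact
    also have "u powr s * m = (u * m powr (1 / s)) powr s"
      using s u m0 by (simp add: powr_mult powr_powr)
    finally show "powint M s (\<lambda>y. f y * indicator (ball x r) y) \<le> ennreal ((u * m powr (1 / s)) powr s)" .
    have "powint M ?s' (indicator (ball x r)) = (\<integral>\<^sup>+y. indicator (ball x r \<inter> \<Omega>) y \<partial>M)"
      unfolding powint_def using s by (intro nn_integral_cong) (auto simp: indicator_def)
    also have "\<dots> = ennreal (dm x r)" by (simp add: sets_M_ball emeasure_dm)
    also have "\<dots> \<le> ennreal m" using m by (rule ennreal_leI)
    also have "m = (m powr (1 / ?s')) powr ?s'" using s m0 by (simp add: powr_powr)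
    finally show "powint M ?s' (indicator (ball x r)) \<le> ennreal ((m powr (1 / ?s')) powr ?s')" .
  qed (use u in auto)
  also have "(u * m powr (1 / s)) * (m powr (1 / ?s')) = u * m powr (1 / s + 1 / ?s')"
    by (simp add: powr_add)
  also have "1 / s + 1 / ?s' = 1" using s by (simp add: field_simps)
  finally show ?thesis using m0 by simp
qed

text \<open>Cotlar's inequality. The truncation at \<open>\<epsilon>\<close> is first replaced by the one at the next doubling radius
  \<open>R\<close>; the annuli in between contribute a geometric series. The truncation at \<open>b R\<close> is nearly constant on
  \<open>B(x,R)\<close>, where it is compared with \<open>T\<^sub>\<delta> f - T\<^sub>\<delta> f\<^sub>1\<close>, \<open>f\<^sub>1\<close> being the part of \<open>f\<close> in \<open>B(x, b R)\<close>, and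
  averaging over \<open>B(x,R)\<close> brings in the maximal functions. The doubling of \<open>R\<close> allows
  one to divide by the measure of \<open>B(x,R)\<close> instead of that of the larger balls.\<close>

lemma cotlar_pointwise:
  assumes s: "s > 1" and st: "strong_type s A" and [measurable]: "f \<in> borel_measurable M"
    and fs: "powint M s f < \<infinity>" and \<delta>: "0 < \<delta>" "\<delta> \<le> \<epsilon>" and x: "x \<in> \<Omega>" and u: "u \<ge> 0"
    and Mf: "maximal (\<lambda>y. ennreal (\<bar>f y\<bar> powr s)) x \<le> ennreal (u powr s)"
    and MTf: "maximal (\<lambda>y. ennreal (\<bar>trunc \<delta> f y\<bar> powr s)) x \<le> ennreal (u powr s)"
  shows "\<bar>trunc \<epsilon> f x\<bar> \<le> cotlar_const s A * u"
proof -
  have A: "A \<ge> 0" using st by (simp add: strong_type_def)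
  have \<epsilon>: "\<epsilon> > 0" using \<delta> by simp
  have int: "integrable M f" using powint_finite_imp_integrable[OF _ fs] s by simp
  have P1: "(\<integral>\<^sup>+y\<in>ball x r. ennreal (\<bar>f y\<bar> powr s) \<partial>M) \<le> ennreal (u powr s * dm x (b * r))" if "r > 0" for r
    using order_trans[OF maximal_bound[OF x that] mult_right_mono[OF Mf]] by (simp add: ennreal_mult)
  have P1': "(\<integral>\<^sup>+y\<in>ball x r. ennreal (\<bar>trunc \<delta> f y\<bar> powr s) \<partial>M) \<le> ennreal (u powr s * dm x (b * r))" if "r > 0" for r
    using order_trans[OF maximal_bound[OF x that] mult_right_mono[OF MTf]] by (simp add: ennreal_mult)
  have P2: "(\<integral>\<^sup>+y\<in>ball x r. ennreal \<bar>f y\<bar> \<partial>M) \<le> ennreal (u * dm x (b * r))" if "r > 0" for r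
    using that by (intro local_L1_le[OF _ s u that P1] dm_mono_radius) auto
  have step: "\<bar>trunc e f x - trunc e' f x\<bar> \<le> C / e ^ n * (u * dm x (b * e'))" if "0 < e" "e \<le> e'" for e e'
  proof -
    have "ennreal \<bar>trunc e f x - trunc e' f x\<bar>
       \<le> ennreal (C / e ^ n) * (\<integral>\<^sup>+y\<in>ball x e'. ennreal \<bar>f y\<bar> \<partial>M)"
      by (rule trunc_step[OF int that])
    also have "\<dots> \<le> ennreal (C / e ^ n) * ennreal (u * dm x (b * e'))"
      using that by (intro mult_left_mono P2) auto
    also have "\<dots> = ennreal (C / e ^ n * (u * dm x (b * e')))"
      using C_pos that u by (intro ennreal_mult[symmetric]) auto
    finally show ?thesis using C_pos that u by (subst (asm) ennreal_le_iff) auto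
  qed
  obtain j where j: "dm x (b ^ (2 * Suc j) * \<epsilon>) \<le> \<Lambda> * dm x (b ^ (2 * j) * \<epsilon>)"
    "\<And>i. i \<le> j \<Longrightarrow> \<Lambda> ^ i * dm x (b ^ (2 * (j - i)) * \<epsilon>) \<le> dm x (b ^ (2 * j) * \<epsilon>)"
    using doubling_radius[OF x \<epsilon>] by metis
  \<comment> \<open>\<open>R\<close> is the first doubling radius of the form \<open>b\<^sup>2\<^sup>j \<epsilon>\<close>.\<close>
  define R where "R = b ^ (2 * j) * \<epsilon>"
  have R: "R > 0" using \<epsilon> by (simp add: R_def)
  have bbR: "dm x (b * (b * R)) \<le> \<Lambda> * dm x R"
    using j(1) by (simp add: R_def mult_ac)
  have dmR: "dm x R \<le> V * R ^ n" using R by (intro dm_le) simp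
  \<comment> \<open>The annuli from \<open>R\<close> inwards contribute \<open>1/2 + 1/4 + \<dots>\<close> times a constant.\<close>
  have chain: "\<bar>trunc (b ^ (2 * (j - k)) * \<epsilon>) f x - trunc R f x\<bar> \<le> C * V * \<Lambda>\<^sup>2 * u * (1 - (1/2) ^ k)"
    if "k \<le> j" for k
    using that
  proof (induction k)
    case 0 then show ?case by (simp add: R_def)
  next
    case (Suc k)
    let ?r = "b ^ (2 * (j - Suc k)) * \<epsilon>" and ?r' = "b ^ (2 * (j - k)) * \<epsilon>"
    have r: "?r > 0" using \<epsilon> by simp
    have r': "?r' = b\<^sup>2 * ?r"
    proof -
      have "2 * (j - k) = 2 + 2 * (j - Suc k)" using Suc by simp
      then show ?thesis by (simp add: power_add power2_eq_square)
    qed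
    have Rr: "R = b ^ (2 * Suc k) * ?r"
    proof -
      have "2 * j = 2 * Suc k + 2 * (j - Suc k)" using Suc by simp
      then show ?thesis unfolding R_def by (metis (no_types) power_add mult.assoc)
    qed
    have dm': "\<Lambda> ^ k * dm x (b * ?r') \<le> \<Lambda> * (V * R ^ n)"
    proof (cases k)
      case 0
      have "dm x (b * R) \<le> dm x (b * (b * R))"
        using R by (intro dm_mono_radius) auto
      also have "\<dots> \<le> \<Lambda> * dm x R" by (rule bbR)
      also have "\<dots> \<le> \<Lambda> * (V * R ^ n)" using dmR \<Lambda>_gt by (intro mult_left_mono) auto
      finally show ?thesis using 0 by (simp add: R_def)
    next
      case (Suc l)
      have "2 * (j - l) = 2 + 2 * (j - k)" using Suc \<open>Suc k \<le> j\<close> by simp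
      then have "b ^ (2 * (j - l)) * \<epsilon> = b * (b * ?r')" by (simp add: power_add power2_eq_square)
      then have "dm x (b * ?r') \<le> dm x (b ^ (2 * (j - l)) * \<epsilon>)"
        using \<epsilon> by (intro dm_mono_radius) auto
      then have "\<Lambda> ^ k * dm x (b * ?r') \<le> \<Lambda> * (\<Lambda> ^ l * dm x (b ^ (2 * (j - l)) * \<epsilon>))"
        using \<Lambda>_gt Suc by simp
      also have "\<dots> \<le> \<Lambda> * (V * R ^ n)"
        using j(2)[of l] dmR Suc \<open>Suc k \<le> j\<close> \<Lambda>_gt by (intro mult_left_mono) (auto simp: R_def)
      finally show ?thesis .
    qed
    have "\<bar>trunc ?r f x - trunc ?r' f x\<bar> \<le> C / ?r ^ n * (u * dm x (b * ?r'))"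
    proof (rule step[OF r])
      have "1 * ?r \<le> b\<^sup>2 * ?r" using r by (intro mult_right_mono one_le_power) auto
      then show "?r \<le> ?r'" by (simp only: r' mult_1)
    qed
    also have "\<dots> \<le> C / ?r ^ n * (u * (\<Lambda> * (V * R ^ n) / \<Lambda> ^ k))"
    proof (intro mult_left_mono u)
      show "dm x (b * ?r') \<le> \<Lambda> * (V * R ^ n) / \<Lambda> ^ k"
        using dm' \<Lambda>_gt by (simp add: pos_le_divide_eq mult.commute)
      show "0 \<le> C / ?r ^ n" using C_pos r zero_less_power[OF r, of n] by simp
    qed
    also have "R ^ n = b ^ (2 * n * Suc k) * ?r ^ n"
    proof -
      have "2 * Suc k * n = 2 * n * Suc k" by simp
      then have "(b ^ (2 * Suc k)) ^ n = b ^ (2 * n * Suc k)" by (metis power_mult)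
      then show ?thesis unfolding Rr by (metis power_mult_distrib)
    qed
    also have "C / ?r ^ n * (u * (\<Lambda> * (V * (b ^ (2 * n * Suc k) * ?r ^ n)) / \<Lambda> ^ k))
        = C * V * u * \<Lambda> * b ^ (2 * n * Suc k) / \<Lambda> ^ k"
      using \<epsilon> by (simp add: field_simps)
    also have "\<dots> = C * V * \<Lambda>\<^sup>2 * u * (b ^ (2 * n) / \<Lambda>) ^ Suc k"
      using \<Lambda>_gt by (simp only: power_mult[of b "2 * n" "Suc k"]) (simp add: power_divide power2_eq_square)
    also have "b ^ (2 * n) / \<Lambda> = 1 / 2" by (simp add: \<Lambda>_def)
    finally have "\<bar>trunc ?r f x - trunc ?r' f x\<bar> \<le> C * V * \<Lambda>\<^sup>2 * u * (1/2) ^ Suc k" .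
    moreover have "\<bar>trunc ?r' f x - trunc R f x\<bar> \<le> C * V * \<Lambda>\<^sup>2 * u * (1 - (1/2) ^ k)"
      using Suc by simp
    ultimately have "\<bar>trunc ?r f x - trunc R f x\<bar> \<le> C * V * \<Lambda>\<^sup>2 * u * (1/2) ^ Suc k + C * V * \<Lambda>\<^sup>2 * u * (1 - (1/2) ^ k)"
      by linarith
    then show ?case by (simp add: algebra_simps)
  qed
  have c1: "\<bar>trunc \<epsilon> f x - trunc R f x\<bar> \<le> C * V * \<Lambda>\<^sup>2 * u"
  proof -
    have "\<bar>trunc \<epsilon> f x - trunc R f x\<bar> \<le> C * V * \<Lambda>\<^sup>2 * u * (1 - (1/2) ^ j)"
      using chain[of j] by simp
    also have "\<dots> \<le> C * V * \<Lambda>\<^sup>2 * u * 1"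
      using C_pos V_pos u by (intro mult_left_mono) auto
    finally show ?thesis by simp
  qed
  have c2: "\<bar>trunc R f x - trunc (b * R) f x\<bar> \<le> C * V * b ^ (2 * n) * u"
  proof -
    have "\<bar>trunc R f x - trunc (b * R) f x\<bar> \<le> C / R ^ n * (u * dm x (b * (b * R)))"
      using R by (intro step) auto
    also have "\<dots> \<le> C / R ^ n * (u * (V * (b * (b * R)) ^ n))"
      using R C_pos u by (intro mult_left_mono dm_le) auto
    also have "\<dots> = C * V * b ^ (2 * n) * u"
      using R by (simp add: power_mult_distrib power_mult power2_eq_square mult_ac)
    finally show ?thesis .
  qed
  define f1 where "f1 = (\<lambda>y. f y * indicator (ball x (b * R)) y)"
  have [measurable]: "f1 \<in> borel_measurable M" by (simp add: f1_def)
  have f1_int: "integrable M f1"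
    by (rule Bochner_Integration.integrable_bound[OF int]) (auto simp: f1_def indicator_def)
  have "5 * R \<le> b * R" using b_ge R by (intro mult_right_mono) auto
  have c3: "\<bar>trunc (b * R) f x - (trunc \<delta> f z - trunc \<delta> f1 z)\<bar> \<le> W * V * b ^ n * u"
    if z: "z \<in> \<Omega>" "dist x z < R" for z
  proof -
    have "trunc \<delta> f z - trunc \<delta> f1 z = (\<integral>y. Kt \<delta> z y * (f y - f1 y) \<partial>M)"
      using trunc_diff[OF int f1_int] by (simp add: trunc_def)
    then have "ennreal \<bar>trunc (b * R) f x - (trunc \<delta> f z - trunc \<delta> f1 z)\<bar>
       \<le> (\<integral>\<^sup>+y. ennreal \<bar>K x y - K z y\<bar> * ennreal \<bar>f y\<bar> * indicator {y. b * R \<le> dist x y} y \<partial>M)"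
    proof (simp only: trunc_def[of "b * R"], intro abs_integral_diff_le Kt_integrable)
      fix y assume y: "y \<in> \<Omega>"
      have "\<epsilon> \<le> R"
      proof -
        have "1 \<le> b ^ (2 * j)" by (intro one_le_power) simp
        then show ?thesis using \<epsilon> by (simp add: R_def)
      qed
      show "ennreal \<bar>Kt (b * R) x y * f y - Kt \<delta> z y * (f y - f1 y)\<bar>
         \<le> ennreal \<bar>K x y - K z y\<bar> * ennreal \<bar>f y\<bar> * indicator {y. b * R \<le> dist x y} y"
      proof (cases "b * R \<le> dist x y")
        case True
        have "dist x y \<le> dist x z + dist z y" by (rule dist_triangle)
        then have "\<delta> \<le> dist z y" using True z \<open>5 * R \<le> b * R\<close> \<open>\<epsilon> \<le> R\<close> \<delta> R by linarith
        then have "Kt (b * R) x y * f y - Kt \<delta> z y * (f y - f1 y) = (K x y - K z y) * f y"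
          using True x y z \<delta> R by (simp add: Kt_def f1_def left_diff_distrib)
        then show ?thesis using True by (simp add: abs_mult ennreal_mult)
      next
        case False
        then show ?thesis by (simp add: Kt_def f1_def)
      qed
    qed (use int f1_int in auto)
    also have "\<dots> \<le> ennreal (W * (u * V * b ^ n))"
    proof (rule hormander[OF _ x z(1) R])
      fix r :: real assume r: "r > 0"
      have "(\<integral>\<^sup>+y\<in>ball x r. ennreal \<bar>f y\<bar> \<partial>M) \<le> ennreal (u * dm x (b * r))" by (rule P2[OF r])
      also have "\<dots> \<le> ennreal (u * (V * (b * r) ^ n))"
        using r u by (intro ennreal_leI mult_left_mono dm_le) auto
      finally show "(\<integral>\<^sup>+y\<in>ball x r. ennreal \<bar>f y\<bar> \<partial>M) \<le> ennreal (u * V * b ^ n * r ^ n)"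
        by (simp add: power_mult_distrib mult_ac)
    qed (use z u V_pos in auto)
    finally show ?thesis
      using W_nonneg u V_pos by (subst (asm) ennreal_le_iff) (auto simp: mult_ac)
  qed
  define a where "a = \<bar>trunc \<epsilon> f x\<bar> - (C * V * \<Lambda>\<^sup>2 * u + C * V * b ^ (2 * n) * u + W * V * b ^ n * u)"
  have "a \<le> 2 * ((1 + A) * \<Lambda>) powr (1 / s) * u"
  proof (cases "a \<le> 0")
    case True
    then show ?thesis using u by (meson mult_nonneg_nonneg order_trans powr_ge_zero zero_le_numeral)
  next
    case False
    then have a: "a > 0" by simp
    have az: "a powr s \<le> 2 powr s * (\<bar>trunc \<delta> f z\<bar> powr s + \<bar>trunc \<delta> f1 z\<bar> powr s)" if z: "z \<in> \<Omega>" "dist x z < R" for z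
    proof -
      have "a \<le> \<bar>trunc \<delta> f z\<bar> + \<bar>trunc \<delta> f1 z\<bar>"
        using c1 c2 c3[OF z] unfolding a_def by linarith
      then have "a powr s \<le> (\<bar>trunc \<delta> f z\<bar> + \<bar>trunc \<delta> f1 z\<bar>) powr s"
        using a s by (intro powr_mono2) auto
      also have "\<dots> \<le> 2 powr s * (\<bar>trunc \<delta> f z\<bar> powr s + \<bar>trunc \<delta> f1 z\<bar> powr s)"
        using s by (intro powr_add_le) auto
      finally show ?thesis .
    qed
    have pf1: "powint M s f1 \<le> ennreal (u powr s * dm x (b * (b * R)))"
    proof -
      have "powint M s f1 = (\<integral>\<^sup>+y\<in>ball x (b * R). ennreal (\<bar>f y\<bar> powr s) \<partial>M)"
        unfolding powint_def f1_def using s by (intro nn_integral_cong) (auto simp: indicator_def)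
      then show ?thesis using P1[of "b * R"] R by simp
    qed
    then have fin: "powint M s f1 < \<infinity>" by (auto intro: order_le_less_trans)
    have "ennreal (a powr s * dm x R) = (\<integral>\<^sup>+z\<in>ball x R \<inter> \<Omega>. ennreal (a powr s) \<partial>M)"
      by (subst nn_integral_cmult_indicator) (auto simp: emeasure_dm ennreal_mult sets_M_ball)
    also have "\<dots> \<le> (\<integral>\<^sup>+z. ennreal (2 powr s) * (ennreal (\<bar>trunc \<delta> f z\<bar> powr s) * indicator (ball x R) z
         + ennreal (\<bar>trunc \<delta> f1 z\<bar> powr s)) \<partial>M)"
    proof (intro nn_integral_mono)
      fix z assume "z \<in> space M"
      then show "ennreal (a powr s) * indicator (ball x R \<inter> \<Omega>) z \<le> ennreal (2 powr s) * (ennreal (\<bar>trunc \<delta> f z\<bar> powr s) * indicator (ball x R) z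
         + ennreal (\<bar>trunc \<delta> f1 z\<bar> powr s))"
        using ennreal_leI[OF az[of z]] by (auto simp: indicator_def ennreal_mult ennreal_plus)
    qed
    also have "\<dots> = ennreal (2 powr s) * ((\<integral>\<^sup>+z\<in>ball x R. ennreal (\<bar>trunc \<delta> f z\<bar> powr s) \<partial>M)
         + powint M s (trunc \<delta> f1))"
      unfolding powint_def by (simp add: nn_integral_cmult nn_integral_add)
    also have "\<dots> \<le> ennreal (2 powr s) * (ennreal (u powr s * dm x (b * R)) + ennreal A * ennreal (u powr s * dm x (b * (b * R))))"
    proof (intro mult_left_mono add_mono P1' R)
      have "powint M s (trunc \<delta> f1) \<le> ennreal A * powint M s f1"
        using st fin \<delta> unfolding strong_type_def by auto
      also have "\<dots> \<le> ennreal A * ennreal (u powr s * dm x (b * (b * R)))" by (intro mult_left_mono pf1) auto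
      finally show "powint M s (trunc \<delta> f1) \<le> ennreal A * ennreal (u powr s * dm x (b * (b * R)))" .
    qed auto
    also have "\<dots> = ennreal (2 powr s * (u powr s * dm x (b * R) + A * (u powr s * dm x (b * (b * R)))))"
      using A by (simp flip: ennreal_mult ennreal_plus)
    finally have "a powr s * dm x R \<le> 2 powr s * (u powr s * dm x (b * R) + A * (u powr s * dm x (b * (b * R))))"
      using A by (subst (asm) ennreal_le_iff) auto
    also have "\<dots> \<le> 2 powr s * (u powr s * (\<Lambda> * dm x R) + A * (u powr s * (\<Lambda> * dm x R)))"
    proof -
      have "dm x (b * R) \<le> dm x (b * (b * R))" using R by (intro dm_mono_radius) auto
      then show ?thesis using bbR A by (intro mult_left_mono add_mono) auto
    qed
    also have "\<dots> = (2 powr s * u powr s * ((1 + A) * \<Lambda>)) * dm x R" by (simp add: algebra_simps)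
    finally have "a powr s \<le> 2 powr s * u powr s * ((1 + A) * \<Lambda>)"
      using dm_pos[OF x R] by simp
    then have "(a powr s) powr (1 / s) \<le> (2 powr s * u powr s * ((1 + A) * \<Lambda>)) powr (1 / s)"
      using s by (intro powr_mono2) auto
    then show ?thesis using s a u A \<Lambda>_gt by (simp add: powr_powr powr_mult mult_ac)
  qed
  then show ?thesis unfolding a_def cotlar_const_def by (simp add: algebra_simps)
qed

text \<open>The exceptional set is a union of two level sets of maximal functions. Stating the estimate through
  this set avoids the measurability of a supremum over uncountably many truncations.\<close>

lemma cotlar_weak_type:
  assumes s: "s > 1" and st: "strong_type s A" and [measurable]: "f \<in> borel_measurable M"
    and fs: "powint M s f < \<infinity>" and \<delta>: "0 < \<delta>" and t: "t > 0"
  obtains G where "G \<in> sets M"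
    "emeasure M G \<le> ennreal ((1 + A) * cotlar_const s A powr s / t powr s) * powint M s f"
    "\<And>x \<epsilon>. x \<in> \<Omega> \<Longrightarrow> x \<notin> G \<Longrightarrow> \<delta> \<le> \<epsilon> \<Longrightarrow> \<bar>trunc \<epsilon> f x\<bar> \<le> t"
proof -
  have A: "A \<ge> 0" using st by (simp add: strong_type_def)
  let ?c = "cotlar_const s A"
  have c: "?c > 0" by (rule cotlar_const_pos[OF A])
  define u where "u = t / ?c"
  have u: "u > 0" using t c by (simp add: u_def)
  define G where "G h = {x\<in>\<Omega>. ennreal (u powr s) < maximal (\<lambda>y. ennreal (\<bar>h y\<bar> powr s)) x}" for h :: "'a \<Rightarrow> real"
  have G: "G h \<in> sets M" if [measurable]: "h \<in> borel_measurable M" for h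
    unfolding G_def by (intro sets_M_open open_maximal_levels) auto
  have mG: "emeasure M (G h) \<le> ennreal (1 / u powr s) * powint M s h" if [measurable]: "h \<in> borel_measurable M" for h
  proof -
    have "ennreal (u powr s) * emeasure M (G h) \<le> powint M s h"
      unfolding G_def powint_def by (rule maximal_weak_type) measurable
    then have "ennreal (1 / u powr s) * (ennreal (u powr s) * emeasure M (G h)) \<le> ennreal (1 / u powr s) * powint M s h"
      by (rule mult_left_mono) simp
    moreover have "ennreal (1 / u powr s) * ennreal (u powr s) = 1"
      using u by (simp flip: ennreal_mult)
    ultimately show ?thesis by (simp add: mult.assoc[symmetric])
  qed
  show thesis
  proof (rule that[of "G f \<union> G (trunc \<delta> f)"])
    show "G f \<union> G (trunc \<delta> f) \<in> sets M" using G by auto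
    have "emeasure M (G f \<union> G (trunc \<delta> f)) \<le> emeasure M (G f) + emeasure M (G (trunc \<delta> f))"
      by (intro emeasure_subadditive G) auto
    also have "\<dots> \<le> ennreal (1 / u powr s) * powint M s f + ennreal (1 / u powr s) * (ennreal A * powint M s f)"
    proof (intro add_mono mG order_trans[OF mG] mult_left_mono)
      show "powint M s (trunc \<delta> f) \<le> ennreal A * powint M s f"
        using st fs \<delta> unfolding strong_type_def by auto
    qed auto
    also have "\<dots> = (ennreal (1 / u powr s) * (1 + ennreal A)) * powint M s f"
      by (simp add: algebra_simps)
    also have "ennreal (1 / u powr s) * (1 + ennreal A) = ennreal ((1 + A) * ?c powr s / t powr s)"
      using A c t by (simp add: u_def powr_divide mult.commute flip: ennreal_plus ennreal_mult ennreal_1)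
    finally show "emeasure M (G f \<union> G (trunc \<delta> f)) \<le> ennreal ((1 + A) * ?c powr s / t powr s) * powint M s f" .
  next
    fix x \<epsilon> assume x: "x \<in> \<Omega>" "x \<notin> G f \<union> G (trunc \<delta> f)" and "\<delta> \<le> \<epsilon>"
    then have "\<bar>trunc \<epsilon> f x\<bar> \<le> ?c * u"
      using u by (intro cotlar_pointwise[OF s st _ fs \<delta>]) (auto simp: G_def not_less)
    then show "\<bar>trunc \<epsilon> f x\<bar> \<le> t" using c by (simp add: u_def)
  qed
qed

end

section \<open>Weak type (1,1)\<close>

context bounded_domain
begin

lemma emeasure_le_of_eventually:
  assumes "A \<in> sets M" "\<And>k. B k \<in> sets M" "\<And>z. z \<in> A \<Longrightarrow> eventually (\<lambda>k. z \<in> B k) sequentially"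
    and le: "\<And>k::nat. emeasure M (B k) \<le> c"
  shows "emeasure M A \<le> c"
proof -
  define D where "D m = (\<Inter>k\<in>{m..}. A \<inter> B k)" for m
  have D: "D m \<in> sets M" for m unfolding D_def using assms by (intro sets.countable_INT') auto
  have "A = (\<Union>m. D m)"
  proof (intro equalityI subsetI)
    fix z assume z: "z \<in> A"
    then obtain N where "\<forall>k\<ge>N. z \<in> B k" using assms(3) by (auto simp: eventually_sequentially)
    then show "z \<in> (\<Union>m. D m)" using z by (auto simp: D_def intro!: exI[of _ N])
  qed (auto simp: D_def)
  then have "emeasure M A = (SUP m. emeasure M (D m))"
    using D by (subst SUP_emeasure_incseq) (auto simp: incseq_def D_def)
  also have "\<dots> \<le> c"
  proof (rule SUP_least)
    fix m have "emeasure M (D m) \<le> emeasure M (B m)" by (intro emeasure_mono assms) (auto simp: D_def)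
    also have "\<dots> \<le> c" by (rule le)
    finally show "emeasure M (D m) \<le> c" .
  qed
  finally show ?thesis .
qed

text \<open>Spheres are null sets, quantitatively: the increments are at most those of the volume of the ball.\<close>

lemma measure_ball_continuous:
  assumes U: "U \<in> sets M"
  shows "continuous_on {0..} (\<lambda>r. measure M (ball x r \<inter> \<Omega> - U))"
proof -
  let ?h = "\<lambda>r. measure M (ball x r \<inter> \<Omega> - U)"
  have le: "\<bar>?h r - ?h r'\<bar> \<le> \<bar>V * r ^ n - V * r' ^ n\<bar>" if "0 \<le> r" "r \<le> r'" for r r'
  proof -
    let ?A = "ball x r' - ball x r"
    have sub: "ball x r \<subseteq> ball x r'" using that by auto
    have "?h r \<le> ?h r'" using that U by (intro M.finite_measure_mono) (auto simp: sets_M_ball)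
    have "?h r' - ?h r = measure M ((ball x r' \<inter> \<Omega> - U) - (ball x r \<inter> \<Omega> - U))"
      using sub U by (intro M.finite_measure_Diff[symmetric]) (auto simp: sets_M_ball)
    also have "\<dots> = measure lebesgue ((ball x r' \<inter> \<Omega> - U) - (ball x r \<inter> \<Omega> - U))"
      by (rule measure_restrict_space) auto
    also have "\<dots> \<le> measure lebesgue ?A"
    proof (rule measure_mono_fmeasurable)
      show "(ball x r' \<inter> \<Omega> - U) - (ball x r \<inter> \<Omega> - U) \<in> sets lebesgue"
        using U by (auto simp: sets_restrict_space_iff intro!: sets.Diff sets.Int)
      show "?A \<in> fmeasurable lebesgue" by (intro fmeasurable_Diff) auto
    qed auto
    also have "\<dots> = measure lebesgue (ball x r') - measure lebesgue (ball x r)"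
      using sub by (intro measurable_measure_Diff) auto
    also have "\<dots> = V * r' ^ n - V * r ^ n"
      using that by (simp add: content_ball V_def n_def)
    finally show ?thesis using \<open>?h r \<le> ?h r'\<close> by linarith
  qed
  have le': "\<bar>?h r - ?h r'\<bar> \<le> \<bar>V * r ^ n - V * r' ^ n\<bar>" if "0 \<le> r" "0 \<le> r'" for r r'
    using le[of r r'] le[of r' r] that by (cases "r \<le> r'") (auto simp: abs_minus_commute)
  have "continuous_on {0..} (\<lambda>r::real. V * r ^ n)" by (intro continuous_intros)
  then show ?thesis
    unfolding continuous_on_iff dist_real_def
    by (meson atLeast_iff le' order_le_less_trans)
qed

text \<open>Each point in turn takes a ball that is just large enough to contain the prescribed measure outside
  of the sets chosen before. The radius exists by the intermediate value theorem, as the total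
  measure asked for is less than that of \<open>\<Omega>\<close>. Off the union of the sets, every point is at distance
  at least \<open>\<rho>\<^sub>i\<close> from every \<open>x\<^sub>i\<close>.\<close>

lemma sweeping:
  fixes x :: "nat \<Rightarrow> 'a" and a :: "nat \<Rightarrow> real"
  assumes "\<And>i. i < m \<Longrightarrow> a i \<ge> 0" and "sum a {..<m} < measure M \<Omega>"
  shows "\<exists>\<rho> E. disjoint_family_on E {..<m} \<and> (\<forall>i<m. \<rho> i \<ge> 0 \<and> E i \<in> sets M \<and> E i \<subseteq> ball (x i) (\<rho> i)
     \<and> measure M (E i) = a i \<and> ball (x i) (\<rho> i) \<inter> \<Omega> \<subseteq> (\<Union>j\<le>i. E j))"
  using assms
proof (induction m)
  case 0
  then show ?case by (auto simp: disjoint_family_on_def)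
next
  case (Suc m)
  have am: "\<And>i. i < m \<Longrightarrow> a i \<ge> 0" "a m \<ge> 0" using Suc.prems(1) by auto
  have sm: "sum a {..<m} < measure M \<Omega>" using Suc.prems(2) am by (simp add: lessThan_Suc)
  obtain \<rho> E where IH: "disjoint_family_on E {..<m}" "\<And>i. i < m \<Longrightarrow> \<rho> i \<ge> 0 \<and> E i \<in> sets M \<and> E i \<subseteq> ball (x i) (\<rho> i)
     \<and> measure M (E i) = a i \<and> ball (x i) (\<rho> i) \<inter> \<Omega> \<subseteq> (\<Union>j\<le>i. E j)"
    using Suc.IH[OF am(1) sm] by blast
  define U where "U = (\<Union>j<m. E j)"
  have U: "U \<in> sets M" "measure M U = sum a {..<m}"
    using IH by (auto simp: U_def intro!: M.finite_measure_finite_Union[THEN trans] sum.cong)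
  let ?h = "\<lambda>r. measure M (ball (x m) r \<inter> \<Omega> - U)"
  obtain D where D: "D > 0" "\<Omega> \<subseteq> ball (x m) D"
    using bounded_dom bounded_subset_ballD by blast
  have "?h D = measure M (\<Omega> - U)" using D by (simp add: Int_absorb1)
  also have "\<dots> = measure M \<Omega> - sum a {..<m}"
    using U sets.sets_into_space[OF U(1)] by (subst M.finite_measure_Diff) (auto simp: sets.top[of M, simplified])
  finally have hD: "a m \<le> ?h D" using Suc.prems by (simp add: lessThan_Suc)
  have "\<exists>r. 0 \<le> r \<and> r \<le> D \<and> ?h r = a m"
    using hD D Suc.prems by (intro IVT' continuous_on_subset[OF measure_ball_continuous[OF U(1)]]) auto
  then obtain r where r: "r \<ge> 0" "?h r = a m" by blast
  define E' where "E' = E(m := ball (x m) r \<inter> \<Omega> - U)"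
  define \<rho>' where "\<rho>' = \<rho>(m := r)"
  have "disjoint_family_on E' {..<Suc m}"
  proof (unfold disjoint_family_on_def, intro ballI impI)
    fix i k assume ik: "i \<in> {..<Suc m}" "k \<in> {..<Suc m}" "i \<noteq> k"
    have "E i \<inter> E k = {}" if "i < m" "k < m"
      using IH(1) that ik(3) unfolding disjoint_family_on_def by blast
    then show "E' i \<inter> E' k = {}" using ik by (auto simp: E'_def U_def less_Suc_eq)
  qed
  moreover have "\<forall>i<Suc m. \<rho>' i \<ge> 0 \<and> E' i \<in> sets M \<and> E' i \<subseteq> ball (x i) (\<rho>' i)
     \<and> measure M (E' i) = a i \<and> ball (x i) (\<rho>' i) \<inter> \<Omega> \<subseteq> (\<Union>j\<le>i. E' j)"
  proof (intro allI impI)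
    fix i assume "i < Suc m"
    then consider "i < m" | "i = m" by linarith
    then show "\<rho>' i \<ge> 0 \<and> E' i \<in> sets M \<and> E' i \<subseteq> ball (x i) (\<rho>' i)
     \<and> measure M (E' i) = a i \<and> ball (x i) (\<rho>' i) \<inter> \<Omega> \<subseteq> (\<Union>j\<le>i. E' j)"
    proof cases
      case 1
      then have "(\<Union>j\<le>i. E' j) = (\<Union>j\<le>i. E j)" by (intro SUP_cong) (auto simp: E'_def)
      then show ?thesis using 1 IH(2)[OF 1] by (simp add: E'_def \<rho>'_def)
    next
      case 2
      have "U \<subseteq> (\<Union>j\<le>m. E' j)" unfolding U_def E'_def by fastforce
      moreover have "E' m \<subseteq> (\<Union>j\<le>m. E' j)" by auto
      ultimately show ?thesis using 2 r U by (auto simp: E'_def \<rho>'_def sets_M_ball)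
    qed
  qed
  ultimately show ?case by blast
qed

end

context cz_kernel_domain
begin

text \<open>Removing a ball of radius \<open>b \<rho>\<close> around a point near \<open>y\<close> amounts to truncating at \<open>b \<rho>\<close> around \<open>y\<close>:
  the two regions differ only at distances comparable to \<open>\<rho>\<close>, where the kernel is of size \<open>\<rho>\<^sup>-\<^sup>n\<close>.\<close>

lemma trunc_recenter:
  assumes e: "e > 0" and xy: "y \<in> \<Omega>" "dist x y < \<rho>" and [measurable]: "F \<in> sets M"
  shows "\<bar>trunc e (indicator (F \<inter> {z. b * \<rho> \<le> dist x z})) y - trunc (max e (b * \<rho>)) (indicator F) y\<bar>
     \<le> C * V * 2 ^ n"
proof -
  have \<rho>: "\<rho> > 0" using xy zero_le_dist[of x y] by linarith
  have b4: "(b - 1) * \<rho> > 0" using \<rho> b_ge by simp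
  have Fm: "F \<inter> {z. b * \<rho> \<le> dist x z} \<in> sets M"
  proof -
    have "F \<inter> {z. b * \<rho> \<le> dist x z} = F \<inter> (- ball x (b * \<rho>) \<inter> \<Omega>)"
      using sets.sets_into_space[OF assms(4)] by (auto simp: not_less)
    then show ?thesis using sets_M_ball by auto
  qed
  have "ennreal \<bar>trunc e (indicator (F \<inter> {z. b * \<rho> \<le> dist x z})) y - trunc (max e (b * \<rho>)) (indicator F) y\<bar>
     \<le> (\<integral>\<^sup>+z. ennreal (C / ((b - 1) * \<rho>) ^ n) * indicator (ball y ((b + 1) * \<rho>)) z \<partial>M)"
    unfolding trunc_def
  proof (intro abs_integral_diff_le Kt_integrable)
    fix z assume z: "z \<in> \<Omega>"
    have tri: "dist x z < \<rho> + dist y z" "dist y z < \<rho> + dist x z"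
      using dist_triangle[of x z y] dist_triangle[of y z x] xy by (auto simp: dist_commute)
    have "\<bar>Kt e y z * indicator (F \<inter> {z. b * \<rho> \<le> dist x z}) z - Kt (max e (b * \<rho>)) y z * indicator F z\<bar>
       \<le> C / ((b - 1) * \<rho>) ^ n * indicator (ball y ((b + 1) * \<rho>)) z"
    proof (cases "(e \<le> dist y z \<and> b * \<rho> \<le> dist x z) = (max e (b * \<rho>) \<le> dist y z) \<or> \<not> e \<le> dist y z \<or> z \<notin> F")
      case True
      then have "Kt e y z * indicator (F \<inter> {z. b * \<rho> \<le> dist x z}) z - Kt (max e (b * \<rho>)) y z * indicator F z = 0"
        using e \<rho> by (auto simp: Kt_def indicator_def)
      then show ?thesis using C_pos b4 by simp
    next
      case False
      then have far: "(b - 1) * \<rho> \<le> dist y z" and near: "dist y z < (b + 1) * \<rho>"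
        using tri e by (auto simp: algebra_simps)
      have "\<bar>Kt e y z * indicator (F \<inter> {z. b * \<rho> \<le> dist x z}) z - Kt (max e (b * \<rho>)) y z * indicator F z\<bar>
          \<le> max \<bar>Kt e y z\<bar> \<bar>Kt (max e (b * \<rho>)) y z\<bar>"
        using False by (auto simp: indicator_def Kt_def)
      also have "\<dots> \<le> C / ((b - 1) * \<rho>) ^ n"
        using Kt_size[OF xy(1) z b4 far] by simp
      finally show ?thesis using near by simp
    qed
    then have "ennreal \<bar>Kt e y z * indicator (F \<inter> {z. b * \<rho> \<le> dist x z}) z - Kt (max e (b * \<rho>)) y z * indicator F z\<bar>
       \<le> ennreal (C / ((b - 1) * \<rho>) ^ n * indicator (ball y ((b + 1) * \<rho>)) z)" by (rule ennreal_leI)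
    also have "\<dots> = ennreal (C / ((b - 1) * \<rho>) ^ n) * indicator (ball y ((b + 1) * \<rho>)) z"
      by (auto simp: indicator_def)
    finally show "ennreal \<bar>Kt e y z * indicator (F \<inter> {z. b * \<rho> \<le> dist x z}) z - Kt (max e (b * \<rho>)) y z * indicator F z\<bar>
       \<le> ennreal (C / ((b - 1) * \<rho>) ^ n) * indicator (ball y ((b + 1) * \<rho>)) z" .
  qed (use Fm in \<open>auto simp: M.emeasure_eq_measure intro!: integrable_real_indicator\<close>)
  also have "\<dots> = ennreal (C / ((b - 1) * \<rho>) ^ n) * (\<integral>\<^sup>+z. indicator (ball y ((b + 1) * \<rho>)) z \<partial>M)"
    by (simp add: nn_integral_cmult)
  also have "\<dots> \<le> ennreal (C / ((b - 1) * \<rho>) ^ n) * ennreal (V * ((b + 1) * \<rho>) ^ n)"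
    using \<rho> by (intro mult_left_mono nn_integral_ball_indicator_le) auto
  also have "\<dots> = ennreal (C / ((b - 1) * \<rho>) ^ n * (V * ((b + 1) * \<rho>) ^ n))"
    using C_pos V_pos \<rho> b4 by (intro ennreal_mult[symmetric]) auto
  also have "\<dots> \<le> ennreal (C / ((b - 1) * \<rho>) ^ n * (V * (2 * ((b - 1) * \<rho>)) ^ n))"
    using C_pos V_pos \<rho> b4 b_ge by (intro ennreal_leI mult_left_mono power_mono) auto
  also have "C / ((b - 1) * \<rho>) ^ n * (V * (2 * ((b - 1) * \<rho>)) ^ n) = C * V * 2 ^ n"
  proof -
    have "C / c ^ n * (V * (2 * c) ^ n) = C * V * 2 ^ n" if "c > 0" for c
      using that by (simp add: power_mult_distrib)
    then show ?thesis using b4 by blast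
  qed
  finally show ?thesis using C_pos V_pos by (subst (asm) ennreal_le_iff) auto
qed

definition transfer_const :: real where
  "transfer_const = C * V * b ^ n + (W * V + C * 2 ^ n * V)"

lemma transfer_const_nonneg: "transfer_const \<ge> 0"
  using C_pos V_pos W_nonneg by (simp add: transfer_const_def)

text \<open>A point mass at \<open>x\<close> and the same mass spread over \<open>E\<close> produce nearly the same function outside
  \<open>B(x, b \<rho>)\<close>, by the Hoermander condition for the transposed kernel. In the shell \<open>\<rho> \<le> |x - z| < b \<rho>\<close> the
  point mass is estimated alone. The spread mass is discarded there, since without doubling there is
  no bound for it near the boundary of \<open>E\<close>.\<close>

lemma point_mass_transfer:
  assumes e: "e > 0" and x: "x \<in> \<Omega>" and [measurable]: "E \<in> sets M" and E: "E \<subseteq> ball x \<rho>"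
  shows "(\<integral>\<^sup>+z. ennreal \<bar>measure M E * Kt e z x - indicator {z. b * \<rho> \<le> dist x z} z * trunc e (indicator E) z\<bar>
        * indicator {z. \<rho> \<le> dist x z} z \<partial>M) \<le> ennreal (transfer_const * measure M E)"
proof (cases "\<rho> > 0")
  case False
  then have "ball x \<rho> = {}" by simp
  then have "E = {}" using E by (metis subset_empty)
  then show ?thesis by (simp add: trunc_def)
next
  case \<rho>: True
  interpret T: cz_kernel_domain \<Omega> b V n "\<lambda>x y. K y x" C \<omega> by (rule transpose)
  let ?m = "measure M E"
  have intE: "integrable M (indicator E :: 'a \<Rightarrow> real)"
    by (intro integrable_real_indicator) (auto simp: M.emeasure_eq_measure)
  let ?g = "\<lambda>z y. ennreal \<bar>Kt e z x - Kt e z y\<bar> * indicator {z. b * \<rho> \<le> dist x z} z * indicator E y"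
  have "(\<integral>\<^sup>+z. ennreal \<bar>?m * Kt e z x - indicator {z. b * \<rho> \<le> dist x z} z * trunc e (indicator E) z\<bar>
        * indicator {z. \<rho> \<le> dist x z} z \<partial>M)
     \<le> (\<integral>\<^sup>+z. ennreal (?m * (C / \<rho> ^ n)) * indicator (ball x (b * \<rho>)) z + (\<integral>\<^sup>+y. ?g z y \<partial>M) \<partial>M)"
  proof (intro nn_integral_mono)
    fix z assume "z \<in> space M"
    then have z: "z \<in> \<Omega>" by simp
    show "ennreal \<bar>?m * Kt e z x - indicator {z. b * \<rho> \<le> dist x z} z * trunc e (indicator E) z\<bar>
        * indicator {z. \<rho> \<le> dist x z} z \<le> ennreal (?m * (C / \<rho> ^ n)) * indicator (ball x (b * \<rho>)) z + (\<integral>\<^sup>+y. ?g z y \<partial>M)"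
    proof (cases "b * \<rho> \<le> dist x z")
      case True
      have "ennreal \<bar>?m * Kt e z x - trunc e (indicator E) z\<bar>
         = ennreal \<bar>(\<integral>y. Kt e z x * indicator E y \<partial>M) - (\<integral>y. Kt e z y * indicator E y \<partial>M)\<bar>"
        using sets.sets_into_space[OF assms(3)] by (simp add: trunc_def Int_absorb2 mult.commute)
      also have "\<dots> \<le> (\<integral>\<^sup>+y. ?g z y \<partial>M)"
      proof (intro abs_integral_diff_le Kt_integrable intE)
        show "integrable M (\<lambda>y. Kt e z x * indicator E y)" using intE by simp
        fix y show "ennreal \<bar>Kt e z x * indicator E y - Kt e z y * indicator E y\<bar> \<le> ?g z y"
          using True by (auto simp: indicator_def)
      qed
      finally show ?thesis using True by (auto simp: indicator_def add_increasing)
    next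
      case False
      have "\<bar>Kt e z x\<bar> \<le> C / \<rho> ^ n" if "\<rho> \<le> dist x z"
        using Kt_size[OF z x \<rho>, of e] that by (simp add: dist_commute)
      then have "ennreal (?m * \<bar>Kt e z x\<bar>) \<le> ennreal (?m * (C / \<rho> ^ n))" if "\<rho> \<le> dist x z"
        using that by (intro ennreal_leI mult_left_mono) auto
      then show ?thesis using False by (auto simp: indicator_def abs_mult add_increasing2)
    qed
  qed
  also have "\<dots> = ennreal (?m * (C / \<rho> ^ n)) * (\<integral>\<^sup>+z. indicator (ball x (b * \<rho>)) z \<partial>M) + (\<integral>\<^sup>+z. (\<integral>\<^sup>+y. ?g z y \<partial>M) \<partial>M)"
    by (subst nn_integral_add) (auto simp: nn_integral_cmult)
  also have "(\<integral>\<^sup>+z. (\<integral>\<^sup>+y. ?g z y \<partial>M) \<partial>M) = (\<integral>\<^sup>+y. (\<integral>\<^sup>+z. ?g z y \<partial>M) \<partial>M)"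
    by (rule MM.Fubini'[symmetric]) measurable
  also have "\<dots> \<le> (\<integral>\<^sup>+y\<in>E. ennreal (W * V + C * 2 ^ n * V) \<partial>M)"
  proof (intro nn_integral_mono)
    fix y assume y: "y \<in> space M"
    show "(\<integral>\<^sup>+z. ?g z y \<partial>M) \<le> ennreal (W * V + C * 2 ^ n * V) * indicator E y"
    proof (cases "y \<in> E")
      case True
      then have "dist x y \<le> \<rho>" using E by auto
      then have "(\<integral>\<^sup>+z. ennreal \<bar>T.Kt e x z - T.Kt e y z\<bar> * indicator {z. b * \<rho> \<le> dist x z} z \<partial>M) \<le> ennreal (T.W * V + C * 2 ^ n * V)"
        using y by (intro T.hormander_trunc_fst e x \<rho>) auto
      then show ?thesis using True by (simp add: transpose_Kt T.W_def W_def)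
    qed simp
  qed
  also have "\<dots> = ennreal (W * V + C * 2 ^ n * V) * ennreal ?m"
    by (subst nn_integral_cmult_indicator) (auto simp: M.emeasure_eq_measure)
  also have "ennreal (?m * (C / \<rho> ^ n)) * (\<integral>\<^sup>+z. indicator (ball x (b * \<rho>)) z \<partial>M) \<le> ennreal (?m * (C / \<rho> ^ n)) * ennreal (V * (b * \<rho>) ^ n)"
    using \<rho> by (intro mult_left_mono nn_integral_ball_indicator_le) auto
  also have "ennreal (?m * (C / \<rho> ^ n)) * ennreal (V * (b * \<rho>) ^ n) + ennreal (W * V + C * 2 ^ n * V) * ennreal ?m
     = ennreal (?m * (C / \<rho> ^ n) * (V * (b * \<rho>) ^ n) + (W * V + C * 2 ^ n * V) * ?m)"
    using C_pos V_pos \<rho> W_nonneg by (simp flip: ennreal_mult ennreal_plus)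
  also have "?m * (C / \<rho> ^ n) * (V * (b * \<rho>) ^ n) + (W * V + C * 2 ^ n * V) * ?m = transfer_const * ?m"
    using \<rho> by (simp add: transfer_const_def power_mult_distrib distrib_right)
  finally show ?thesis by (simp add: add_right_mono)
qed

definition swept_const :: "real \<Rightarrow> real" where
  "swept_const A = C * V * 2 ^ n + (1 + A) * (cz_kernel_domain.cotlar_const b V n C \<omega> 2 A)\<^sup>2"

text \<open>Let \<open>F\<close> be the level set and \<open>U\<close> the union of the \<open>E i\<close>. Integrating the sum over \<open>F\<close> and moving the
  operator to the other side gives integrals over \<open>E i\<close> of the transposed operator applied to the part
  of \<open>F\<close> outside a ball. Up to a constant these are truncations of the transpose applied to the
  indicator of \<open>F\<close>, so by disjointness their sum is an integral over \<open>U\<close> of a function of weak type \<open>2\<close>.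
  Kolmogorov's inequality yields \<open>2 |F| \<le> const |U| + |F|\<close>.\<close>

lemma swept_tail_level:
  fixes x :: "nat \<Rightarrow> 'a"
  assumes T2: "cz_kernel_domain.strong_type \<Omega> (\<lambda>x y. K y x) 2 A" and e: "e > 0"
    and disj: "disjoint_family_on E {..<m}"
    and E: "\<And>i. i < m \<Longrightarrow> E i \<in> sets M" "\<And>i. i < m \<Longrightarrow> E i \<subseteq> ball (x i) (\<rho> i)"
    and s: "\<And>i. i < m \<Longrightarrow> \<bar>s i\<bar> \<le> (1::real)"
  shows "measure M {z\<in>\<Omega>. (\<Sum>i<m. s i * (indicator {z. b * \<rho> i \<le> dist (x i) z} z * trunc e (indicator (E i)) z)) > 2}
     \<le> swept_const A * measure M (\<Union>i<m. E i)"
proof -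
  let ?\<tau> = "\<lambda>i z. indicator {z. b * \<rho> i \<le> dist (x i) z} z * trunc e (indicator (E i)) z"
  interpret T: cz_kernel_domain \<Omega> b V n "\<lambda>x y. K y x" C \<omega> by (rule transpose)
  have A: "A \<ge> 0" using T2 by (simp add: T.strong_type_def)
  \<comment> \<open>The weak type constant of the maximal truncation. Using \<open>c\<close> also as the level at which
    Kolmogorov's inequality is split makes the coefficient of \<open>|F|\<close> equal to \<open>1\<close>.\<close>
  define c where "c = (1 + A) * (T.cotlar_const 2 A)\<^sup>2"
  have c: "c > 0" using T.cotlar_const_pos[OF A, of 2] A by (simp add: c_def)
  have [measurable]: "E i \<in> sets M" if "i < m" for i using E that by simp
  define \<sigma> where "\<sigma> z = (\<Sum>i<m. s i * ?\<tau> i z)" for z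
  have \<sigma>_meas [measurable]: "\<sigma> \<in> borel_measurable M"
    unfolding \<sigma>_def by (intro borel_measurable_sum borel_measurable_times borel_measurable_const indicator_borel_M(2)[OF far_borel] trunc_measurable borel_measurable_indicator) auto
  define F where "F = {z\<in>\<Omega>. \<sigma> z > 2}"
  have F [measurable]: "F \<in> sets M"
  proof -
    have "{z\<in>space M. \<sigma> z > 2} \<in> sets M" by measurable
    then show ?thesis by (simp add: F_def)
  qed
  define Fi where "Fi i = F \<inter> {z. b * \<rho> i \<le> dist (x i) z}" for i
  have Fi [measurable]: "Fi i \<in> sets M" for i
  proof -
    have "Fi i = F \<inter> (- ball (x i) (b * \<rho> i) \<inter> \<Omega>)" by (auto simp: Fi_def F_def not_less)
    then show ?thesis using sets_M_ball F by auto
  qed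
  have ind_int: "integrable M (indicator S :: 'a \<Rightarrow> real)" if "S \<in> sets M" for S
    using that by (intro integrable_real_indicator) (auto simp: M.emeasure_eq_measure)
  let ?U = "\<Union>i<m. E i"
  have U: "?U \<in> sets M" by (intro sets.finite_UN) (use E in auto)
  define g where "g y = (\<Sum>i<m. indicator (E i) y * \<bar>T.trunc (max e (b * \<rho> i)) (indicator F) y\<bar>)" for y
  have [measurable]: "g \<in> borel_measurable M"
    unfolding g_def by (intro borel_measurable_sum borel_measurable_times borel_measurable_abs T.trunc_measurable borel_measurable_indicator) auto
  have g0: "g y \<ge> 0" for y unfolding g_def by (intro sum_nonneg) auto
  have gE: "g y = \<bar>T.trunc (max e (b * \<rho> i)) (indicator F) y\<bar>" if "i < m" "y \<in> E i" for i y
  proof -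
    have "g y = (\<Sum>k\<in>{i}. indicator (E k) y * \<bar>T.trunc (max e (b * \<rho> k)) (indicator F) y\<bar>)"
      unfolding g_def using that disj
      by (intro sum.mono_neutral_right) (auto simp: disjoint_family_on_def indicator_def)
    then show ?thesis using that by simp
  qed
  have gout: "g y = 0" if "y \<notin> ?U" for y
    unfolding g_def using that by (intro sum.neutral) auto
  have powF: "powint M 2 (indicator F) = ennreal (measure M F)"
  proof -
    have "powint M 2 (indicator F) = (\<integral>\<^sup>+y. indicator F y \<partial>M)"
      unfolding powint_def by (intro nn_integral_cong) (auto simp: indicator_def)
    then show ?thesis by (simp add: M.emeasure_eq_measure)
  qed
  have "(\<integral>\<^sup>+y. ennreal \<bar>g y\<bar> \<partial>M) \<le> ennreal (c * measure M ?U + (c * measure M F) / c)"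
  proof (rule kolmogorov_weak_L2)
    fix t :: real assume t: "t > 0"
    have sub: "{y\<in>space M. \<bar>g y\<bar> > t} \<subseteq> ?U" using gout t by force
    then show "emeasure M {y\<in>space M. \<bar>g y\<bar> > t} \<le> ennreal (measure M ?U)"
      using U by (auto simp: M.emeasure_eq_measure[symmetric] intro!: emeasure_mono)
    obtain G where G: "G \<in> sets M"
       "emeasure M G \<le> ennreal ((1 + A) * T.cotlar_const 2 A powr 2 / t powr 2) * powint M 2 (indicator F)"
       "\<And>y \<epsilon>. y \<in> \<Omega> \<Longrightarrow> y \<notin> G \<Longrightarrow> e \<le> \<epsilon> \<Longrightarrow> \<bar>T.trunc \<epsilon> (indicator F) y\<bar> \<le> t"
      by (rule T.cotlar_weak_type[OF _ T2 _ _ e t, of "indicator F"]) (auto simp: powF)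
    have "{y\<in>space M. \<bar>g y\<bar> > t} \<subseteq> G"
    proof
      fix y assume y: "y \<in> {y\<in>space M. \<bar>g y\<bar> > t}"
      then obtain i where i: "i < m" "y \<in> E i" using sub by auto
      show "y \<in> G"
      proof (rule ccontr)
        assume "y \<notin> G"
        then have "\<bar>g y\<bar> \<le> t" using G(3)[of y "max e (b * \<rho> i)"] y by (simp add: gE[OF i])
        then show False using y by simp
      qed
    qed
    then have "emeasure M {y\<in>space M. \<bar>g y\<bar> > t} \<le> emeasure M G" using G by (intro emeasure_mono) auto
    also note G(2)
    also have "ennreal ((1 + A) * T.cotlar_const 2 A powr 2 / t powr 2) * powint M 2 (indicator F)
       = ennreal (c * measure M F / t\<^sup>2)"
      using A t T.cotlar_const_pos[OF A, of 2] unfolding powF c_def by (simp add: mult_ac flip: ennreal_mult)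
    finally show "emeasure M {y\<in>space M. \<bar>g y\<bar> > t} \<le> ennreal (c * measure M F / t\<^sup>2)" .
  qed (use c M.sigma_finite_measure_axioms in auto)
  then have g_le: "(\<integral>\<^sup>+y. ennreal (g y) \<partial>M) \<le> ennreal (c * measure M ?U + measure M F)"
    using c g0 by simp
  have g_int: "integrable M g"
    using g_le g0 by (intro integrableI_nonneg) (auto intro: order_le_less_trans)
  have g_le': "(\<integral>y. g y \<partial>M) \<le> c * measure M ?U + measure M F"
  proof -
    have "ennreal (\<integral>y. g y \<partial>M) \<le> ennreal (c * measure M ?U + measure M F)"
      using g_le g0 g_int by (subst (asm) nn_integral_eq_integral) auto
    then show ?thesis using c by (subst (asm) ennreal_le_iff) auto
  qed
  have tail_le: "(\<integral>z. s i * ?\<tau> i z * indicator F z \<partial>M)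
      \<le> (\<integral>y. indicator (E i) y * g y \<partial>M) + C * V * 2 ^ n * measure M (E i)"
    and tail_int: "integrable M (\<lambda>z. s i * ?\<tau> i z * indicator F z)"
    if i: "i < m" for i
  proof -
    have "(\<lambda>z. s i * ?\<tau> i z * indicator F z)
       = (\<lambda>z. s i * (trunc e (indicator (E i)) z * indicator (Fi i) z))"
      by (auto simp: fun_eq_iff Fi_def indicator_def)
    note eq = this
    have bd: "\<bar>trunc e (indicator (E i)) z\<bar> \<le> C / e ^ n * (\<integral>y. \<bar>indicator (E i) y\<bar> \<partial>M)" for z
      using i e ind_int by (intro trunc_sup_bound) auto
    have int1: "integrable M (\<lambda>z. trunc e (indicator (E i)) z * indicator (Fi i) z)"
    proof (rule M.integrable_const_bound)
      show "AE z in M. norm (trunc e (indicator (E i)) z * indicator (Fi i) z) \<le> C / e ^ n * (\<integral>y. \<bar>indicator (E i) y\<bar> \<partial>M)"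
        using bd order_trans[OF abs_ge_zero bd] by (intro AE_I2) (auto simp: indicator_def)
    qed (use i in measurable)
    then show "integrable M (\<lambda>z. s i * ?\<tau> i z * indicator F z)"
      unfolding eq by simp
    have "(\<integral>z. s i * (trunc e (indicator (E i)) z * indicator (Fi i) z) \<partial>M)
        = s i * (\<integral>y. indicator (E i) y * T.trunc e (indicator (Fi i)) y \<partial>M)"
      using trunc_duality[OF ind_int ind_int, of "E i" "Fi i" e] i Fi by simp
    also have "\<dots> \<le> \<bar>s i * (\<integral>y. indicator (E i) y * T.trunc e (indicator (Fi i)) y \<partial>M)\<bar>" by simp
    also have "\<dots> \<le> 1 * \<bar>\<integral>y. indicator (E i) y * T.trunc e (indicator (Fi i)) y \<partial>M\<bar>"
      unfolding abs_mult using s[OF i] by (intro mult_right_mono) auto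
    also have "\<dots> \<le> (\<integral>y. \<bar>indicator (E i) y * T.trunc e (indicator (Fi i)) y\<bar> \<partial>M)" by simp
    also have "\<dots> \<le> (\<integral>y. indicator (E i) y * g y + C * V * 2 ^ n * indicator (E i) y \<partial>M)"
    proof (rule integral_mono')
      show "integrable M (\<lambda>y. indicator (E i) y * g y + C * V * 2 ^ n * indicator (E i) y)"
        using integrable_mult_indicator[OF E(1)[OF i] g_int] ind_int[OF E(1)[OF i]] by simp
      fix y assume "y \<in> space M"
      show "0 \<le> indicator (E i) y * g y + C * V * 2 ^ n * indicator (E i) y"
        using g0[of y] C_pos V_pos by simp
      show "\<bar>indicator (E i) y * T.trunc e (indicator (Fi i)) y\<bar> \<le> indicator (E i) y * g y + C * V * 2 ^ n * indicator (E i) y"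
      proof (cases "y \<in> E i")
        case True
        have "\<bar>T.trunc e (indicator (Fi i)) y - T.trunc (max e (b * \<rho> i)) (indicator F) y\<bar> \<le> C * V * 2 ^ n"
          unfolding Fi_def using True E[OF i] \<open>y \<in> space M\<close> by (intro T.trunc_recenter e F) auto
        then show ?thesis using True gE[OF i True] by simp
      qed simp
    qed
    also have "\<dots> = (\<integral>y. indicator (E i) y * g y \<partial>M) + C * V * 2 ^ n * measure M (E i)"
      using integrable_mult_indicator[OF E(1)[OF i] g_int] ind_int[OF E(1)[OF i]] E(1)[OF i] sets.sets_into_space[OF E(1)[OF i]]
      by (simp add: Int_absorb2)
    finally show "(\<integral>z. s i * ?\<tau> i z * indicator F z \<partial>M)
      \<le> (\<integral>y. indicator (E i) y * g y \<partial>M) + C * V * 2 ^ n * measure M (E i)" unfolding eq .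
  qed
  have U_sum: "(\<Sum>i<m. measure M (E i)) = measure M ?U"
    using disj E by (intro M.finite_measure_finite_Union[symmetric]) auto
  have \<sigma>F: "(\<lambda>z. \<sigma> z * indicator F z) = (\<lambda>z. \<Sum>i<m. s i * ?\<tau> i z * indicator F z)"
    unfolding \<sigma>_def sum_distrib_right ..
  have "2 * measure M F = (\<integral>z. 2 * indicator F z \<partial>M)"
    using sets.sets_into_space[OF F] by (simp add: Int_absorb2)
  also have "\<dots> \<le> (\<integral>z. \<sigma> z * indicator F z \<partial>M)"
  proof (rule integral_mono)
    show "integrable M (\<lambda>z. \<sigma> z * indicator F z)" unfolding \<sigma>F by (intro Bochner_Integration.integrable_sum tail_int) auto
    show "integrable M (\<lambda>z. 2 * indicator F z :: real)" using ind_int[OF F] by simp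
    fix z show "2 * indicator F z \<le> \<sigma> z * indicator F z" by (auto simp: F_def indicator_def)
  qed
  also have "\<dots> = (\<Sum>i<m. \<integral>z. s i * ?\<tau> i z * indicator F z \<partial>M)"
    unfolding \<sigma>F by (intro Bochner_Integration.integral_sum tail_int) auto
  also have "\<dots> \<le> (\<Sum>i<m. (\<integral>y. indicator (E i) y * g y \<partial>M) + C * V * 2 ^ n * measure M (E i))"
    by (intro sum_mono tail_le) auto
  also have "\<dots> = (\<Sum>i<m. \<integral>y. indicator (E i) y * g y \<partial>M) + C * V * 2 ^ n * measure M ?U"
    by (simp add: sum.distrib sum_distrib_left[symmetric] U_sum)
  also have "(\<Sum>i<m. \<integral>y. indicator (E i) y * g y \<partial>M) = (\<integral>y. (\<Sum>i<m. indicator (E i) y * g y) \<partial>M)"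
    using integrable_mult_indicator[OF E(1) g_int] by (intro Bochner_Integration.integral_sum[symmetric]) auto
  also have "\<dots> = (\<integral>y. g y \<partial>M)"
  proof (intro Bochner_Integration.integral_cong refl)
    fix y
    show "(\<Sum>i<m. indicator (E i) y * g y) = g y"
    proof (cases "y \<in> ?U")
      case True
      then obtain i where i: "i < m" "y \<in> E i" by auto
      have "(\<Sum>k<m. indicator (E k) y * g y) = (\<Sum>k\<in>{i}. indicator (E k) y * g y)"
        using i disj by (intro sum.mono_neutral_right) (auto simp: disjoint_family_on_def indicator_def)
      then show ?thesis using i by simp
    qed (simp add: gout)
  qed
  finally have "2 * measure M F \<le> c * measure M ?U + measure M F + C * V * 2 ^ n * measure M ?U"
    using g_le' by linarith
  then have "measure M F \<le> swept_const A * measure M ?U"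
    unfolding swept_const_def c_def by (simp add: algebra_simps)
  then show ?thesis by (simp only: F_def \<sigma>_def)
qed

definition weak_const :: "real \<Rightarrow> real" where
  "weak_const A = 3 * (1 + transfer_const + 2 * swept_const A)"

lemma swept_const_nonneg: "A \<ge> 0 \<Longrightarrow> swept_const A \<ge> 0"
  using C_pos V_pos by (simp add: swept_const_def)

text \<open>The weights are normalised so that the sets \<open>E i\<close> have measure \<open>|a i|\<close> and the level is \<open>3\<close>, which is split
  into \<open>1\<close> for the transfer error and \<open>2\<close> for the tails of the spread masses.\<close>

lemma weak_type_point_masses:
  fixes x :: "nat \<Rightarrow> 'a" and \<alpha> :: "nat \<Rightarrow> real"
  assumes T2: "cz_kernel_domain.strong_type \<Omega> (\<lambda>x y. K y x) 2 A" and e: "e > 0" and t: "t > 0"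
    and x: "\<And>i. i < m \<Longrightarrow> x i \<in> \<Omega>"
  shows "emeasure M {z\<in>\<Omega>. \<bar>\<Sum>i<m. \<alpha> i * Kt e z (x i)\<bar> > t} \<le> ennreal (weak_const A / t * (\<Sum>i<m. \<bar>\<alpha> i\<bar>))"
proof -
  interpret T: cz_kernel_domain \<Omega> b V n "\<lambda>x y. K y x" C \<omega> by (rule transpose)
  have A: "A \<ge> 0" using T2 by (simp add: T.strong_type_def)
  define a where "a i = 3 * \<alpha> i / t" for i
  let ?S = "\<Sum>i<m. \<bar>a i\<bar>"
  define L where "L = {z\<in>\<Omega>. \<bar>\<Sum>i<m. a i * Kt e z (x i)\<bar> > 3}"
  have S: "?S = 3 / t * (\<Sum>i<m. \<bar>\<alpha> i\<bar>)"
    using t by (simp add: a_def abs_mult sum_distrib_left)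
  have L: "{z\<in>\<Omega>. \<bar>\<Sum>i<m. \<alpha> i * Kt e z (x i)\<bar> > t} = L"
  proof -
    have "(\<Sum>i<m. a i * Kt e z (x i)) = 3 / t * (\<Sum>i<m. \<alpha> i * Kt e z (x i))" for z
      by (simp add: a_def sum_distrib_left mult.assoc)
    moreover have "3 < \<bar>3 / t * X\<bar> \<longleftrightarrow> t < \<bar>X\<bar>" for X
      using t by (simp add: abs_mult field_simps)
    ultimately show ?thesis by (simp only: L_def)
  qed
  have Lm [measurable]: "L \<in> sets M"
  proof -
    have "{z\<in>space M. \<bar>\<Sum>i<m. a i * Kt e z (x i)\<bar> > 3} \<in> sets M" by measurable
    then show ?thesis by (simp add: L_def)
  qed
  let ?c = "1 + transfer_const + 2 * swept_const A"
  have c1: "?c \<ge> 1" using transfer_const_nonneg swept_const_nonneg[OF A] by simp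
  have "measure M L \<le> ?c * ?S"
  \<comment> \<open>If the weights sum to at least the measure of \<open>\<Omega>\<close>, the bound is trivial.\<close>
  proof (cases "?S < measure M \<Omega>")
    case False
    have "measure M L \<le> measure M \<Omega>" by (intro M.finite_measure_mono) (auto simp: L_def sets.top[of M, simplified])
    also have "\<dots> \<le> 1 * ?S" using False by simp
    also have "\<dots> \<le> ?c * ?S" using c1 by (intro mult_right_mono sum_nonneg) auto
    finally show ?thesis .
  next
    case True
    obtain \<rho> E where disj: "disjoint_family_on E {..<m}" and
      E: "\<And>i. i < m \<Longrightarrow> \<rho> i \<ge> 0" "\<And>i. i < m \<Longrightarrow> E i \<in> sets M" "\<And>i. i < m \<Longrightarrow> E i \<subseteq> ball (x i) (\<rho> i)"
         "\<And>i. i < m \<Longrightarrow> measure M (E i) = \<bar>a i\<bar>" "\<And>i. i < m \<Longrightarrow> ball (x i) (\<rho> i) \<inter> \<Omega> \<subseteq> (\<Union>j\<le>i. E j)"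
      using sweeping[of m "\<lambda>i. \<bar>a i\<bar>" x] True by (auto simp del: UN_simps) metis
    have [measurable]: "E i \<in> sets M" if "i < m" for i using E that by simp
    let ?\<tau> = "\<lambda>i z. indicator {z. b * \<rho> i \<le> dist (x i) z} z * trunc e (indicator (E i)) z"
    let ?U = "\<Union>i<m. E i"
    have U [measurable]: "?U \<in> sets M" by (intro sets.finite_UN) (use E in auto)
    have mU: "measure M ?U = ?S"
      using disj E by (subst M.finite_measure_finite_Union) (auto intro!: sum.cong)
    define \<phi> where "\<phi> i z = measure M (E i) * Kt e z (x i) - ?\<tau> i z" for i z
    have \<phi>_meas [measurable]: "\<phi> i \<in> borel_measurable M" if "i < m" for i
      unfolding \<phi>_def using that
      by (intro borel_measurable_diff borel_measurable_times borel_measurable_const indicator_borel_M(2)[OF far_borel] trunc_measurable borel_measurable_indicator) auto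
    define \<sigma> where "\<sigma> s z = (\<Sum>i<m. s i * ?\<tau> i z)" for s :: "nat \<Rightarrow> real" and z
    define D where "D z = (\<Sum>i<m. sgn (a i) * \<phi> i z)" for z
    have D_meas [measurable]: "D \<in> borel_measurable M"
      unfolding D_def by (intro borel_measurable_sum borel_measurable_times \<phi>_meas) auto
    have split: "(\<Sum>i<m. a i * Kt e z (x i)) = D z + \<sigma> (\<lambda>i. sgn (a i)) z" for z
      unfolding D_def \<sigma>_def sum.distrib[symmetric]
    proof (intro sum.cong refl)
      fix i assume "i \<in> {..<m}"
      then have "sgn (a i) * measure M (E i) = a i" using E(4)[of i] by (simp add: sgn_mult_abs)
      then show "a i * Kt e z (x i) = sgn (a i) * \<phi> i z + sgn (a i) * ?\<tau> i z"
        unfolding \<phi>_def by (simp add: algebra_simps)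
    qed
    let ?P = "{z\<in>\<Omega>. \<bar>D z * indicator (- ?U) z\<bar> > 1}"
    let ?Q = "\<lambda>s. {z\<in>\<Omega>. \<sigma> s z > 2}"
    have \<sigma>_meas: "\<sigma> s \<in> borel_measurable M" for s
      unfolding \<sigma>_def by (intro borel_measurable_sum borel_measurable_times borel_measurable_const indicator_borel_M(2)[OF far_borel] trunc_measurable borel_measurable_indicator) auto
    have Q: "?Q s \<in> sets M" for s
    proof -
      note \<sigma>_meas[of s, measurable]
      have "{z\<in>space M. \<sigma> s z > 2} \<in> sets M" by measurable
      then show ?thesis by simp
    qed
    have DU_meas [measurable]: "(\<lambda>z. D z * indicator (- ?U) z) \<in> borel_measurable M"
    proof -
      have "(\<lambda>z. D z * (1 - indicator ?U z)) \<in> borel_measurable M" by measurable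
      also have "(\<lambda>z. D z * (1 - indicator ?U z)) = (\<lambda>z. D z * indicator (- ?U) z)"
        by (auto simp: fun_eq_iff indicator_def)
      finally show ?thesis .
    qed
    have P: "?P \<in> sets M"
    proof -
      have "{z\<in>space M. \<bar>D z * indicator (- ?U) z\<bar> > 1} \<in> sets M" by measurable
      then show ?thesis by simp
    qed
    have "L \<subseteq> ?U \<union> ?P \<union> ?Q (\<lambda>i. sgn (a i)) \<union> ?Q (\<lambda>i. - sgn (a i))"
    proof
      fix z assume "z \<in> L"
      then have z: "z \<in> \<Omega>" "\<bar>D z + \<sigma> (\<lambda>i. sgn (a i)) z\<bar> > 3" by (auto simp: L_def split)
      have "\<sigma> (\<lambda>i. - sgn (a i)) z = - \<sigma> (\<lambda>i. sgn (a i)) z" by (simp add: \<sigma>_def sum_negf)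
      then show "z \<in> ?U \<union> ?P \<union> ?Q (\<lambda>i. sgn (a i)) \<union> ?Q (\<lambda>i. - sgn (a i))"
        using z by (auto simp: indicator_def)
    qed
    then have "measure M L \<le> measure M (?U \<union> ?P \<union> ?Q (\<lambda>i. sgn (a i)) \<union> ?Q (\<lambda>i. - sgn (a i)))"
      using U P Q by (intro M.finite_measure_mono) auto
    also have "\<dots> \<le> measure M ?U + measure M ?P + measure M (?Q (\<lambda>i. sgn (a i))) + measure M (?Q (\<lambda>i. - sgn (a i)))"
      by (intro order_trans[OF measure_Un_le] add_mono U P Q order_refl sets.Un)
    also have "\<dots> \<le> ?S + transfer_const * ?S + swept_const A * ?S + swept_const A * ?S"
    proof (intro add_mono)
      show "measure M ?U \<le> ?S" using mU by simp
      show "measure M (?Q (\<lambda>i. sgn (a i))) \<le> swept_const A * ?S" "measure M (?Q (\<lambda>i. - sgn (a i))) \<le> swept_const A * ?S"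
        unfolding \<sigma>_def mU[symmetric] using E by (intro swept_tail_level[OF T2 e disj]; auto simp: sgn_real_def)+
      have "ennreal (measure M ?P) = emeasure M {z\<in>space M. \<bar>D z * indicator (- ?U) z\<bar> > 1}" by (simp add: M.emeasure_eq_measure)
      also have "\<dots> \<le> ennreal (1 / 1 powr 1) * powint M 1 (\<lambda>z. D z * indicator (- ?U) z)"
        by (rule powint_Markov) auto
      also have "\<dots> = (\<integral>\<^sup>+z. ennreal \<bar>D z * indicator (- ?U) z\<bar> \<partial>M)" by (simp add: powint_one)
      also have "\<dots> \<le> (\<integral>\<^sup>+z. (\<Sum>i<m. ennreal \<bar>\<phi> i z\<bar> * indicator {z. \<rho> i \<le> dist (x i) z} z) \<partial>M)"
      proof (intro nn_integral_mono)
        fix z assume "z \<in> space M"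
        then have z: "z \<in> \<Omega>" by simp
        show "ennreal \<bar>D z * indicator (- ?U) z\<bar> \<le> (\<Sum>i<m. ennreal \<bar>\<phi> i z\<bar> * indicator {z. \<rho> i \<le> dist (x i) z} z)"
        proof (cases "z \<in> ?U")
          case False
          have far: "\<rho> i \<le> dist (x i) z" if "i < m" for i
          proof (rule ccontr)
            assume "\<not> ?thesis"
            then have "z \<in> ball (x i) (\<rho> i) \<inter> \<Omega>" using z by (simp add: not_le)
            then have "z \<in> (\<Union>j\<le>i. E j)" using E(5)[OF that] by (rule rev_subsetD)
            then show False using False that by auto
          qed
          have "\<bar>D z\<bar> \<le> (\<Sum>i<m. \<bar>sgn (a i) * \<phi> i z\<bar>)" unfolding D_def by (rule sum_abs)
          also have "\<dots> \<le> (\<Sum>i<m. \<bar>\<phi> i z\<bar>)" by (intro sum_mono) (auto simp: abs_mult sgn_real_def)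
          finally have "ennreal \<bar>D z * indicator (- ?U) z\<bar> \<le> ennreal (\<Sum>i<m. \<bar>\<phi> i z\<bar>)"
            using False by (intro ennreal_leI) simp
          also have "\<dots> = (\<Sum>i<m. ennreal \<bar>\<phi> i z\<bar>)" by (rule sum_ennreal[symmetric]) simp
          also have "\<dots> = (\<Sum>i<m. ennreal \<bar>\<phi> i z\<bar> * indicator {z. \<rho> i \<le> dist (x i) z} z)"
            using far by (intro sum.cong) auto
          finally show ?thesis .
        qed simp
      qed
      also have "\<dots> = (\<Sum>i<m. \<integral>\<^sup>+z. ennreal \<bar>\<phi> i z\<bar> * indicator {z. \<rho> i \<le> dist (x i) z} z \<partial>M)"
        by (intro nn_integral_sum) auto
      also have "\<dots> \<le> (\<Sum>i<m. ennreal (transfer_const * \<bar>a i\<bar>))"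
      proof (intro sum_mono)
        fix i assume i: "i \<in> {..<m}"
        then show "(\<integral>\<^sup>+z\<in>{z. \<rho> i \<le> dist (x i) z}. ennreal \<bar>\<phi> i z\<bar> \<partial>M) \<le> ennreal (transfer_const * \<bar>a i\<bar>)"
          using point_mass_transfer[OF e x[of i] E(2)[of i] E(3)[of i]] E(4)[of i] unfolding \<phi>_def by simp
      qed
      also have "\<dots> = ennreal (transfer_const * ?S)"
        using transfer_const_nonneg by (subst sum_ennreal) (auto simp: sum_distrib_left)
      finally show "measure M ?P \<le> transfer_const * ?S"
        using transfer_const_nonneg by (subst (asm) ennreal_le_iff) (auto intro!: mult_nonneg_nonneg sum_nonneg)
    qed
    also have "\<dots> = ?c * ?S" by (simp add: algebra_simps)
    finally show ?thesis .
  qed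
  then have "emeasure M L \<le> ennreal (?c * ?S)" by (simp add: M.emeasure_eq_measure ennreal_leI)
  also have "?c * ?S = weak_const A / t * (\<Sum>i<m. \<bar>\<alpha> i\<bar>)"
    unfolding S weak_const_def by simp
  finally show ?thesis unfolding L .
qed

text \<open>Replacing \<open>y\<close> by a simple function \<open>Z k y\<close> in the kernel turns the integral into one against finitely many
  point masses. The truncated kernel is continuous in \<open>y\<close> off the sphere \<open>|z - y| = e\<close>, a null set, so
  these integrals converge.\<close>

lemma weak_type_1_1:
  assumes T2: "cz_kernel_domain.strong_type \<Omega> (\<lambda>x y. K y x) 2 A" and e: "e > 0" and t: "t > 0"
    and f: "integrable M f"
  shows "emeasure M {z\<in>\<Omega>. \<bar>trunc e f z\<bar> > t} \<le> ennreal (weak_const A / t) * (\<integral>\<^sup>+y. ennreal \<bar>f y\<bar> \<partial>M)"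
proof -
  have [measurable]: "f \<in> borel_measurable M" using f by auto
  have A: "A \<ge> 0" using T2 by (simp add: cz_kernel_domain.strong_type_def[OF transpose])
  have w0: "weak_const A \<ge> 0" using transfer_const_nonneg swept_const_nonneg[OF A] by (simp add: weak_const_def)
  obtain Z where Z: "\<And>k. simple_function M (Z k)" "\<And>y. y \<in> \<Omega> \<Longrightarrow> (\<lambda>k. Z k y) \<longlonglongrightarrow> y"
    using borel_measurable_implies_sequence_metric[OF id_measurable_M, of 0] by auto
  have Zm [measurable]: "Z k \<in> borel_measurable M" for k using Z(1) by (rule borel_measurable_simple_function)
  define u where "u k z = (\<integral>y. Kt e z (Z k y) * f y \<partial>M)" for k z
  have um [measurable]: "u k \<in> borel_measurable M" for k unfolding u_def by measurable
  have intk: "integrable M (\<lambda>y. Kt e z (Z k y) * f y)" for z k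
  proof -
    have "integrable M (\<lambda>y. C / e ^ n * f y)" using f by simp
    then show ?thesis
    proof (rule Bochner_Integration.integrable_bound)
      show "AE y in M. norm (Kt e z (Z k y) * f y) \<le> norm (C / e ^ n * f y)"
      proof (rule AE_I2)
        fix y show "norm (Kt e z (Z k y) * f y) \<le> norm (C / e ^ n * f y)"
          using mult_right_mono[OF Kt_bound[OF e, of z "Z k y"], of "\<bar>f y\<bar>"] e C_pos by (simp add: abs_mult)
      qed
    qed measurable
  qed
  have lim: "(\<lambda>k. u k z) \<longlonglongrightarrow> trunc e f z" if z: "z \<in> \<Omega>" for z
    unfolding u_def trunc_def
  proof (rule integral_dominated_convergence)
    show "integrable M (\<lambda>y. C / e ^ n * \<bar>f y\<bar>)" using f by simp
    show "AE y in M. norm (Kt e z (Z k y) * f y) \<le> C / e ^ n * \<bar>f y\<bar>" for k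
    proof (rule AE_I2)
      fix y show "norm (Kt e z (Z k y) * f y) \<le> C / e ^ n * \<bar>f y\<bar>"
        using mult_right_mono[OF Kt_bound[OF e, of z "Z k y"], of "\<bar>f y\<bar>"] by (simp add: abs_mult)
    qed
    show "AE y in M. (\<lambda>k. Kt e z (Z k y) * f y) \<longlonglongrightarrow> Kt e z y * f y"
      using null_sphere[of z e] AE_space
    proof eventually_elim
      case (elim y)
      then have y: "y \<in> \<Omega>" by simp
      have Zy: "(\<lambda>k. Z k y) \<longlonglongrightarrow> y" by (rule Z(2)[OF y])
      have d: "(\<lambda>k. dist z (Z k y)) \<longlonglongrightarrow> dist z y" by (intro tendsto_intros Zy)
      have in\<Omega>: "\<forall>\<^sub>F k in sequentially. Z k y \<in> \<Omega>"
        by (rule topological_tendstoD[OF Zy open_dom y])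
      have "(\<lambda>k. Kt e z (Z k y)) \<longlonglongrightarrow> Kt e z y"
      proof (cases "dist z y < e")
        case True
        have "\<forall>\<^sub>F k in sequentially. dist z (Z k y) < e" using order_tendstoD(2)[OF d True] .
        then have "\<forall>\<^sub>F k in sequentially. Kt e z (Z k y) = Kt e z y"
          by eventually_elim (use True in \<open>auto simp: Kt_def\<close>)
        then show ?thesis by (rule tendsto_eventually)
      next
        case False
        then have gt: "e < dist z y" using elim by auto
        let ?W = "{p. fst p \<in> \<Omega> \<and> snd p \<in> \<Omega> \<and> fst p \<noteq> snd p}"
        have "\<forall>\<^sub>F k in sequentially. e < dist z (Z k y)" using order_tendstoD(1)[OF d gt] .
        with in\<Omega> have ev: "\<forall>\<^sub>F k in sequentially. (z, Z k y) \<in> ?W \<and> K z (Z k y) = Kt e z (Z k y)"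
          by eventually_elim (use e z in \<open>auto simp: Kt_def\<close>)
        have "(\<lambda>k. K (fst (z, Z k y)) (snd (z, Z k y))) \<longlonglongrightarrow> K (fst (z, y)) (snd (z, y))"
        proof (rule continuous_on_tendsto_compose[OF kernel_continuous])
          show "(\<lambda>k. (z, Z k y)) \<longlonglongrightarrow> (z, y)" by (intro tendsto_intros Zy)
          show "(z, y) \<in> ?W" using z y gt e by auto
          show "\<forall>\<^sub>F k in sequentially. (z, Z k y) \<in> ?W" using ev by eventually_elim auto
        qed
        then have "(\<lambda>k. K z (Z k y)) \<longlonglongrightarrow> Kt e z y" using z y gt e by (simp add: Kt_def)
        moreover have "\<forall>\<^sub>F k in sequentially. K z (Z k y) = Kt e z (Z k y)" using ev by eventually_elim auto
        ultimately show ?thesis by (rule Lim_transform_eventually)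
      qed
      then show ?case by (intro tendsto_intros)
    qed
  qed measurable
  show ?thesis
  proof (rule emeasure_le_of_eventually[where B="\<lambda>k. {z\<in>\<Omega>. \<bar>u k z\<bar> > t}"])
    have "{z\<in>space M. \<bar>trunc e f z\<bar> > t} \<in> sets M" "{z\<in>space M. \<bar>u k z\<bar> > t} \<in> sets M" for k by measurable
    then show "{z\<in>\<Omega>. \<bar>trunc e f z\<bar> > t} \<in> sets M" "{z\<in>\<Omega>. \<bar>u k z\<bar> > t} \<in> sets M" for k by simp_all
    fix z assume "z \<in> {z\<in>\<Omega>. \<bar>trunc e f z\<bar> > t}"
    then have z: "z \<in> \<Omega>" "t < \<bar>trunc e f z\<bar>" by auto
    have "(\<lambda>k. \<bar>u k z\<bar>) \<longlonglongrightarrow> \<bar>trunc e f z\<bar>" by (intro tendsto_intros lim z)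
    from order_tendstoD(1)[OF this z(2)]
    show "\<forall>\<^sub>F k in sequentially. z \<in> {z\<in>\<Omega>. \<bar>u k z\<bar> > t}" by eventually_elim (use z in auto)
  next
    fix k
    have fin: "finite (Z k ` \<Omega>)" using simple_functionD(1)[OF Z(1)[of k]] by simp
    define P where "P = Z k ` \<Omega> \<inter> \<Omega>"
    have finP: "finite P" using fin by (simp add: P_def)
    define \<beta> where "\<beta> v = (\<integral>y. indicator (Z k -` {v} \<inter> \<Omega>) y * f y \<partial>M)" for v
    have lev: "Z k -` {v} \<inter> \<Omega> \<in> sets M" for v using simple_functionD(2)[OF Z(1)[of k], of "{v}"] by simp
    have levint: "integrable M (\<lambda>y. indicator (Z k -` {v} \<inter> \<Omega>) y * f y)" for v
      using integrable_mult_indicator[OF lev f] by simp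
    have u_eq: "u k z = (\<Sum>v\<in>P. \<beta> v * Kt e z v)" for z
    proof -
      have "u k z = (\<integral>y. (\<Sum>v\<in>P. Kt e z v * (indicator (Z k -` {v} \<inter> \<Omega>) y * f y)) \<partial>M)"
        unfolding u_def
      proof (intro Bochner_Integration.integral_cong refl)
        fix y assume "y \<in> space M"
        then have y: "y \<in> \<Omega>" by simp
        show "Kt e z (Z k y) * f y = (\<Sum>v\<in>P. Kt e z v * (indicator (Z k -` {v} \<inter> \<Omega>) y * f y))"
        proof (cases "Z k y \<in> \<Omega>")
          case True
          have "(\<Sum>v\<in>P. Kt e z v * (indicator (Z k -` {v} \<inter> \<Omega>) y * f y))
             = (\<Sum>v\<in>{Z k y}. Kt e z v * (indicator (Z k -` {v} \<inter> \<Omega>) y * f y))"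
            using True y finP by (intro sum.mono_neutral_right) (auto simp: P_def)
          then show ?thesis using y by simp
        next
          case False
          have "(\<Sum>v\<in>P. Kt e z v * (indicator (Z k -` {v} \<inter> \<Omega>) y * f y)) = 0"
            using False by (intro sum.neutral) (auto simp: P_def indicator_def)
          then show ?thesis using False by (simp add: Kt_def)
        qed
      qed
      also have "\<dots> = (\<Sum>v\<in>P. Kt e z v * \<beta> v)"
        unfolding \<beta>_def using levint by (subst Bochner_Integration.integral_sum) auto
      finally show ?thesis by (simp add: mult.commute)
    qed
    obtain h where h: "bij_betw h {..<card P} P"
      using ex_bij_betw_nat_finite[OF finP] by (auto simp: atLeast0LessThan)
    have "(\<Sum>i<card P. \<bar>\<beta> (h i)\<bar>) = (\<Sum>v\<in>P. \<bar>\<beta> v\<bar>)" by (rule sum.reindex_bij_betw[OF h])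
    also have "(\<Sum>v\<in>P. \<bar>\<beta> v\<bar>) \<le> (\<Sum>v\<in>P. \<integral>y. \<bar>indicator (Z k -` {v} \<inter> \<Omega>) y * f y\<bar> \<partial>M)"
      unfolding \<beta>_def by (intro sum_mono) simp
    also have "\<dots> = (\<integral>y. (\<Sum>v\<in>P. \<bar>indicator (Z k -` {v} \<inter> \<Omega>) y * f y\<bar>) \<partial>M)"
      using levint by (intro Bochner_Integration.integral_sum[symmetric]) auto
    also have "\<dots> \<le> (\<integral>y. \<bar>f y\<bar> \<partial>M)"
    proof (rule integral_mono)
      show "integrable M (\<lambda>y. \<Sum>v\<in>P. \<bar>indicator (Z k -` {v} \<inter> \<Omega>) y * f y\<bar>)" using levint by auto
      show "integrable M (\<lambda>y. \<bar>f y\<bar>)" using f by simp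
      fix y
      have "(\<Sum>v\<in>P. \<bar>indicator (Z k -` {v} \<inter> \<Omega>) y * f y\<bar>) \<le> (\<Sum>v\<in>insert (Z k y) P. \<bar>indicator (Z k -` {v} \<inter> \<Omega>) y * f y\<bar>)"
        using finP by (intro sum_mono2) auto
      also have "\<dots> = (\<Sum>v\<in>{Z k y}. \<bar>indicator (Z k -` {v} \<inter> \<Omega>) y * f y\<bar>)"
        using finP by (intro sum.mono_neutral_right) (auto simp: indicator_def)
      also have "\<dots> \<le> \<bar>f y\<bar>" by (simp add: indicator_def)
      finally show "(\<Sum>v\<in>P. \<bar>indicator (Z k -` {v} \<inter> \<Omega>) y * f y\<bar>) \<le> \<bar>f y\<bar>" .
    qed
    finally have B: "(\<Sum>i<card P. \<bar>\<beta> (h i)\<bar>) \<le> (\<integral>y. \<bar>f y\<bar> \<partial>M)" .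
    have "{z\<in>\<Omega>. \<bar>u k z\<bar> > t} = {z\<in>\<Omega>. \<bar>\<Sum>i<card P. \<beta> (h i) * Kt e z (h i)\<bar> > t}"
      unfolding u_eq using sum.reindex_bij_betw[OF h, of "\<lambda>v. \<beta> v * Kt e z v" for z] by simp
    also have "emeasure M \<dots> \<le> ennreal (weak_const A / t * (\<Sum>i<card P. \<bar>\<beta> (h i)\<bar>))"
      using bij_betwE[OF h] by (intro weak_type_point_masses T2 e t) (auto simp: P_def)
    also have "\<dots> \<le> ennreal (weak_const A / t * (\<integral>y. \<bar>f y\<bar> \<partial>M))"
      using w0 t B by (intro ennreal_leI mult_left_mono) auto
    also have "\<dots> = ennreal (weak_const A / t) * (\<integral>\<^sup>+y. ennreal \<bar>f y\<bar> \<partial>M)"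
      using f w0 t by (simp add: nn_integral_eq_integral flip: ennreal_mult)
    finally show "emeasure M {z\<in>\<Omega>. \<bar>u k z\<bar> > t} \<le> ennreal (weak_const A / t) * (\<integral>\<^sup>+y. ennreal \<bar>f y\<bar> \<partial>M)" .
  qed
qed

end

section \<open>Strong type by interpolation and duality\<close>

context cz_kernel_domain
begin

lemma strong_type_mono: "strong_type s A \<Longrightarrow> A \<le> A' \<Longrightarrow> strong_type s A'"
  unfolding strong_type_def
  by (meson dual_order.trans ennreal_leI mult_right_mono zero_le)

lemma bounded_powint_finite:
  assumes "\<And>x. x \<in> \<Omega> \<Longrightarrow> \<bar>h x\<bar> \<le> c" "q > 0"
  shows "powint M q h < \<infinity>"
proof -
  have "powint M q h \<le> (\<integral>\<^sup>+x. ennreal (\<bar>c\<bar> powr q) \<partial>M)"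
    unfolding powint_def
  proof (intro nn_integral_mono ennreal_leI powr_mono2)
    fix x assume "x \<in> space M"
    then show "\<bar>h x\<bar> \<le> \<bar>c\<bar>" using assms(1)[of x] by simp
  qed (use assms in auto)
  also have "\<dots> < \<infinity>" using M.emeasure_finite[of \<Omega>] by (simp add: ennreal_mult_eq_top_iff less_top[symmetric])
  finally show ?thesis .
qed

lemma powint_trunc_finite:
  assumes "integrable M f" "e > 0" "q > 0"
  shows "powint M q (trunc e f) < \<infinity>"
  using trunc_sup_bound[OF assms(1,2)] assms(3) by (rule bounded_powint_finite)

text \<open>Duality, tested against \<open>g = sgn h |h|\<^sup>r\<^sup>-\<^sup>1\<close> where \<open>h\<close> is the truncation of \<open>f\<close> for the transposed kernel. As \<open>h\<close>
  is bounded, its norm is known to be finite and can be cancelled.\<close>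

lemma strong_type_transpose:
  assumes s: "s > 1" and st: "strong_type s A"
  shows "cz_kernel_domain.strong_type \<Omega> (\<lambda>x y. K y x) (s / (s - 1)) (A powr (1 / (s - 1)))"
proof -
  interpret T: cz_kernel_domain \<Omega> b V n "\<lambda>x y. K y x" C \<omega> by (rule transpose)
  have A: "A \<ge> 0" using st by (simp add: strong_type_def)
  define r where "r = s / (s - 1)"
  have r: "r > 1" "s = r / (r - 1)" "(r - 1) * s = r" "1 / r + 1 / s = 1" "r / s = 1 / (s - 1)"
    using s by (auto simp: r_def field_simps)
  have "powint M r (T.trunc e f) \<le> ennreal (A powr (1 / (s - 1))) * powint M r f"
    if e: "e > 0" and [measurable]: "f \<in> borel_measurable M" and ff: "powint M r f < \<infinity>" for e f
  proof -
    have f: "integrable M f" using powint_finite_imp_integrable[OF _ ff] r by simp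
    define h where "h = T.trunc e f"
    have [measurable]: "h \<in> borel_measurable M" unfolding h_def by measurable
    have hfin: "powint M r h < \<infinity>" unfolding h_def using r by (intro T.powint_trunc_finite f e) auto
    define g where "g x = sgn (h x) * \<bar>h x\<bar> powr (r - 1)" for x
    have [measurable]: "g \<in> borel_measurable M" unfolding g_def by measurable
    have gabs: "\<bar>g x\<bar> = \<bar>h x\<bar> powr (r - 1)" for x
      using r by (simp add: g_def abs_mult abs_sgn_eq)
    have gh: "h x * g x = \<bar>h x\<bar> powr r" for x
    proof -
      have "h x * g x = \<bar>h x\<bar> * \<bar>h x\<bar> powr (r - 1)" by (simp add: g_def abs_sgn mult.assoc[symmetric])
      also have "\<dots> = \<bar>h x\<bar> powr r" by (subst powr_mult_base) auto
      finally show ?thesis .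
    qed
    have gs: "powint M s g = powint M r h"
      unfolding powint_def gabs using r by (simp add: powr_powr)
    have g: "integrable M g" using powint_finite_imp_integrable[of g s] hfin s by (simp add: gs)
    obtain N where N: "powint M r h = ennreal N" "N \<ge> 0" using hfin by (cases "powint M r h") auto
    obtain F where F: "powint M r f = ennreal F" "F \<ge> 0" using ff by (cases "powint M r f") auto
    have "powint M s (trunc e g) \<le> ennreal A * powint M s g"
      using st e hfin[folded gs] \<open>g \<in> borel_measurable M\<close> unfolding strong_type_def by blast
    also have "\<dots> = ennreal (((A * N) powr (1 / s)) powr s)"
      using A N s by (simp add: gs powr_powr ennreal_mult)
    finally have tg: "powint M s (trunc e g) \<le> ennreal (((A * N) powr (1 / s)) powr s)" .
    have hol: "(\<integral>\<^sup>+y. ennreal (\<bar>f y\<bar> * \<bar>trunc e g y\<bar>) \<partial>M) \<le> ennreal (F powr (1 / r) * (A * N) powr (1 / s))"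
      using F r by (intro Holder_powint[OF r(1,2) _ _ _ _ _ tg]) (auto simp: powr_powr)
    have "N = (\<integral>x. \<bar>h x\<bar> powr r \<partial>M)"
      using N unfolding powint_def by (subst integral_eq_nn_integral) auto
    also have "\<dots> = (\<integral>x. T.trunc e f x * g x \<partial>M)" using gh by (intro Bochner_Integration.integral_cong) (auto simp: h_def)
    also have "\<dots> = (\<integral>y. f y * trunc e g y \<partial>M)"
      using T.trunc_duality[OF f g, of e] by simp
    finally have "N = (\<integral>y. f y * trunc e g y \<partial>M)" .
    then have "ennreal N \<le> ennreal (norm (\<integral>y. f y * trunc e g y \<partial>M))" by (intro ennreal_leI) auto
    also have "\<dots> \<le> (\<integral>\<^sup>+y. ennreal (norm (f y * trunc e g y)) \<partial>M)"
    proof (cases "integrable M (\<lambda>y. f y * trunc e g y)")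
      case True then show ?thesis by (rule integral_norm_bound_ennreal)
    qed (simp add: not_integrable_integral_eq)
    also have "\<dots> \<le> ennreal (F powr (1 / r) * (A * N) powr (1 / s))" using hol by (simp add: abs_mult)
    finally have "N \<le> F powr (1 / r) * (A * N) powr (1 / s)" by (subst (asm) ennreal_le_iff) auto
    then have *: "N \<le> F powr (1 / r) * A powr (1 / s) * N powr (1 / s)" using A N by (simp add: powr_mult)
    have "N \<le> A powr (1 / (s - 1)) * F"
    proof (cases "N = 0")
      case False
      then have N0: "N > 0" using N by simp
      have "N powr (1 / r) * N powr (1 / s) = N" using N0 r by (simp flip: powr_add)
      then have "N powr (1 / r) * N powr (1 / s) \<le> F powr (1 / r) * A powr (1 / s) * N powr (1 / s)" using * by simp
      then have "N powr (1 / r) \<le> F powr (1 / r) * A powr (1 / s)" using N0 by simp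
      then have "(N powr (1 / r)) powr r \<le> (F powr (1 / r) * A powr (1 / s)) powr r"
        using r by (intro powr_mono2) auto
      then show ?thesis using r N F A by (simp add: powr_mult powr_powr mult.commute)
    qed (use F in simp)
    then show ?thesis unfolding h_def[symmetric] N F using F by (simp flip: ennreal_mult)
  qed
  then show ?thesis unfolding T.strong_type_def r_def by auto
qed

text \<open>For truncations both parts of \<open>f\<close> are integrable, so linearity of the integral suffices to split \<open>T\<^sub>e f\<close>.\<close>

lemma strong_type_interpolate:
  assumes T2: "cz_kernel_domain.strong_type \<Omega> (\<lambda>x y. K y x) 2 A" and st: "strong_type s B"
    and q: "1 < q" "q < s"
  shows "strong_type q (2 * weak_const A * q / (q - 1) + 2 powr s * B * q / (s - q))"
proof -
  have A: "A \<ge> 0" using T2 by (simp add: cz_kernel_domain.strong_type_def[OF transpose])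
  have B: "B \<ge> 0" using st by (simp add: strong_type_def)
  have w: "weak_const A \<ge> 0" using transfer_const_nonneg swept_const_nonneg[OF A] by (simp add: weak_const_def)
  have "powint M q (trunc e f) \<le> ennreal (2 * weak_const A * q / (q - 1) + 2 powr s * B * q / (s - q)) * powint M q f"
    if e: "e > 0" and [measurable]: "f \<in> borel_measurable M" and ff: "powint M q f < \<infinity>" for e f
  proof (rule marcinkiewicz)
    have f: "integrable M f" using powint_finite_imp_integrable[OF _ ff] q by simp
    fix t :: real assume t: "t > 0"
    \<comment> \<open>The part above height \<open>t\<close> is integrable, the part below is bounded.\<close>
    define fh where "fh y = f y * indicator {y. t < \<bar>f y\<bar>} y" for y
    define fl where "fl y = f y * indicator {y. \<bar>f y\<bar> \<le> t} y" for y
    have [measurable]: "fh \<in> borel_measurable M" "fl \<in> borel_measurable M"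
      unfolding fh_def fl_def indicator_def by measurable
    have fh: "integrable M fh" and fl: "integrable M fl"
      by (auto intro!: Bochner_Integration.integrable_bound[OF f] simp: fh_def fl_def indicator_def)
    have f_eq: "f = (\<lambda>y. fh y + fl y)" by (auto simp: fun_eq_iff fh_def fl_def indicator_def)
    have flfin: "powint M s fl < \<infinity>"
      by (rule bounded_powint_finite[of _ t]) (use q t in \<open>auto simp: fl_def indicator_def\<close>)
    have "{x\<in>space M. \<bar>trunc e f x\<bar> > t} \<subseteq> {x\<in>\<Omega>. \<bar>trunc e fh x\<bar> > t/2} \<union> {x\<in>space M. \<bar>trunc e fl x\<bar> > t/2}"
      by (subst (1) f_eq) (auto simp: trunc_add fh fl)
    moreover have meas: "{x\<in>space M. \<bar>trunc e fh x\<bar> > t/2} \<in> sets M" "{x\<in>space M. \<bar>trunc e fl x\<bar> > t/2} \<in> sets M"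
      by measurable
    ultimately have "emeasure M {x\<in>space M. \<bar>trunc e f x\<bar> > t}
      \<le> emeasure M ({x\<in>\<Omega>. \<bar>trunc e fh x\<bar> > t/2} \<union> {x\<in>space M. \<bar>trunc e fl x\<bar> > t/2})"
      by (intro emeasure_mono) auto
    also have "\<dots> \<le> emeasure M {x\<in>\<Omega>. \<bar>trunc e fh x\<bar> > t/2} + emeasure M {x\<in>space M. \<bar>trunc e fl x\<bar> > t/2}"
      using meas by (intro emeasure_subadditive) auto
    also have "\<dots> \<le> ennreal (weak_const A / (t/2)) * (\<integral>\<^sup>+y. ennreal \<bar>fh y\<bar> \<partial>M)
         + ennreal (1 / (t/2) powr s) * (ennreal B * powint M s fl)"
    proof (intro add_mono)
      show "emeasure M {x\<in>\<Omega>. \<bar>trunc e fh x\<bar> > t/2} \<le> ennreal (weak_const A / (t/2)) * (\<integral>\<^sup>+y. ennreal \<bar>fh y\<bar> \<partial>M)"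
        using t by (intro weak_type_1_1 T2 e fh) auto
      have "emeasure M {x\<in>space M. \<bar>trunc e fl x\<bar> > t/2} \<le> ennreal (1 / (t/2) powr s) * powint M s (trunc e fl)"
        using t q by (intro powint_Markov) auto
      also have "\<dots> \<le> ennreal (1 / (t/2) powr s) * (ennreal B * powint M s fl)"
        using st e flfin unfolding strong_type_def by (intro mult_left_mono) auto
      finally show "emeasure M {x\<in>space M. \<bar>trunc e fl x\<bar> > t/2} \<le> ennreal (1 / (t/2) powr s) * (ennreal B * powint M s fl)" .
    qed
    also have "(\<integral>\<^sup>+y. ennreal \<bar>fh y\<bar> \<partial>M) = (\<integral>\<^sup>+x\<in>{x. \<bar>f x\<bar> > t}. ennreal \<bar>f x\<bar> \<partial>M)"
      by (intro nn_integral_cong) (auto simp: fh_def indicator_def)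
    also have "powint M s fl = (\<integral>\<^sup>+x\<in>{x. \<bar>f x\<bar> \<le> t}. ennreal (\<bar>f x\<bar> powr s) \<partial>M)"
      unfolding powint_def using q by (intro nn_integral_cong) (auto simp: fl_def indicator_def)
    also have "ennreal (1 / (t/2) powr s) * (ennreal B * (\<integral>\<^sup>+x\<in>{x. \<bar>f x\<bar> \<le> t}. ennreal (\<bar>f x\<bar> powr s) \<partial>M))
        = ennreal (2 powr s * B / t powr s) * (\<integral>\<^sup>+x\<in>{x. \<bar>f x\<bar> \<le> t}. ennreal (\<bar>f x\<bar> powr s) \<partial>M)"
      using B t by (simp add: mult.assoc[symmetric] powr_divide flip: ennreal_mult)
    finally show "emeasure M {x\<in>space M. \<bar>trunc e f x\<bar> > t}
      \<le> ennreal (2 * weak_const A / t) * (\<integral>\<^sup>+x\<in>{x. \<bar>f x\<bar> > t}. ennreal \<bar>f x\<bar> \<partial>M)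
       + ennreal (2 powr s * B / t powr s) * (\<integral>\<^sup>+x\<in>{x. \<bar>f x\<bar> \<le> t}. ennreal (\<bar>f x\<bar> powr s) \<partial>M)"
      by (simp add: mult.commute)
  qed (use q w B M.sigma_finite_measure_axioms in auto)
  moreover have "2 * weak_const A * q / (q - 1) + 2 powr s * B * q / (s - q) \<ge> 0" using q w B by simp
  ultimately show ?thesis unfolding strong_type_def by blast
qed

text \<open>The constant of Marcinkiewicz interpolation blows up at the upper exponent. Hence the exponent \<open>2\<close> is
  first replaced by \<open>s = p + 1\<close>: interpolation for the transpose reaches \<open>s / (s - 1) < 2\<close>, and duality
  takes this to \<open>s\<close>.\<close>

lemma strong_type_uniform:
  assumes st: "strong_type 2 A" and q0: "1 < q0" "q0 \<le> p"
  obtains B where "\<And>q. q0 \<le> q \<Longrightarrow> q \<le> p \<Longrightarrow> strong_type q B"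
proof -
  interpret T: cz_kernel_domain \<Omega> b V n "\<lambda>x y. K y x" C \<omega> by (rule transpose)
  have A: "A \<ge> 0" using st by (simp add: strong_type_def)
  have T2: "T.strong_type 2 A"
    using strong_type_transpose[OF _ st] A by simp
  define s where "s = p + 1"
  define s' where "s' = s / (s - 1)"
  have s: "s > 2" "1 < s'" "s' < 2" "s' / (s' - 1) = s" using q0 by (auto simp: s_def s'_def field_simps)
  obtain B1 where "T.strong_type s' B1"
    using T.strong_type_interpolate[of A 2 A s'] st T2 s by auto
  then obtain B2 where B2: "strong_type s B2"
    using T.strong_type_transpose[of s' B1] s by auto
  have B2': "B2 \<ge> 0" using B2 by (simp add: strong_type_def)
  have w: "weak_const A \<ge> 0" using transfer_const_nonneg swept_const_nonneg[OF A] by (simp add: weak_const_def)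
  show thesis
  proof (rule that)
    fix q assume q: "q0 \<le> q" "q \<le> p"
    have "strong_type q (2 * weak_const A * q / (q - 1) + 2 powr s * B2 * q / (s - q))"
      using q q0 by (intro strong_type_interpolate T2 B2) (auto simp: s_def)
    moreover have "2 * weak_const A * q / (q - 1) + 2 powr s * B2 * q / (s - q)
        \<le> 2 * weak_const A * p / (q0 - 1) + 2 powr s * B2 * p / 1"
      using q q0 w B2' by (intro add_mono frac_le mult_left_mono mult_nonneg_nonneg) (auto simp: s_def)
    ultimately show "strong_type q (2 * weak_const A * p / (q0 - 1) + 2 powr s * B2 * p / 1)"
      by (rule strong_type_mono)
  qed
qed

end

section \<open>Principal values\<close>

lemma Cauchy_at_right_0_convergent:
  fixes u :: "real \<Rightarrow> real"
  assumes "\<And>\<eta>. \<eta> > 0 \<Longrightarrow> \<exists>\<delta>>0. \<forall>\<epsilon> \<epsilon>'. 0 < \<epsilon> \<longrightarrow> \<epsilon> < \<delta> \<longrightarrow> 0 < \<epsilon>' \<longrightarrow> \<epsilon>' < \<delta> \<longrightarrow> \<bar>u \<epsilon> - u \<epsilon>'\<bar> \<le> \<eta>"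
  shows "\<exists>L. (u \<longlongrightarrow> L) (at_right 0)"
proof -
  define v where "v k = u (1 / real (Suc k))" for k
  have small: "\<exists>N. \<forall>k\<ge>N. 1 / real (Suc k) < \<delta>" if "\<delta> > 0" for \<delta>
  proof -
    obtain N where "1 / real (Suc N) < \<delta>" using nat_approx_posE[OF \<open>\<delta> > 0\<close>] by blast
    moreover have "1 / real (Suc k) \<le> 1 / real (Suc N)" if "k \<ge> N" for k using that by (simp add: frac_le)
    ultimately show ?thesis by (meson order_le_less_trans)
  qed
  have "Cauchy v"
  proof (rule CauchyI)
    fix \<eta> :: real assume "\<eta> > 0"
    then obtain \<delta> where \<delta>: "\<delta> > 0" "\<And>\<epsilon> \<epsilon>'. 0 < \<epsilon> \<Longrightarrow> \<epsilon> < \<delta> \<Longrightarrow> 0 < \<epsilon>' \<Longrightarrow> \<epsilon>' < \<delta> \<Longrightarrow> \<bar>u \<epsilon> - u \<epsilon>'\<bar> \<le> \<eta> / 2"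
      using assms[of "\<eta> / 2"] by auto
    obtain N where "\<And>k. k \<ge> N \<Longrightarrow> 1 / real (Suc k) < \<delta>" using small[OF \<delta>(1)] by blast
    then have "\<bar>v k - v l\<bar> \<le> \<eta> / 2" if "k \<ge> N" "l \<ge> N" for k l
      unfolding v_def using that by (intro \<delta>(2)) auto
    then show "\<exists>N. \<forall>m\<ge>N. \<forall>n\<ge>N. norm (v m - v n) < \<eta>"
      using \<open>\<eta> > 0\<close> by (intro exI[of _ N]) fastforce
  qed
  then obtain L where L: "v \<longlonglongrightarrow> L" using Cauchy_convergent_iff convergent_def by blast
  have "(u \<longlongrightarrow> L) (at_right 0)"
  proof (rule tendstoI)
    fix \<eta> :: real assume \<eta>: "\<eta> > 0"
    then obtain \<delta> where \<delta>: "\<delta> > 0" "\<And>\<epsilon> \<epsilon>'. 0 < \<epsilon> \<Longrightarrow> \<epsilon> < \<delta> \<Longrightarrow> 0 < \<epsilon>' \<Longrightarrow> \<epsilon>' < \<delta> \<Longrightarrow> \<bar>u \<epsilon> - u \<epsilon>'\<bar> \<le> \<eta> / 2"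
      using assms[of "\<eta> / 2"] by auto
    obtain N where N: "\<And>k. k \<ge> N \<Longrightarrow> 1 / real (Suc k) < \<delta>" using small[OF \<delta>(1)] by blast
    obtain N' where N': "\<And>k. k \<ge> N' \<Longrightarrow> dist (v k) L < \<eta> / 2"
      using L \<eta> unfolding lim_sequentially by (meson half_gt_zero)
    define k where "k = max N N'"
    have "dist (u \<epsilon>) L < \<eta>" if "0 < \<epsilon>" "\<epsilon> < \<delta>" for \<epsilon>
    proof -
      have "\<bar>u \<epsilon> - v k\<bar> \<le> \<eta> / 2" unfolding v_def using that N[of k] by (intro \<delta>(2)) (auto simp: k_def)
      moreover have "\<bar>v k - L\<bar> < \<eta> / 2" using N'[of k] by (simp add: k_def dist_real_def)
      ultimately show ?thesis unfolding dist_real_def by linarith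
    qed
    then show "\<forall>\<^sub>F \<epsilon> in at_right 0. dist (u \<epsilon>) L < \<eta>"
      using \<delta>(1) by (auto simp: eventually_at_right_field)
  qed
  then show ?thesis by blast
qed

context cz_kernel_domain
begin

text \<open>The exceptional sets for the truncations above \<open>1 / (k + 1)\<close> need not be nested; their lower limit
  works for all truncations.\<close>

lemma maximal_trunc_weak_type:
  assumes s: "s > 1" and st: "strong_type s A" and [measurable]: "f \<in> borel_measurable M"
    and fs: "powint M s f < \<infinity>" and t: "t > 0"
  obtains G where "G \<in> sets M"
    "emeasure M G \<le> ennreal ((1 + A) * cotlar_const s A powr s / t powr s) * powint M s f"
    "\<And>x \<epsilon>. x \<in> \<Omega> \<Longrightarrow> x \<notin> G \<Longrightarrow> 0 < \<epsilon> \<Longrightarrow> \<bar>trunc \<epsilon> f x\<bar> \<le> t"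
proof -
  let ?B = "ennreal ((1 + A) * cotlar_const s A powr s / t powr s) * powint M s f"
  have "\<exists>G. G \<in> sets M \<and> emeasure M G \<le> ?B \<and> (\<forall>x \<epsilon>. x \<in> \<Omega> \<longrightarrow> x \<notin> G \<longrightarrow> 1 / real (Suc k) \<le> \<epsilon> \<longrightarrow> \<bar>trunc \<epsilon> f x\<bar> \<le> t)" for k
    by (rule cotlar_weak_type[OF s st assms(3) fs _ t, of "1 / real (Suc k)"]) auto
  then obtain G where G: "\<And>k. G k \<in> sets M" "\<And>k. emeasure M (G k) \<le> ?B"
    "\<And>k x \<epsilon>. x \<in> \<Omega> \<Longrightarrow> x \<notin> G k \<Longrightarrow> 1 / real (Suc k) \<le> \<epsilon> \<Longrightarrow> \<bar>trunc \<epsilon> f x\<bar> \<le> t"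
    by metis
  define G' where "G' = (\<Union>m. \<Inter>k\<in>{m..}. G k)"
  have G': "G' \<in> sets M"
    unfolding G'_def using G(1) by (intro sets.countable_UN sets.countable_INT') auto
  show thesis
  proof (rule that[OF G'])
    show "emeasure M G' \<le> ?B"
    proof (rule emeasure_le_of_eventually[OF G' G(1) _ G(2)])
      fix z assume "z \<in> G'"
      then show "\<forall>\<^sub>F k in sequentially. z \<in> G k" by (auto simp: G'_def eventually_sequentially)
    qed
    fix x \<epsilon> assume x: "x \<in> \<Omega>" "x \<notin> G'" and \<epsilon>: "0 < (\<epsilon>::real)"
    obtain m where m: "1 / real (Suc m) < \<epsilon>" using nat_approx_posE[OF \<epsilon>] by blast
    obtain k where k: "k \<ge> m" "x \<notin> G k" using x(2) by (auto simp: G'_def)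
    have "1 / real (Suc k) \<le> 1 / real (Suc m)" using k(1) by (simp add: frac_le)
    then show "\<bar>trunc \<epsilon> f x\<bar> \<le> t" using m by (intro G(3)[OF x(1) k(2)]) simp
  qed
qed

text \<open>For bounded functions the limits exist by assumption. The oscillation of the truncations of \<open>f\<close> is at most
  that for a bounded part plus twice the maximal truncation of the remainder, which is small in
  measure.\<close>

lemma pv_exists:
  assumes q: "q > 1" and st: "strong_type q A"
    and bdd: "\<And>h c. h \<in> borel_measurable M \<Longrightarrow> (\<And>x. \<bar>h x\<bar> \<le> c) \<Longrightarrow>
        AE x in M. \<exists>L. ((\<lambda>\<epsilon>. trunc \<epsilon> h x) \<longlongrightarrow> L) (at_right 0)"
    and [measurable]: "f \<in> borel_measurable M" and fq: "powint M q f < \<infinity>"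
  shows "AE x in M. \<exists>L. ((\<lambda>\<epsilon>. trunc \<epsilon> f x) \<longlongrightarrow> L) (at_right 0)"
proof -
  have f: "integrable M f" using powint_finite_imp_integrable[OF _ fq] q by simp
  define h where "h N y = f y * indicator {y. \<bar>f y\<bar> \<le> real N} y" for N y
  define r where "r N y = f y * indicator {y. \<bar>f y\<bar> > real N} y" for N y
  have [measurable]: "h N \<in> borel_measurable M" "r N \<in> borel_measurable M" for N
    unfolding h_def r_def indicator_def by measurable
  have hi: "integrable M (h N)" and ri: "integrable M (r N)" for N
    by (auto intro!: Bochner_Integration.integrable_bound[OF f] simp: h_def r_def indicator_def)
  have f_eq: "f = (\<lambda>y. h N y + r N y)" for N by (auto simp: fun_eq_iff h_def r_def indicator_def)
  have r_le: "powint M q (r N) \<le> powint M q f" for N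
    unfolding powint_def r_def using q by (intro nn_integral_mono ennreal_leI powr_mono2) (auto simp: indicator_def)
  have r_fin: "powint M q (r N) < \<infinity>" for N using r_le fq by (rule order_le_less_trans)
  have r_lim: "(\<lambda>N. powint M q (r N)) \<longlonglongrightarrow> 0"
  proof -
    have "(\<lambda>N. \<integral>\<^sup>+y. ennreal (\<bar>r N y\<bar> powr q) \<partial>M) \<longlonglongrightarrow> (\<integral>\<^sup>+y. 0 \<partial>M)"
    proof (rule nn_integral_dominated_convergence)
      show "AE y in M. ennreal (\<bar>r N y\<bar> powr q) \<le> ennreal (\<bar>f y\<bar> powr q)" for N
        unfolding r_def using q by (intro AE_I2 ennreal_leI powr_mono2) (auto simp: indicator_def)
      show "(\<integral>\<^sup>+y. ennreal (\<bar>f y\<bar> powr q) \<partial>M) < \<infinity>" using fq by (simp add: powint_def)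
      show "AE y in M. (\<lambda>N. ennreal (\<bar>r N y\<bar> powr q)) \<longlonglongrightarrow> 0"
      proof (rule AE_I2)
        fix y
        obtain N0 where "\<bar>f y\<bar> \<le> real N0" using real_arch_simple by blast
        then have "\<forall>\<^sub>F N in sequentially. ennreal (\<bar>r N y\<bar> powr q) = 0"
          unfolding eventually_sequentially using q
          by (intro exI[of _ N0]) (auto simp: r_def indicator_def)
        then show "(\<lambda>N. ennreal (\<bar>r N y\<bar> powr q)) \<longlonglongrightarrow> 0" by (rule tendsto_eventually)
      qed
    qed auto
    then show ?thesis by (simp add: powint_def)
  qed
  have "\<exists>G. G \<in> sets M \<and> emeasure M G = 0 \<and> (\<forall>x\<in>\<Omega> - G. \<exists>N. \<forall>\<epsilon>>0. \<bar>trunc \<epsilon> (r N) x\<bar> \<le> t)" if t: "t > 0" for t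
  proof -
    let ?c = "ennreal ((1 + A) * cotlar_const q A powr q / t powr q)"
    have "\<exists>G. G \<in> sets M \<and> emeasure M G \<le> ?c * powint M q (r N) \<and> (\<forall>x \<epsilon>. x \<in> \<Omega> \<longrightarrow> x \<notin> G \<longrightarrow> 0 < \<epsilon> \<longrightarrow> \<bar>trunc \<epsilon> (r N) x\<bar> \<le> t)" for N
      by (rule maximal_trunc_weak_type[OF q st _ r_fin t, of N]) auto
    then obtain G where G: "\<And>N. G N \<in> sets M" "\<And>N. emeasure M (G N) \<le> ?c * powint M q (r N)"
      "\<And>N x \<epsilon>. x \<in> \<Omega> \<Longrightarrow> x \<notin> G N \<Longrightarrow> 0 < \<epsilon> \<Longrightarrow> \<bar>trunc \<epsilon> (r N) x\<bar> \<le> t" by metis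
    have GI: "(\<Inter>N. G N) \<in> sets M" using G(1) by (intro sets.countable_INT') auto
    have "emeasure M (\<Inter>N. G N) \<le> ?c * powint M q (r N)" for N
      by (rule order_trans[OF emeasure_mono G(2)]) (use G in auto)
    moreover have "(\<lambda>N. ?c * powint M q (r N)) \<longlonglongrightarrow> ?c * 0"
      by (intro ennreal_tendsto_cmult r_lim) simp
    ultimately have "emeasure M (\<Inter>N. G N) \<le> ?c * 0"
      by (intro LIMSEQ_le_const) auto
    moreover have "\<exists>N. \<forall>\<epsilon>>0. \<bar>trunc \<epsilon> (r N) x\<bar> \<le> t" if x: "x \<in> \<Omega> - (\<Inter>N. G N)" for x
    proof -
      obtain N where "x \<notin> G N" using x by auto
      then show ?thesis using G(3)[of x N] x by blast
    qed
    ultimately show ?thesis using GI by (intro exI[of _ "\<Inter>N. G N"]) auto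
  qed
  then obtain G where G: "\<And>t. t > 0 \<Longrightarrow> G t \<in> sets M" "\<And>t. t > 0 \<Longrightarrow> emeasure M (G t) = 0"
    "\<And>t x. t > 0 \<Longrightarrow> x \<in> \<Omega> - G t \<Longrightarrow> \<exists>N. \<forall>\<epsilon>>0. \<bar>trunc \<epsilon> (r N) x\<bar> \<le> t" by metis
  have AE1: "AE x in M. \<forall>k::nat. x \<notin> G (1 / real (Suc k))"
    unfolding AE_all_countable using G by (intro allI AE_not_in) (auto simp: null_sets_def)
  have AE2: "AE x in M. \<forall>N. \<exists>L. ((\<lambda>\<epsilon>. trunc \<epsilon> (h N) x) \<longlongrightarrow> L) (at_right 0)"
    unfolding AE_all_countable
  proof (intro allI bdd)
    fix N x show "\<bar>h N x\<bar> \<le> real N" by (auto simp: h_def indicator_def)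
  qed measurable
  show ?thesis
    using AE1 AE2 AE_space
  proof eventually_elim
    case (elim x)
    then have x: "x \<in> \<Omega>" by simp
    show ?case
    proof (rule Cauchy_at_right_0_convergent)
      fix \<eta> :: real assume \<eta>: "\<eta> > 0"
      then have "\<eta> / 4 > 0" by simp
      then obtain k where k: "1 / real (Suc k) < \<eta> / 4" using nat_approx_posE by blast
      obtain N where N: "\<And>\<epsilon>. \<epsilon> > 0 \<Longrightarrow> \<bar>trunc \<epsilon> (r N) x\<bar> \<le> 1 / real (Suc k)"
        using G(3)[of "1 / real (Suc k)" x] elim(1) x by auto
      obtain L where L: "((\<lambda>\<epsilon>. trunc \<epsilon> (h N) x) \<longlongrightarrow> L) (at_right 0)" using elim(2) by blast
      have "\<forall>\<^sub>F \<epsilon> in at_right 0. dist (trunc \<epsilon> (h N) x) L < \<eta> / 4"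
        by (rule tendstoD[OF L]) (use \<eta> in simp)
      then obtain \<delta> where \<delta>: "\<delta> > 0" "\<And>\<epsilon>. 0 < \<epsilon> \<Longrightarrow> \<epsilon> < \<delta> \<Longrightarrow> dist (trunc \<epsilon> (h N) x) L < \<eta> / 4"
        by (auto simp: eventually_at_right_field)
      have tf: "trunc \<epsilon> f x = trunc \<epsilon> (h N) x + trunc \<epsilon> (r N) x" for \<epsilon>
        by (subst f_eq[of N], rule trunc_add[OF hi ri])
      have "\<bar>trunc \<epsilon> f x - trunc \<epsilon>' f x\<bar> \<le> \<eta>" if "0 < \<epsilon>" "\<epsilon> < \<delta>" "0 < \<epsilon>'" "\<epsilon>' < \<delta>" for \<epsilon> \<epsilon>'
        using \<delta>(2)[OF that(1,2)] \<delta>(2)[OF that(3,4)] N[OF that(1)] N[OF that(3)] k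
        unfolding tf dist_real_def by linarith
      then show "\<exists>\<delta>>0. \<forall>\<epsilon> \<epsilon>'. 0 < \<epsilon> \<longrightarrow> \<epsilon> < \<delta> \<longrightarrow> 0 < \<epsilon>' \<longrightarrow> \<epsilon>' < \<delta> \<longrightarrow> \<bar>trunc \<epsilon> f x - trunc \<epsilon>' f x\<bar> \<le> \<eta>"
        using \<delta>(1) by blast
    qed
  qed
qed

end

section \<open>From principal values to uniformly bounded truncations\<close>

context cz_kernel_domain
begin

text \<open>On a cube \<open>Q\<close> of side \<open>e\<close>, let \<open>f\<^sub>Q\<close> be the restriction of \<open>f\<close> to the cube of side \<open>3 e\<close> with the same centre.
  For points of \<open>Q\<close>, the rest of \<open>f\<close> is at distance at least \<open>e\<close>, so its truncations at all levels up to
  \<open>e\<close> agree and equal \<open>T f - T f\<^sub>Q\<close>. Thus \<open>T\<^sub>e f = T\<^sub>e f\<^sub>Q + T f - T f\<^sub>Q\<close> on \<open>Q\<close>, where \<open>T\<^sub>e f\<^sub>Q\<close> is bounded by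
  Cauchy-Schwarz. Every point lies in at most \<open>3\<^sup>n\<close> of the enlarged cubes.\<close>

lemma strong_type_2_of_pv:
  fixes T :: "('a \<Rightarrow> real) \<Rightarrow> 'a \<Rightarrow> real"
  assumes A: "A \<ge> 0"
    and T: "\<And>h. h \<in> borel_measurable M \<Longrightarrow> powint M 2 h < \<infinity> \<Longrightarrow> T h \<in> borel_measurable M"
    and pv: "\<And>h. h \<in> borel_measurable M \<Longrightarrow> powint M 2 h < \<infinity> \<Longrightarrow>
        AE x in M. ((\<lambda>\<epsilon>. trunc \<epsilon> h x) \<longlongrightarrow> T h x) (at_right 0)"
    and bd: "\<And>h. h \<in> borel_measurable M \<Longrightarrow> powint M 2 h < \<infinity> \<Longrightarrow> powint M 2 (T h) \<le> ennreal A * powint M 2 h"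
  shows "strong_type 2 (3 * A + 3 * (A + (C * V * real (3 * n) ^ n)\<^sup>2) * 3 ^ n)"
proof -
  let ?c = "(C * V * real (3 * n) ^ n)\<^sup>2"
  have "powint M 2 (trunc e f) \<le> ennreal (3 * A + 3 * (A + ?c) * 3 ^ n) * powint M 2 f"
    if e: "e > 0" and fm [measurable]: "f \<in> borel_measurable M" and ff: "powint M 2 f < \<infinity>" for e f
  proof -
    have f: "integrable M f" using powint_finite_imp_integrable[OF _ ff] by simp
    note [measurable] = T[OF fm ff]
    \<comment> \<open>The integer vector \<open>ix y\<close> names the cube of side \<open>e\<close> that contains \<open>y\<close>.\<close>
    define ix where "ix y = (\<lambda>i\<in>Basis. \<lfloor>(y \<bullet> i) / e\<rfloor>)" for y :: 'a
    define Q where "Q k = {y\<in>\<Omega>. ix y = k}" for k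
    define Q3 where "Q3 k = {y\<in>\<Omega>. \<forall>i\<in>Basis. \<bar>\<lfloor>(y \<bullet> i) / e\<rfloor> - k i\<bar> \<le> 1}" for k :: "'a \<Rightarrow> int"
    define I where "I = ix ` \<Omega>"
    have coord: "(\<lambda>y. \<lfloor>(y \<bullet> i) / e\<rfloor>) \<in> measurable M (count_space UNIV)" for i :: 'a
    proof -
      have "(\<lambda>y. (y \<bullet> i) / e) \<in> borel_measurable M"
        using borel_measurable_inner[OF id_measurable_M borel_measurable_const[of i]] by measurable
      then show ?thesis by (rule measurable_compose) (rule measurable_real_floor)
    qed
    have lev: "{y\<in>space M. \<forall>i\<in>Basis. P i \<lfloor>(y \<bullet> i) / e\<rfloor>} \<in> sets M" for P :: "'a \<Rightarrow> int \<Rightarrow> bool"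
    proof (intro sets.sets_Collect_finite_All)
      fix i :: 'a
      have "(\<lambda>y. \<lfloor>(y \<bullet> i) / e\<rfloor>) -` {m. P i m} \<inter> space M \<in> sets M"
        by (rule measurable_sets[OF coord]) simp
      then show "{y\<in>space M. P i \<lfloor>(y \<bullet> i) / e\<rfloor>} \<in> sets M" by (simp add: vimage_def Int_def conj_commute)
    qed simp
    have Q3m [measurable]: "Q3 k \<in> sets M" for k
      using lev[of "\<lambda>i m. \<bar>m - k i\<bar> \<le> 1"] by (simp add: Q3_def)
    have Q_eq: "Q k = {y\<in>\<Omega>. \<forall>i\<in>Basis. \<lfloor>(y \<bullet> i) / e\<rfloor> = k i}" if "k \<in> I" for k
      using that unfolding Q_def I_def ix_def by (auto simp: fun_eq_iff restrict_def)
    have Qm [measurable]: "Q k \<in> sets M" if "k \<in> I" for k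
      using lev[of "\<lambda>i m. m = k i"] by (simp add: Q_eq[OF that])
    have finI: "finite I"
    proof -
      obtain B where B: "\<And>y. y \<in> \<Omega> \<Longrightarrow> norm y \<le> B" using bounded_dom bounded_iff by blast
      have "I \<subseteq> PiE Basis (\<lambda>_. {\<lfloor>-B / e\<rfloor>..\<lfloor>B / e\<rfloor>})"
      proof
        fix k assume "k \<in> I"
        then obtain y where y: "y \<in> \<Omega>" "k = ix y" by (auto simp: I_def)
        have "\<bar>y \<bullet> i\<bar> \<le> B" if "i \<in> Basis" for i using Basis_le_norm[OF that, of y] B[OF y(1)] by simp
        then have "- B / e \<le> y \<bullet> i / e \<and> y \<bullet> i / e \<le> B / e" if "i \<in> Basis" for i
          using divide_right_mono[of "- B" "y \<bullet> i" e] divide_right_mono[of "y \<bullet> i" B e] e that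
          by (meson abs_le_iff minus_le_iff less_imp_le)
        then show "k \<in> PiE Basis (\<lambda>_. {\<lfloor>-B / e\<rfloor>..\<lfloor>B / e\<rfloor>})"
          unfolding y(2) ix_def by (simp only: restrict_PiE_iff) (auto intro!: floor_mono simp del: divide_minus_left)
      qed
      moreover have "finite (PiE (Basis :: 'a set) (\<lambda>_. {\<lfloor>-B / e\<rfloor>..\<lfloor>B / e\<rfloor>}))" by (intro finite_PiE) auto
      ultimately show ?thesis by (rule finite_subset)
    qed
    have sep: "e \<le> dist x y" if k: "k \<in> I" and x: "x \<in> Q k" and y: "y \<in> \<Omega>" "y \<notin> Q3 k" for k x y
    proof -
      obtain i where i: "i \<in> Basis" "\<not> \<bar>\<lfloor>(y \<bullet> i) / e\<rfloor> - k i\<bar> \<le> 1" using y by (auto simp: Q3_def)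
      have "k i = \<lfloor>(x \<bullet> i) / e\<rfloor>" using x i by (simp add: Q_eq[OF k])
      with i have "\<bar>(y \<bullet> i) / e - (x \<bullet> i) / e\<bar> \<ge> 1" by linarith
      then have "e \<le> \<bar>(y - x) \<bullet> i\<bar>"
        using e by (simp add: inner_diff_left diff_divide_distrib[symmetric] le_divide_eq)
      also have "\<dots> \<le> dist x y" using Basis_le_norm[OF i(1), of "y - x"] by (simp add: dist_norm norm_minus_commute)
      finally show ?thesis .
    qed
    have near: "Q3 k \<subseteq> ball x (real (3 * n) * e)" if k: "k \<in> I" and x: "x \<in> Q k" for k x
    proof
      fix y assume y: "y \<in> Q3 k"
      have "\<bar>(x - y) \<bullet> i\<bar> \<le> 2 * e" if i: "i \<in> Basis" for i
      proof -
        have "k i = \<lfloor>(x \<bullet> i) / e\<rfloor>" using x i by (simp add: Q_eq[OF k])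
        moreover have "\<bar>\<lfloor>(y \<bullet> i) / e\<rfloor> - k i\<bar> \<le> 1" using y i by (auto simp: Q3_def)
        ultimately have "\<bar>(x \<bullet> i) / e - (y \<bullet> i) / e\<bar> \<le> 2" by linarith
        then show ?thesis
          using e by (simp add: inner_diff_left diff_divide_distrib[symmetric] divide_le_eq)
      qed
      then have "norm (x - y) \<le> (\<Sum>i\<in>(Basis :: 'a set). 2 * e)"
        by (intro order_trans[OF norm_le_l1] sum_mono) auto
      also have "\<dots> < real (3 * n) * e" using e n_pos by (simp add: n_def)
      finally show "y \<in> ball x (real (3 * n) * e)" by (simp add: dist_norm)
    qed
    define fk where "fk k y = f y * indicator (Q3 k) y" for k y
    have fkm [measurable]: "fk k \<in> borel_measurable M" for k unfolding fk_def by measurable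
    have fk_int: "integrable M (fk k)" for k
      by (rule Bochner_Integration.integrable_bound[OF f]) (auto simp: fk_def indicator_def)
    have pfk: "powint M 2 (fk k) = (\<integral>\<^sup>+y\<in>Q3 k. ennreal (\<bar>f y\<bar> powr 2) \<partial>M)" for k
      unfolding powint_def fk_def by (intro nn_integral_cong) (auto simp: indicator_def)
    have pfk_le: "powint M 2 (fk k) \<le> powint M 2 f" for k
      unfolding powint_def by (intro nn_integral_mono) (auto simp: fk_def indicator_def)
    have pfk_fin: "powint M 2 (fk k) < \<infinity>" for k using pfk_le ff by (rule order_le_less_trans)
    note [measurable] = T[OF fkm pfk_fin]
    have id: "AE x in M. x \<in> Q k \<longrightarrow> trunc e f x = trunc e (fk k) x + (T f x - T (fk k) x)" if k: "k \<in> I" for k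
      using pv[OF fm ff] pv[OF fkm pfk_fin, of k]
    proof eventually_elim
      case (elim x)
      show ?case
      proof
        assume x: "x \<in> Q k"
        have eq: "trunc \<epsilon> f x - trunc \<epsilon> (fk k) x = trunc e f x - trunc e (fk k) x" if "0 < \<epsilon>" "\<epsilon> < e" for \<epsilon>
        proof -
          have "trunc \<epsilon> (\<lambda>y. f y - fk k y) x = trunc e (\<lambda>y. f y - fk k y) x"
            unfolding trunc_def
          proof (intro Bochner_Integration.integral_cong refl)
            fix y assume "y \<in> space M"
            then have y: "y \<in> \<Omega>" by simp
            show "Kt \<epsilon> x y * (f y - fk k y) = Kt e x y * (f y - fk k y)"
              using sep[OF k x y] that by (auto simp: fk_def Kt_def indicator_def)
          qed
          then show ?thesis by (simp add: trunc_diff f fk_int)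
        qed
        have "((\<lambda>\<epsilon>. trunc \<epsilon> f x - trunc \<epsilon> (fk k) x) \<longlongrightarrow> T f x - T (fk k) x) (at_right 0)"
          by (intro tendsto_diff elim)
        moreover have "((\<lambda>\<epsilon>. trunc \<epsilon> f x - trunc \<epsilon> (fk k) x) \<longlongrightarrow> trunc e f x - trunc e (fk k) x) (at_right 0)"
          by (rule tendsto_eventually) (unfold eventually_at_right_field, use e eq in blast)
        ultimately have "T f x - T (fk k) x = trunc e f x - trunc e (fk k) x"
          by (rule tendsto_unique[OF trivial_limit_at_right_real])
        then show "trunc e f x = trunc e (fk k) x + (T f x - T (fk k) x)" by simp
      qed
    qed
    have loc: "(\<integral>\<^sup>+x\<in>Q k. ennreal (\<bar>trunc e (fk k) x\<bar> powr 2) \<partial>M) \<le> ennreal ?c * powint M 2 (fk k)"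
      if k: "k \<in> I" for k
    proof -
      obtain x0 where x0: "x0 \<in> Q k" using k by (auto simp: I_def Q_def)
      let ?v = "V * (real (3 * n) * e) ^ n"
      have v: "?v \<ge> 0" using V_pos e by simp
      have R: "real (3 * n) * e \<ge> 0" using e by simp
      have Q3v: "emeasure M (Q3 k) \<le> ennreal ?v"
        using near[OF k x0] by (intro emeasure_M_ball_le R) auto
      have QQ3: "Q k \<subseteq> Q3 k" by (auto simp: Q_eq[OF k] Q3_def)
      obtain F where F: "powint M 2 (fk k) = ennreal F" "F \<ge> 0" using pfk_fin[of k] by (cases "powint M 2 (fk k)") auto
      have "(\<integral>\<^sup>+y. ennreal (\<bar>fk k y\<bar> * \<bar>indicator (Q3 k) y\<bar>) \<partial>M) \<le> ennreal (sqrt F * sqrt ?v)"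
      proof (rule Holder_powint[where q=2 and r=2])
        have "powint M 2 (indicator (Q3 k)) = (\<integral>\<^sup>+y. indicator (Q3 k) y \<partial>M)"
          unfolding powint_def by (intro nn_integral_cong) (auto simp: indicator_def)
        then show "powint M 2 (indicator (Q3 k)) \<le> ennreal (sqrt ?v powr 2)" using Q3v v by simp
      qed (use F v in auto)
      also have "(\<integral>\<^sup>+y. ennreal (\<bar>fk k y\<bar> * \<bar>indicator (Q3 k) y\<bar>) \<partial>M) = (\<integral>\<^sup>+y. ennreal \<bar>fk k y\<bar> \<partial>M)"
        by (intro nn_integral_cong) (auto simp: fk_def indicator_def)
      also have "\<dots> = ennreal (\<integral>y. \<bar>fk k y\<bar> \<partial>M)" using fk_int by (intro nn_integral_eq_integral) auto
      finally have L1: "(\<integral>y. \<bar>fk k y\<bar> \<partial>M) \<le> sqrt F * sqrt ?v" using F v by (subst (asm) ennreal_le_iff) auto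
      have pt: "\<bar>trunc e (fk k) x\<bar> powr 2 \<le> (C / e ^ n)\<^sup>2 * (F * ?v)" for x
      proof -
        have "\<bar>trunc e (fk k) x\<bar> \<le> C / e ^ n * (\<integral>y. \<bar>fk k y\<bar> \<partial>M)" by (rule trunc_sup_bound[OF fk_int e])
        also have "\<dots> \<le> C / e ^ n * (sqrt F * sqrt ?v)" using L1 C_pos e by (intro mult_left_mono) auto
        finally have "\<bar>trunc e (fk k) x\<bar>\<^sup>2 \<le> (C / e ^ n * (sqrt F * sqrt ?v))\<^sup>2" by (intro power_mono) auto
        also have "(C / e ^ n * (sqrt F * sqrt ?v))\<^sup>2 = (C / e ^ n)\<^sup>2 * (F * ?v)"
          using F(2) v by (simp only: power_mult_distrib[of "C / e ^ n"] power_mult_distrib[of "sqrt F"] real_sqrt_pow2)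
        finally show ?thesis by simp
      qed
      have "(\<integral>\<^sup>+x\<in>Q k. ennreal (\<bar>trunc e (fk k) x\<bar> powr 2) \<partial>M)
         \<le> (\<integral>\<^sup>+x\<in>Q3 k. ennreal ((C / e ^ n)\<^sup>2 * (F * ?v)) \<partial>M)"
        using QQ3 by (intro nn_integral_mono mult_mono ennreal_leI pt) (auto simp: indicator_def)
      also have "\<dots> = ennreal ((C / e ^ n)\<^sup>2 * (F * ?v)) * emeasure M (Q3 k)" by (simp add: nn_integral_cmult_indicator)
      also have "\<dots> \<le> ennreal ((C / e ^ n)\<^sup>2 * (F * ?v)) * ennreal ?v" by (intro mult_left_mono Q3v) auto
      also have "\<dots> = ennreal ((C / e ^ n)\<^sup>2 * (F * ?v) * ?v)" using F v by (intro ennreal_mult[symmetric]) auto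
      also have "(C / e ^ n)\<^sup>2 * (F * ?v) * ?v = ?c * F"
        using e by (simp add: power_mult_distrib power_divide power2_eq_square)
      also have "ennreal (?c * F) = ennreal ?c * powint M 2 (fk k)" using F by (simp add: ennreal_mult)
      finally show ?thesis .
    qed
    have cube: "(\<integral>\<^sup>+x\<in>Q k. ennreal (\<bar>trunc e f x\<bar> powr 2) \<partial>M)
       \<le> 3 * (\<integral>\<^sup>+x\<in>Q k. ennreal (\<bar>T f x\<bar> powr 2) \<partial>M) + ennreal (3 * (A + ?c)) * powint M 2 (fk k)"
      if k: "k \<in> I" for k
    proof -
      have sq: "\<bar>u + (v - w)\<bar> powr 2 \<le> 3 * (\<bar>u\<bar> powr 2) + 3 * (\<bar>v\<bar> powr 2) + 3 * (\<bar>w\<bar> powr 2)" for u v w :: real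
      proof -
        have "0 \<le> (u - v)\<^sup>2 + (u + w)\<^sup>2 + (v + w)\<^sup>2" by simp
        then show ?thesis by (simp add: power2_eq_square algebra_simps)
      qed
      have "(\<integral>\<^sup>+x\<in>Q k. ennreal (\<bar>trunc e f x\<bar> powr 2) \<partial>M)
         \<le> (\<integral>\<^sup>+x. 3 * (ennreal (\<bar>trunc e (fk k) x\<bar> powr 2) * indicator (Q k) x) + (3 * (ennreal (\<bar>T f x\<bar> powr 2) * indicator (Q k) x)
             + 3 * ennreal (\<bar>T (fk k) x\<bar> powr 2)) \<partial>M)"
      proof (rule nn_integral_mono_AE)
        show "AE x in M. ennreal (\<bar>trunc e f x\<bar> powr 2) * indicator (Q k) x \<le> 3 * (ennreal (\<bar>trunc e (fk k) x\<bar> powr 2) * indicator (Q k) x)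
           + (3 * (ennreal (\<bar>T f x\<bar> powr 2) * indicator (Q k) x) + 3 * ennreal (\<bar>T (fk k) x\<bar> powr 2))"
          using id[OF k]
        proof eventually_elim
          case (elim x)
          show ?case
          proof (cases "x \<in> Q k")
            case True
            have "\<bar>trunc e f x\<bar> powr 2 \<le> 3 * (\<bar>trunc e (fk k) x\<bar> powr 2) + 3 * (\<bar>T f x\<bar> powr 2) + 3 * (\<bar>T (fk k) x\<bar> powr 2)"
              using sq elim True by simp
            then have "ennreal (\<bar>trunc e f x\<bar> powr 2) \<le> ennreal (3 * (\<bar>trunc e (fk k) x\<bar> powr 2) + 3 * (\<bar>T f x\<bar> powr 2) + 3 * (\<bar>T (fk k) x\<bar> powr 2))"
              by (rule ennreal_leI)
            also have "\<dots> = 3 * ennreal (\<bar>trunc e (fk k) x\<bar> powr 2) + (3 * ennreal (\<bar>T f x\<bar> powr 2) + 3 * ennreal (\<bar>T (fk k) x\<bar> powr 2))"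
              by (simp add: ennreal_mult' add.assoc flip: ennreal_numeral)
            finally show ?thesis using True by simp
          qed simp
        qed
      qed
      also have "\<dots> = 3 * (\<integral>\<^sup>+x\<in>Q k. ennreal (\<bar>trunc e (fk k) x\<bar> powr 2) \<partial>M)
        + (3 * (\<integral>\<^sup>+x\<in>Q k. ennreal (\<bar>T f x\<bar> powr 2) \<partial>M) + 3 * powint M 2 (T (fk k)))"
        using k unfolding powint_def by (subst nn_integral_add; simp add: nn_integral_add nn_integral_cmult)
      also have "\<dots> \<le> 3 * (ennreal ?c * powint M 2 (fk k))
        + (3 * (\<integral>\<^sup>+x\<in>Q k. ennreal (\<bar>T f x\<bar> powr 2) \<partial>M) + 3 * (ennreal A * powint M 2 (fk k)))"
        by (intro add_mono mult_left_mono loc k bd fkm pfk_fin order_refl) auto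
      also have "\<dots> = 3 * (\<integral>\<^sup>+x\<in>Q k. ennreal (\<bar>T f x\<bar> powr 2) \<partial>M) + ennreal (3 * (A + ?c)) * powint M 2 (fk k)"
        using A by (simp add: ennreal_mult distrib_left distrib_right mult.assoc ac_simps)
      finally show ?thesis .
    qed
    have partition: "(\<Sum>k\<in>I. \<integral>\<^sup>+x. h x * indicator (Q k) x \<partial>M) = (\<integral>\<^sup>+x. h x \<partial>M)"
      if [measurable]: "h \<in> borel_measurable M" for h :: "'a \<Rightarrow> ennreal"
    proof -
      have "(\<Sum>k\<in>I. \<integral>\<^sup>+x. h x * indicator (Q k) x \<partial>M) = (\<integral>\<^sup>+x. (\<Sum>k\<in>I. h x * indicator (Q k) x) \<partial>M)"
        by (rule nn_integral_sum[symmetric]) measurable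
      also have "\<dots> = (\<integral>\<^sup>+x. h x \<partial>M)"
      proof (intro nn_integral_cong)
        fix x assume "x \<in> space M"
        then have x: "x \<in> \<Omega>" by simp
        have "(\<Sum>k\<in>I. h x * indicator (Q k) x) = (\<Sum>k\<in>{ix x}. h x * indicator (Q k) x)"
          using finI x by (intro sum.mono_neutral_right) (auto simp: I_def Q_def indicator_def)
        then show "(\<Sum>k\<in>I. h x * indicator (Q k) x) = h x" using x by (simp add: Q_def)
      qed
      finally show ?thesis .
    qed
    have overlap: "(\<Sum>k\<in>I. powint M 2 (fk k)) \<le> ennreal (3 ^ n) * powint M 2 f"
    proof -
      have "(\<Sum>k\<in>I. powint M 2 (fk k)) = (\<integral>\<^sup>+y. (\<Sum>k\<in>I. ennreal (\<bar>f y\<bar> powr 2) * indicator (Q3 k) y) \<partial>M)"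
        unfolding pfk by (rule nn_integral_sum[symmetric]) measurable
      also have "\<dots> \<le> (\<integral>\<^sup>+y. ennreal (3 ^ n) * ennreal (\<bar>f y\<bar> powr 2) \<partial>M)"
      proof (intro nn_integral_mono)
        fix y assume "y \<in> space M"
        then have y: "y \<in> \<Omega>" by simp
        let ?P = "PiE (Basis :: 'a set) (\<lambda>_. {-1..1::int})"
        let ?J = "{k\<in>I. y \<in> Q3 k}"
        have "?J \<subseteq> (\<lambda>j. \<lambda>i\<in>Basis. \<lfloor>(y \<bullet> i) / e\<rfloor> + j i) ` ?P"
        proof
          fix k assume k: "k \<in> ?J"
          then have ext: "k i = undefined" if "i \<notin> Basis" for i using that by (auto simp: I_def ix_def)
          let ?j = "\<lambda>i\<in>Basis. k i - \<lfloor>(y \<bullet> i) / e\<rfloor>"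
          have "k = (\<lambda>i\<in>Basis. \<lfloor>(y \<bullet> i) / e\<rfloor> + ?j i)" using ext by (auto simp: fun_eq_iff restrict_def)
          moreover have "?j \<in> ?P"
          proof (rule restrict_PiE_iff[THEN iffD2], intro ballI)
            fix i :: 'a assume "i \<in> Basis"
            then have "\<bar>\<lfloor>(y \<bullet> i) / e\<rfloor> - k i\<bar> \<le> 1" using k by (auto simp: Q3_def)
            then show "k i - \<lfloor>(y \<bullet> i) / e\<rfloor> \<in> {-1..1}" unfolding atLeastAtMost_iff by linarith
          qed
          ultimately show "k \<in> (\<lambda>j. \<lambda>i\<in>Basis. \<lfloor>(y \<bullet> i) / e\<rfloor> + j i) ` ?P" by (rule image_eqI)
        qed
        moreover have finP: "finite ?P" by (intro finite_PiE) auto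
        ultimately have "card ?J \<le> card ?P" by (meson card_image_le card_mono finite_imageI order_trans)
        also have "card ?P = 3 ^ n" by (simp add: card_PiE n_def)
        finally have cardJ: "card ?J \<le> 3 ^ n" .
        have "(\<Sum>k\<in>I. ennreal (\<bar>f y\<bar> powr 2) * indicator (Q3 k) y) = (\<Sum>k\<in>?J. ennreal (\<bar>f y\<bar> powr 2) * indicator (Q3 k) y)"
          using finI by (intro sum.mono_neutral_right) (auto simp: indicator_def)
        also have "\<dots> = (\<Sum>k\<in>?J. ennreal (\<bar>f y\<bar> powr 2))" by (intro sum.cong) auto
        also have "\<dots> = of_nat (card ?J) * ennreal (\<bar>f y\<bar> powr 2)" by simp
        also have "\<dots> \<le> of_nat (3 ^ n) * ennreal (\<bar>f y\<bar> powr 2)" using cardJ by (intro mult_right_mono of_nat_mono) auto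
        also have "(of_nat (3 ^ n) :: ennreal) = ennreal (3 ^ n)" by (simp add: ennreal_of_nat_eq_real_of_nat del: of_nat_power)
        finally show "(\<Sum>k\<in>I. ennreal (\<bar>f y\<bar> powr 2) * indicator (Q3 k) y) \<le> ennreal (3 ^ n) * ennreal (\<bar>f y\<bar> powr 2)" .
      qed
      finally show ?thesis unfolding powint_def by (simp add: nn_integral_cmult)
    qed
    have "powint M 2 (trunc e f) = (\<Sum>k\<in>I. \<integral>\<^sup>+x. ennreal (\<bar>trunc e f x\<bar> powr 2) * indicator (Q k) x \<partial>M)"
      unfolding powint_def by (rule partition[symmetric]) measurable
    also have "\<dots> \<le> (\<Sum>k\<in>I. 3 * (\<integral>\<^sup>+x\<in>Q k. ennreal (\<bar>T f x\<bar> powr 2) \<partial>M) + ennreal (3 * (A + ?c)) * powint M 2 (fk k))"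
      by (intro sum_mono cube)
    also have "\<dots> = 3 * powint M 2 (T f) + ennreal (3 * (A + ?c)) * (\<Sum>k\<in>I. powint M 2 (fk k))"
      unfolding sum.distrib sum_distrib_left[symmetric] powint_def[of M 2 "T f"] by (subst partition) auto
    also have "\<dots> \<le> 3 * (ennreal A * powint M 2 f) + ennreal (3 * (A + ?c)) * (ennreal (3 ^ n) * powint M 2 f)"
      by (intro add_mono mult_left_mono overlap bd fm ff) auto
    also have "\<dots> = (ennreal (3 * A) + ennreal (3 * (A + ?c) * 3 ^ n)) * powint M 2 f"
    proof -
      have "ennreal (3 * A) = 3 * ennreal A" by (simp add: ennreal_mult')
      moreover have "ennreal (3 * (A + ?c) * 3 ^ n) = ennreal (3 * (A + ?c)) * ennreal (3 ^ n)"
        using A by (intro ennreal_mult) auto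
      ultimately show ?thesis by (simp add: distrib_right mult.assoc)
    qed
    also have "ennreal (3 * A) + ennreal (3 * (A + ?c) * 3 ^ n) = ennreal (3 * A + 3 * (A + ?c) * 3 ^ n)"
      using A by (intro ennreal_plus[symmetric]) auto
    finally show ?thesis .
  qed
  then show ?thesis using A unfolding strong_type_def by auto
qed

end

section \<open>Morrey bounds for truncations\<close>

context cz_kernel_domain
begin

definition morrey_mass :: "real \<Rightarrow> ('a \<Rightarrow> real) \<Rightarrow> 'a \<Rightarrow> real \<Rightarrow> ennreal" where
  "morrey_mass q f x r = (\<integral>\<^sup>+y\<in>ball x r. ennreal (\<bar>f y\<bar> powr q) \<partial>M)"

definition tail_const :: "real \<Rightarrow> real" where
  "tail_const \<kappa> = C * V * 4 ^ n / (1 - 2 powr (- \<kappa>))"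

lemma tail_const_nonneg: "\<kappa> > 0 \<Longrightarrow> tail_const \<kappa> \<ge> 0"
proof -
  assume "\<kappa> > 0"
  then have "2 powr (- \<kappa>) < (1::real)" using powr_less_mono[of "-\<kappa>" 0 2] by simp
  then show ?thesis using C_pos V_pos by (simp add: tail_const_def)
qed

text \<open>With \<open>\<kappa> = (1 - \<mu>) / q\<close>, Hoelder's inequality bounds the integral of \<open>|f|\<close> over a ball of volume \<open>v\<close> by
  \<open>L v\<^sup>1\<^sup>-\<^sup>\<kappa>\<close>. After multiplication by the kernel the annuli contribute \<open>L v\<^sup>-\<^sup>\<kappa>\<close>, a geometric series. Its ratio is
  bounded through \<open>\<kappa>0\<close>, which makes the constant independent of \<open>q\<close> and \<open>\<mu>\<close>.\<close>

lemma trunc_tail: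
  assumes q: "1 < q" and \<kappa>0: "0 < \<kappa>0" "\<kappa>0 \<le> \<kappa>" and \<mu>: "\<mu> = 1 - \<kappa> * q" and L: "L \<ge> 0"
    and f: "integrable M f" and x: "x \<in> \<Omega>" and r: "r > 0" and e: "e > 0"
    and mass: "\<And>\<rho>. \<rho> > 0 \<Longrightarrow> morrey_mass q f x \<rho> \<le> ennreal (L powr q * (V * \<rho> ^ n) powr \<mu>)"
    and z: "z \<in> \<Omega>" "dist x z < r"
  shows "\<bar>trunc e (\<lambda>y. f y * indicator {y. 2 * r \<le> dist x y} y) z\<bar> \<le> tail_const \<kappa>0 * L * (V * r ^ n) powr (- \<kappa>)"
proof -
  have [measurable]: "f \<in> borel_measurable M" using f by auto
  have ball_L1: "(\<integral>\<^sup>+y\<in>ball x \<rho>. ennreal \<bar>f y\<bar> \<partial>M) \<le> ennreal (L * (V * \<rho> ^ n) powr (- \<kappa>) * (V * \<rho> ^ n))"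
    if \<rho>: "\<rho> > 0" for \<rho>
  proof (rule local_L1_le[OF _ q _ \<rho>])
    have pos: "V * \<rho> ^ n > 0" using V_pos \<rho> by simp
    have "(V * \<rho> ^ n) powr \<mu> = ((V * \<rho> ^ n) powr (- \<kappa>)) powr q * (V * \<rho> ^ n) powr 1"
      using pos by (simp only: powr_powr powr_add[symmetric]) (simp add: \<mu>)
    then have "L powr q * (V * \<rho> ^ n) powr \<mu> = (L * (V * \<rho> ^ n) powr (- \<kappa>)) powr q * (V * \<rho> ^ n)"
      using L pos by (simp add: powr_mult)
    then show "(\<integral>\<^sup>+y\<in>ball x \<rho>. ennreal (\<bar>f y\<bar> powr q) \<partial>M) \<le> ennreal ((L * (V * \<rho> ^ n) powr (- \<kappa>)) powr q * (V * \<rho> ^ n))"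
      using mass[OF \<rho>] by (simp add: morrey_mass_def)
    show "dm x \<rho> \<le> V * \<rho> ^ n" using \<rho> by (intro dm_le) simp
  qed (use L in auto)
  let ?d = "2 powr (- \<kappa>0)"
  have d: "0 < ?d" "?d < 1" using \<kappa>0 powr_less_mono[of "-\<kappa>0" 0 2] by simp_all
  let ?D = "C * V * 4 ^ n * L * (V * r ^ n) powr (- \<kappa>)"
  have D: "?D \<ge> 0" using C_pos V_pos L by simp
  have "ennreal \<bar>trunc e (\<lambda>y. f y * indicator {y. 2 * r \<le> dist x y} y) z\<bar>
      \<le> (\<integral>\<^sup>+y\<in>{y. 2 * r \<le> dist x y}. ennreal \<bar>Kt e z y * f y\<bar> \<partial>M)"
  proof -
    have "ennreal \<bar>(\<integral>y. Kt e z y * (f y * indicator {y. 2 * r \<le> dist x y} y) \<partial>M) - (\<integral>y. 0 \<partial>M)\<bar>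
       \<le> (\<integral>\<^sup>+y\<in>{y. 2 * r \<le> dist x y}. ennreal \<bar>Kt e z y * f y\<bar> \<partial>M)"
    proof (rule abs_integral_diff_le)
      have "integrable M (\<lambda>y. f y * indicator {y. 2 * r \<le> dist x y} y)"
        by (rule Bochner_Integration.integrable_bound[OF f]) (auto simp: indicator_def)
      then show "integrable M (\<lambda>y. Kt e z y * (f y * indicator {y. 2 * r \<le> dist x y} y))" by (rule Kt_integrable)
    qed (auto simp: indicator_def)
    then show ?thesis by (simp add: trunc_def)
  qed
  also have "\<dots> \<le> (\<Sum>j. ennreal (C / (2 ^ j * r) ^ n) * (\<integral>\<^sup>+y. ennreal \<bar>f y\<bar> * indicator (ball x (2 ^ Suc j * (2 * r))) y \<partial>M))"
  proof (rule annuli_sum_bound)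
    fix j y assume y: "y \<in> \<Omega>" "2 ^ j * (2 * r) \<le> dist x y"
    have "1 * r \<le> 2 ^ j * r" using r by (intro mult_right_mono one_le_power) auto
    then have "2 ^ j * r \<le> dist z y" using y z dist_triangle[of x y z] by simp
    then have "\<bar>Kt e z y\<bar> \<le> C / (2 ^ j * r) ^ n" using r by (intro Kt_size z y) auto
    then have "ennreal \<bar>Kt e z y * f y\<bar> \<le> ennreal (C / (2 ^ j * r) ^ n * \<bar>f y\<bar>)"
      unfolding abs_mult by (intro ennreal_leI mult_right_mono) auto
    also have "\<dots> = ennreal (C / (2 ^ j * r) ^ n) * ennreal \<bar>f y\<bar>" using C_pos r by (intro ennreal_mult) auto
    finally show "ennreal \<bar>Kt e z y * f y\<bar> \<le> ennreal (C / (2 ^ j * r) ^ n) * ennreal \<bar>f y\<bar>" .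
  qed (use r in auto)
  also have "\<dots> \<le> (\<Sum>j. ennreal (?D * ?d ^ j))"
  proof (intro suminf_le summableI)
    fix j
    let ?\<rho> = "2 ^ Suc j * (2 * r)"
    have \<rho>: "?\<rho> > 0" using r by simp
    have "ennreal (C / (2 ^ j * r) ^ n) * (\<integral>\<^sup>+y\<in>ball x ?\<rho>. ennreal \<bar>f y\<bar> \<partial>M)
      \<le> ennreal (C / (2 ^ j * r) ^ n) * ennreal (L * (V * ?\<rho> ^ n) powr (- \<kappa>) * (V * ?\<rho> ^ n))"
      by (intro mult_left_mono ball_L1 \<rho>) auto
    also have "\<dots> = ennreal (C / (2 ^ j * r) ^ n * (L * (V * ?\<rho> ^ n) powr (- \<kappa>) * (V * ?\<rho> ^ n)))"
      using C_pos L V_pos r by (intro ennreal_mult[symmetric]) auto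
    also have "\<dots> \<le> ennreal (?D * ?d ^ j)"
    proof (rule ennreal_leI)
      have \<rho>4: "?\<rho> = 4 * (2 ^ j * r)" by simp
      have e1: "C / (2 ^ j * r) ^ n * (L * (V * ?\<rho> ^ n) powr (- \<kappa>) * (V * ?\<rho> ^ n)) = C * V * 4 ^ n * L * (V * ?\<rho> ^ n) powr (- \<kappa>)"
      proof -
        have "C / w ^ n * (L * P * (V * (4 * w) ^ n)) = C * V * 4 ^ n * L * P" if "w > 0" for w P
          using that by (simp add: power_mult_distrib)
        then show ?thesis unfolding \<rho>4 using r by simp
      qed
      have "(V * ?\<rho> ^ n) powr (- \<kappa>) \<le> (2 ^ j * (V * r ^ n)) powr (- \<kappa>)"
      proof (rule powr_mono2')
        have "2 ^ j * 1 \<le> (2::real) ^ Suc j * 2" by simp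
        then have "(2 ^ j)^1 \<le> ((2::real) ^ Suc j * 2) ^ 1" by simp
        also have "\<dots> \<le> (2 ^ Suc j * 2) ^ n"
        proof (rule power_increasing[OF n_pos])
          have "(1::real) \<le> 2 ^ j" by (intro one_le_power) simp
          then show "1 \<le> (2::real) ^ Suc j * 2" unfolding power_Suc by linarith
        qed
        finally have "2 ^ j * (V * r ^ n) \<le> (2 ^ Suc j * 2) ^ n * (V * r ^ n)" using V_pos r by (intro mult_right_mono) auto
        then show "2 ^ j * (V * r ^ n) \<le> V * ?\<rho> ^ n" by (simp add: power_mult_distrib mult_ac)
      qed (use \<kappa>0 V_pos r in auto)
      also have "\<dots> = ((2 ^ j) powr (- \<kappa>)) * (V * r ^ n) powr (- \<kappa>)" using V_pos r by (simp add: powr_mult)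
      also have "(2 ^ j :: real) powr (- \<kappa>) \<le> (2 ^ j) powr (- \<kappa>0)" using \<kappa>0 by (intro powr_mono) auto
      also have "(2 ^ j :: real) powr (- \<kappa>0) = ?d ^ j" by (simp add: powr_realpow[symmetric] powr_powr mult.commute)
      finally have e2: "(V * ?\<rho> ^ n) powr (- \<kappa>) \<le> ?d ^ j * (V * r ^ n) powr (- \<kappa>)" by (simp add: mult_right_mono)
      have "C * V * 4 ^ n * L * (V * ?\<rho> ^ n) powr (- \<kappa>) \<le> C * V * 4 ^ n * L * (?d ^ j * (V * r ^ n) powr (- \<kappa>))"
        using C_pos V_pos L by (intro mult_left_mono e2) auto
      then show "C / (2 ^ j * r) ^ n * (L * (V * ?\<rho> ^ n) powr (- \<kappa>) * (V * ?\<rho> ^ n)) \<le> ?D * ?d ^ j"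
        unfolding e1 by (simp add: mult_ac)
    qed
    finally show "ennreal (C / (2 ^ j * r) ^ n) * (\<integral>\<^sup>+y\<in>ball x ?\<rho>. ennreal \<bar>f y\<bar> \<partial>M) \<le> ennreal (?D * ?d ^ j)" .
  qed
  also have "\<dots> = ennreal (\<Sum>j. ?D * ?d ^ j)"
    using D d by (intro suminf_ennreal2) (auto intro!: summable_mult summable_geometric)
  also have "(\<Sum>j. ?D * ?d ^ j) = ?D * (1 / (1 - ?d))"
    using d by (subst suminf_mult) (auto simp: suminf_geometric)
  also have "?D * (1 / (1 - ?d)) = tail_const \<kappa>0 * L * (V * r ^ n) powr (- \<kappa>)" by (simp add: tail_const_def)
  finally show ?thesis
    using L tail_const_nonneg[OF \<kappa>0(1)] by (subst (asm) ennreal_le_iff) auto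
qed

definition morrey_const :: "real \<Rightarrow> real \<Rightarrow> real" where
  "morrey_const A \<kappa> = 4 * (A * 2 ^ n + tail_const \<kappa> + 1)"

text \<open>On \<open>B(x,r)\<close> the restriction of \<open>f\<close> to \<open>B(x,2r)\<close> is handled by the strong type bound and the remainder by
  \<open>trunc_tail\<close>, whose bound \<open>v\<^sup>-\<^sup>(\<^sup>1\<^sup>-\<^sup>\<mu>\<^sup>)\<^sup>/\<^sup>q\<close> becomes \<open>v\<^sup>\<mu>\<close> after taking \<open>q\<close>-th powers and integrating over a ball of
  volume \<open>v\<close>. The factor \<open>4\<close> in \<^term>\<open>morrey_const\<close> absorbs \<open>2\<^sup>q\<close> from adding the two parts and \<open>2 \<le> 2\<^sup>q\<close> from
  adding the two bounds.\<close>

lemma morrey_trunc: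
  assumes q: "1 < q" and \<kappa>0: "0 < \<kappa>0" "\<kappa>0 \<le> (1 - \<mu>) / q" and \<mu>: "0 \<le> \<mu>" "\<mu> < 1" and L: "L \<ge> 0"
    and st: "strong_type q A" and [measurable]: "f \<in> borel_measurable M" and fq: "powint M q f < \<infinity>"
    and x: "x \<in> \<Omega>" and r: "r > 0" and e: "e > 0"
    and mass: "\<And>\<rho>. \<rho> > 0 \<Longrightarrow> morrey_mass q f x \<rho> \<le> ennreal (L powr q * (V * \<rho> ^ n) powr \<mu>)"
  shows "morrey_mass q (trunc e f) x r \<le> ennreal ((morrey_const A \<kappa>0 * L) powr q * (V * r ^ n) powr \<mu>)"
proof -
  have A: "A \<ge> 0" using st by (simp add: strong_type_def)
  have f: "integrable M f" using powint_finite_imp_integrable[OF _ fq] q by simp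
  let ?\<kappa> = "(1 - \<mu>) / q" and ?v = "V * r ^ n"
  have v: "?v > 0" using V_pos r by simp
  define X where "X = A * 2 ^ n + tail_const \<kappa>0 + 1"
  have B2: "tail_const \<kappa>0 \<ge> 0" by (rule tail_const_nonneg[OF \<kappa>0(1)])
  have X: "X \<ge> 1" "A * 2 ^ n \<le> X" "tail_const \<kappa>0 \<le> X" using A B2 by (auto simp: X_def)
  define f1 where "f1 y = f y * indicator (ball x (2 * r)) y" for y
  define f2 where "f2 y = f y * indicator {y. 2 * r \<le> dist x y} y" for y
  have [measurable]: "f1 \<in> borel_measurable M" "f2 \<in> borel_measurable M"
    unfolding f1_def f2_def by measurable
  have f1i: "integrable M f1" and f2i: "integrable M f2"
    by (auto intro!: Bochner_Integration.integrable_bound[OF f] simp: f1_def f2_def indicator_def)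
  have f_eq: "f = (\<lambda>y. f1 y + f2 y)" by (auto simp: fun_eq_iff f1_def f2_def indicator_def)
  have m1: "powint M q f1 \<le> ennreal (L powr q * (2 ^ n * ?v powr \<mu>))"
  proof -
    have "powint M q f1 = morrey_mass q f x (2 * r)"
      unfolding powint_def morrey_mass_def f1_def using q by (intro nn_integral_cong) (auto simp: indicator_def)
    also have "\<dots> \<le> ennreal (L powr q * (V * (2 * r) ^ n) powr \<mu>)" using r by (intro mass) auto
    also have "\<dots> \<le> ennreal (L powr q * (2 ^ n * ?v powr \<mu>))"
    proof (intro ennreal_leI mult_left_mono)
      have "(V * (2 * r) ^ n) powr \<mu> = (2 ^ n) powr \<mu> * ?v powr \<mu>"
        using v by (simp add: power_mult_distrib powr_mult[symmetric] mult_ac)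
      also have "(2 ^ n :: real) powr \<mu> \<le> (2 ^ n) powr 1" using \<mu> by (intro powr_mono one_le_power) auto
      finally show "(V * (2 * r) ^ n) powr \<mu> \<le> 2 ^ n * ?v powr \<mu>" by (simp add: mult_right_mono)
    qed auto
    finally show ?thesis .
  qed
  have p1: "powint M q (trunc e f1) \<le> ennreal ((X * L) powr q * ?v powr \<mu>)"
  proof -
    have "powint M q f1 < \<infinity>" using m1 by (rule order_le_less_trans) simp
    then have "powint M q (trunc e f1) \<le> ennreal A * powint M q f1"
      using st e \<open>f1 \<in> borel_measurable M\<close> unfolding strong_type_def by blast
    also have "\<dots> \<le> ennreal A * ennreal (L powr q * (2 ^ n * ?v powr \<mu>))" by (intro mult_left_mono m1) auto
    also have "\<dots> = ennreal (A * (L powr q * (2 ^ n * ?v powr \<mu>)))" using A v by (intro ennreal_mult[symmetric]) auto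
    also have "\<dots> \<le> ennreal ((X * L) powr q * ?v powr \<mu>)"
    proof (rule ennreal_leI)
      have "A * 2 ^ n \<le> X powr 1" using X by simp
      also have "X powr 1 \<le> X powr q" using X q by (intro powr_mono) auto
      finally have "A * 2 ^ n * (L powr q * ?v powr \<mu>) \<le> X powr q * (L powr q * ?v powr \<mu>)" by (intro mult_right_mono) auto
      then show "A * (L powr q * (2 ^ n * ?v powr \<mu>)) \<le> (X * L) powr q * ?v powr \<mu>"
        using X L by (simp add: powr_mult mult_ac)
    qed
    finally show ?thesis .
  qed
  have p2: "\<bar>trunc e f2 z\<bar> powr q \<le> (X * L) powr q * ?v powr (\<mu> - 1)" if z: "z \<in> \<Omega>" "dist x z < r" for z
  proof -
    have "\<bar>trunc e f2 z\<bar> \<le> tail_const \<kappa>0 * L * ?v powr (- ?\<kappa>)"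
      unfolding f2_def using q \<kappa>0 by (intro trunc_tail[of q \<kappa>0 ?\<kappa> \<mu>] L f x r e mass z) auto
    also have "\<dots> \<le> X * L * ?v powr (- ?\<kappa>)" using X L by (intro mult_right_mono) auto
    finally have "\<bar>trunc e f2 z\<bar> powr q \<le> (X * L * ?v powr (- ?\<kappa>)) powr q" using q by (intro powr_mono2) auto
    also have "\<dots> = (X * L) powr q * ?v powr (- ?\<kappa> * q)" using X L by (simp add: powr_mult powr_powr)
    also have "- ?\<kappa> * q = \<mu> - 1" using q by simp
    finally show ?thesis .
  qed
  have vm: "?v powr (\<mu> - 1) * ?v = ?v powr \<mu>" using v powr_add[of ?v "\<mu> - 1" 1] by simp
  have "morrey_mass q (trunc e f) x r
     \<le> (\<integral>\<^sup>+z. ennreal (2 powr q) * (ennreal (\<bar>trunc e f1 z\<bar> powr q) + ennreal ((X * L) powr q * ?v powr (\<mu> - 1)) * indicator (ball x r) z) \<partial>M)"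
    unfolding morrey_mass_def
  proof (intro nn_integral_mono)
    fix z assume "z \<in> space M"
    then have z: "z \<in> \<Omega>" by simp
    show "ennreal (\<bar>trunc e f z\<bar> powr q) * indicator (ball x r) z
      \<le> ennreal (2 powr q) * (ennreal (\<bar>trunc e f1 z\<bar> powr q) + ennreal ((X * L) powr q * ?v powr (\<mu> - 1)) * indicator (ball x r) z)"
    proof (cases "dist x z < r")
      case True
      have "trunc e f z = trunc e f1 z + trunc e f2 z" by (subst f_eq) (rule trunc_add[OF f1i f2i])
      then have "\<bar>trunc e f z\<bar> powr q \<le> (\<bar>trunc e f1 z\<bar> + \<bar>trunc e f2 z\<bar>) powr q" using q by (intro powr_mono2) auto
      also have "\<dots> \<le> 2 powr q * (\<bar>trunc e f1 z\<bar> powr q + \<bar>trunc e f2 z\<bar> powr q)" using q by (intro powr_add_le) auto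
      also have "\<dots> \<le> 2 powr q * (\<bar>trunc e f1 z\<bar> powr q + (X * L) powr q * ?v powr (\<mu> - 1))"
        using p2[OF z True] by (intro mult_left_mono add_mono) auto
      finally have "ennreal (\<bar>trunc e f z\<bar> powr q) \<le> ennreal (2 powr q * (\<bar>trunc e f1 z\<bar> powr q + (X * L) powr q * ?v powr (\<mu> - 1)))"
        by (rule ennreal_leI)
      also have "\<dots> = ennreal (2 powr q) * (ennreal (\<bar>trunc e f1 z\<bar> powr q) + ennreal ((X * L) powr q * ?v powr (\<mu> - 1)))"
        by (simp add: ennreal_mult ennreal_plus)
      finally show ?thesis using True by simp
    qed simp
  qed
  also have "\<dots> = ennreal (2 powr q) * (powint M q (trunc e f1) + ennreal ((X * L) powr q * ?v powr (\<mu> - 1)) * (\<integral>\<^sup>+z. indicator (ball x r) z \<partial>M))"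
    unfolding powint_def by (simp add: nn_integral_cmult nn_integral_add)
  also have "\<dots> \<le> ennreal (2 powr q) * (ennreal ((X * L) powr q * ?v powr \<mu>) + ennreal ((X * L) powr q * ?v powr (\<mu> - 1)) * ennreal ?v)"
    using r by (intro mult_left_mono add_mono p1 nn_integral_ball_indicator_le) auto
  also have "ennreal ((X * L) powr q * ?v powr (\<mu> - 1)) * ennreal ?v = ennreal ((X * L) powr q * (?v powr (\<mu> - 1) * ?v))"
    using v by (simp add: ennreal_mult[symmetric] mult.assoc)
  also have "\<dots> = ennreal ((X * L) powr q * ?v powr \<mu>)" by (simp only: vm)
  also have "ennreal (2 powr q) * (ennreal ((X * L) powr q * ?v powr \<mu>) + ennreal ((X * L) powr q * ?v powr \<mu>))
     = ennreal (2 powr q * (2 * ((X * L) powr q * ?v powr \<mu>)))"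
    by (simp flip: ennreal_plus ennreal_mult)
  also have "\<dots> \<le> ennreal (2 powr q * (2 powr q * ((X * L) powr q * ?v powr \<mu>)))"
  proof (intro ennreal_leI mult_left_mono mult_right_mono)
    show "2 \<le> 2 powr q" using powr_mono[of 1 q 2] q by simp
  qed auto
  also have "2 powr q * (2 powr q * ((X * L) powr q * ?v powr \<mu>)) = (morrey_const A \<kappa>0 * L) powr q * ?v powr \<mu>"
  proof -
    have "(morrey_const A \<kappa>0 * L) powr q = (2 * 2 * X * L) powr q" by (simp add: morrey_const_def X_def)
    also have "\<dots> = 2 powr q * 2 powr q * (X * L) powr q" using X L by (simp only: powr_mult mult.assoc)
    finally show ?thesis by simp
  qed
  finally show ?thesis .
qed

text \<open>Fatou along the truncations at \<open>1 / (k + 1)\<close>. Passing to the limit only after the local estimate avoids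
  any use of linearity of the principal value operator.\<close>

lemma morrey_limit:
  assumes q: "q > 0" and [measurable]: "f \<in> borel_measurable M" "g \<in> borel_measurable M"
    and lim: "AE x in M. ((\<lambda>\<epsilon>. trunc \<epsilon> f x) \<longlongrightarrow> g x) (at_right 0)"
    and le: "\<And>e. e > 0 \<Longrightarrow> morrey_mass q (trunc e f) x r \<le> c"
  shows "morrey_mass q g x r \<le> c"
proof -
  let ?e = "\<lambda>k::nat. 1 / real (Suc k)"
  have e: "filterlim ?e (at_right 0) sequentially"
    unfolding filterlim_at_right_to_top[symmetric] filterlim_at
    using LIMSEQ_inverse_real_of_nat by (auto simp: inverse_eq_divide)
  have "morrey_mass q g x r \<le> (\<integral>\<^sup>+y. liminf (\<lambda>k. ennreal (\<bar>trunc (?e k) f y\<bar> powr q) * indicator (ball x r) y) \<partial>M)"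
    unfolding morrey_mass_def
  proof (rule nn_integral_mono_AE)
    show "AE y in M. ennreal (\<bar>g y\<bar> powr q) * indicator (ball x r) y \<le> liminf (\<lambda>k. ennreal (\<bar>trunc (?e k) f y\<bar> powr q) * indicator (ball x r) y)"
      using lim
    proof eventually_elim
      case (elim y)
      have "(\<lambda>k. trunc (?e k) f y) \<longlonglongrightarrow> g y" by (rule filterlim_compose[OF elim e])
      then have "(\<lambda>k. ennreal (\<bar>trunc (?e k) f y\<bar> powr q)) \<longlonglongrightarrow> ennreal (\<bar>g y\<bar> powr q)"
        using q by (intro tendsto_ennrealI tendsto_powr2 tendsto_rabs tendsto_const) auto
      then have "(\<lambda>k. ennreal (\<bar>trunc (?e k) f y\<bar> powr q) * indicator (ball x r) y) \<longlonglongrightarrow> ennreal (\<bar>g y\<bar> powr q) * indicator (ball x r) y"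
        by (cases "y \<in> ball x r") auto
      then show ?case by (simp add: lim_imp_Liminf)
    qed
  qed
  also have "\<dots> \<le> liminf (\<lambda>k. \<integral>\<^sup>+y. ennreal (\<bar>trunc (?e k) f y\<bar> powr q) * indicator (ball x r) y \<partial>M)"
    by (rule nn_integral_liminf) measurable
  also have "\<dots> \<le> liminf (\<lambda>k. c)"
    using le unfolding morrey_mass_def by (intro Liminf_mono always_eventually) auto
  also have "\<dots> = c" by (simp add: Liminf_const)
  finally show ?thesis .
qed

end

section \<open>Dini moduli give summable decay\<close>

text \<open>On the interval from \<open>b\<^sup>-\<^sup>(\<^sup>k\<^sup>+\<^sup>1\<^sup>)\<close> to \<open>b\<^sup>-\<^sup>k\<close> the integrand \<open>w t / t\<close> is at least \<open>w (b\<^sup>-\<^sup>(\<^sup>k\<^sup>+\<^sup>1\<^sup>)) b\<^sup>k\<close>, and the length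
  of the interval is \<open>(1 - 1 / b) b\<^sup>-\<^sup>k\<close>.\<close>

lemma dini_modulus_summable:
  assumes w: "dini_modulus w" and b: "b > (1::real)"
  shows "summable (\<lambda>k. w (1 / b ^ Suc k))"
proof -
  have pos: "w t > 0" if "t > 0" for t using w that by (simp add: dini_modulus_def)
  have mono: "w s \<le> w t" if "0 < s" "s \<le> t" for s t
    using w that unfolding dini_modulus_def by (auto dest!: mono_onD[of _ _ s t])
  have fin: "(\<integral>\<^sup>+t\<in>{0<..<1}. ennreal (w t / t) \<partial>lborel) < \<infinity>" using w by (simp add: dini_modulus_def)
  define J where "J k = {1 / b ^ Suc k<..<1 / b ^ k}" for k
  have len: "1 / b ^ k - 1 / b ^ Suc k = (1 - 1 / b) / b ^ k" for k using b by (simp add: field_simps)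
  have sep: "k = l" if "t \<in> J k" "t \<in> J l" for t k l
  proof -
    have False if "k < l" "t \<in> J k" "t \<in> J l" for k l
    proof -
      have "b ^ Suc k \<le> b ^ l" using b that by (intro power_increasing) auto
      then have "1 / b ^ l \<le> 1 / b ^ Suc k" using b by (intro divide_left_mono mult_pos_pos) auto
      then show False using that(2,3) unfolding J_def greaterThanLessThan_iff by linarith
    qed
    then show ?thesis using that by (metis linorder_neqE_nat)
  qed
  have J01: "J k \<subseteq> {0<..<1}" for k
  proof
    fix t assume t: "t \<in> J k"
    have "0 < 1 / b ^ Suc k" using b by simp
    moreover have "1 / b ^ k \<le> 1" using b by (simp add: one_le_power)
    ultimately show "t \<in> {0<..<1}" using t unfolding J_def greaterThanLessThan_iff by linarith
  qed
  let ?a = "\<lambda>k. w (1 / b ^ Suc k)"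
  have a0: "?a k \<ge> 0" for k using pos[of "1 / b ^ Suc k"] b by simp
  have "(\<Sum>k. ennreal (?a k * (1 - 1 / b))) = (\<Sum>k. \<integral>\<^sup>+t. ennreal (?a k * b ^ k) * indicator (J k) t \<partial>lborel)"
  proof (intro arg_cong[where f=suminf] ext)
    fix k
    have "(\<integral>\<^sup>+t\<in>J k. ennreal (?a k * b ^ k) \<partial>lborel) = ennreal (?a k * b ^ k) * ennreal (1 / b ^ k - 1 / b ^ Suc k)"
      unfolding J_def using b by (subst nn_integral_cmult_indicator) (auto simp: divide_left_mono)
    also have "\<dots> = ennreal (?a k * b ^ k * (1 / b ^ k - 1 / b ^ Suc k))"
      unfolding len using b a0 by (intro ennreal_mult[symmetric]) auto
    also have "?a k * b ^ k * (1 / b ^ k - 1 / b ^ Suc k) = ?a k * (1 - 1 / b)" unfolding len using b by simp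
    finally show "ennreal (?a k * (1 - 1 / b)) = (\<integral>\<^sup>+t\<in>J k. ennreal (?a k * b ^ k) \<partial>lborel)" ..
  qed
  also have "\<dots> = (\<integral>\<^sup>+t. (\<Sum>k. ennreal (?a k * b ^ k) * indicator (J k) t) \<partial>lborel)"
    by (rule nn_integral_suminf[symmetric]) (simp add: J_def)
  also have "\<dots> \<le> (\<integral>\<^sup>+t\<in>{0<..<1}. ennreal (w t / t) \<partial>lborel)"
  proof (intro nn_integral_mono)
    fix t :: real
    show "(\<Sum>k. ennreal (?a k * b ^ k) * indicator (J k) t) \<le> ennreal (w t / t) * indicator {0<..<1} t"
    proof (cases "\<exists>k. t \<in> J k")
      case True
      then obtain k where k: "t \<in> J k" by blast
      have "(\<Sum>k. ennreal (?a k * b ^ k) * indicator (J k) t) = (\<Sum>l\<in>{k}. ennreal (?a l * b ^ l) * indicator (J l) t)"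
        using k sep by (intro suminf_finite) (auto simp: indicator_def)
      also have "\<dots> = ennreal (?a k * b ^ k)" using k by simp
      also have "\<dots> \<le> ennreal (w t / t)"
      proof (rule ennreal_leI)
        have t: "t > 0" "1 / b ^ Suc k \<le> t" "t \<le> 1 / b ^ k" using k J01[of k] by (auto simp: J_def)
        have "?a k \<le> w t" using t b by (intro mono) auto
        moreover have "b ^ k \<le> 1 / t" using t b by (simp add: field_simps)
        ultimately have "?a k * b ^ k \<le> w t * (1 / t)" using pos[OF t(1)] b by (intro mult_mono) auto
        then show "?a k * b ^ k \<le> w t / t" by simp
      qed
      also have "\<dots> = ennreal (w t / t) * indicator {0<..<1} t" using k J01[of k] by auto
      finally show ?thesis .
    qed (auto simp: indicator_def)
  qed
  finally have "(\<Sum>k. ennreal (?a k * (1 - 1 / b))) \<noteq> top" using fin by (auto simp: top_unique)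
  then have "summable (\<lambda>k. ?a k * (1 - 1 / b))" using a0 b by (intro summable_suminf_not_top) auto
  then have "summable (\<lambda>k. ?a k * (1 - 1 / b) * (1 / (1 - 1 / b)))" by (rule summable_mult2)
  then show ?thesis using b by simp
qed

section \<open>Norms of Morrey type\<close>

lemma ennreal_powr_le_iff:
  assumes "q > 0" "c > 0" "L \<ge> 0"
  shows "ennreal_powr (ennreal (1 / c) * m) (1 / q) \<le> ennreal L \<longleftrightarrow> m \<le> ennreal (L powr q * c)"
proof (cases m)
  case (real a)
  then have "ennreal (1 / c) * m = ennreal (a / c)" using assms by (simp flip: ennreal_mult)
  then have "ennreal_powr (ennreal (1 / c) * m) (1 / q) = ennreal ((a / c) powr (1 / q))"
    using real assms by (simp add: ennreal_powr_def)
  moreover have "(a / c) powr (1 / q) \<le> L \<longleftrightarrow> a \<le> L powr q * c"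
  proof
    assume "(a / c) powr (1 / q) \<le> L"
    then have "((a / c) powr (1 / q)) powr q \<le> L powr q" using assms by (intro powr_mono2) auto
    then show "a \<le> L powr q * c" using assms real by (simp add: powr_powr divide_le_eq)
  next
    assume "a \<le> L powr q * c"
    then have "(a / c) powr (1 / q) \<le> (L powr q) powr (1 / q)"
      using assms real by (intro powr_mono2) (auto simp: divide_le_eq)
    then show "(a / c) powr (1 / q) \<le> L" using assms by (simp add: powr_powr)
  qed
  ultimately show ?thesis using real assms by simp
next
  case top
  then have "ennreal (1 / c) * m = top" using assms by (simp add: ennreal_mult_top)
  then show ?thesis using top by (simp add: ennreal_powr_def top_unique)
qed

text \<open>The segment from \<open>x\<close> to \<open>y\<close> can be prolonged a little beyond \<open>y\<close> inside \<open>\<Omega>\<close>. Hence a ball of radius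
  \<^term>\<open>diameter \<Omega>\<close> about a point of \<open>\<Omega>\<close> contains all of \<open>\<Omega>\<close>, although balls are open.\<close>

lemma open_bounded_dist_less_diameter:
  fixes \<Omega> :: "'a::euclidean_space set"
  assumes op: "open \<Omega>" and bd: "bounded \<Omega>" and x: "x \<in> \<Omega>" and y: "y \<in> \<Omega>"
  shows "dist x y < diameter \<Omega>"
proof -
  obtain d where d: "d > 0" "ball y d \<subseteq> \<Omega>" using op y open_contains_ball by blast
  obtain v :: 'a where v: "norm v = 1" "dist x (y + (d/2) *\<^sub>R v) = dist x y + d/2"
  proof (cases "x = y")
    case True
    obtain i :: 'a where "i \<in> Basis" using nonempty_Basis by blast
    then show thesis using that[of i] d True by (simp add: dist_norm)
  next
    case False
    let ?v = "(y - x) /\<^sub>R norm (y - x)"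
    have n1: "norm ?v = 1" using False by simp
    have eq: "y + (d/2) *\<^sub>R ?v - x = (1 + d / (2 * norm (y - x))) *\<^sub>R (y - x)"
      by (simp add: scaleR_left_distrib scaleR_right_diff_distrib field_simps)
    have "dist x (y + (d/2) *\<^sub>R ?v) = norm (y + (d/2) *\<^sub>R ?v - x)"
      by (metis dist_commute dist_norm)
    also have "\<dots> = (1 + d / (2 * norm (y - x))) * norm (y - x)"
      unfolding eq norm_scaleR using d by simp
    also have "\<dots> = dist x y + d/2" using False by (simp add: distrib_right dist_norm norm_minus_commute)
    finally show thesis using that n1 by blast
  qed
  have "dist y (y + (d/2) *\<^sub>R v) = d/2" using v d by (simp add: dist_norm)
  then have "y + (d/2) *\<^sub>R v \<in> ball y d" using d by simp
  then have "y + (d/2) *\<^sub>R v \<in> \<Omega>" using d by blast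
  then have "dist x (y + (d/2) *\<^sub>R v) \<le> diameter \<Omega>" by (rule diameter_bounded_bound[OF bd x])
  then show ?thesis using v d by simp
qed

context
  fixes \<Omega> :: "(real ^ 'n) set" and b V :: real and n :: nat and K :: "real ^ 'n \<Rightarrow> real ^ 'n \<Rightarrow> real"
    and C :: real and \<omega> :: "nat \<Rightarrow> real"
  assumes D: "cz_kernel_domain \<Omega> b V n K C \<omega>"
begin

interpretation D: cz_kernel_domain \<Omega> b V n K C \<omega> by (rule D)

lemma measure_ball_eq: "r \<ge> 0 \<Longrightarrow> measure lebesgue (ball x r) = V * r ^ n" for x :: "real ^ 'n"
  by (simp add: content_ball D.V_def D.n_def)

lemma morrey_norm_le_iff:
  assumes q: "q > 0" and L: "L \<ge> 0"
  shows "morrey_norm \<Omega> q \<mu> f \<le> ennreal L \<longleftrightarrow>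
    (\<forall>x\<in>\<Omega>. \<forall>r\<in>{0<..diameter \<Omega>}. D.morrey_mass q f x r \<le> ennreal (L powr q * (V * r ^ n) powr \<mu>))"
proof -
  have "ennreal_powr (ennreal (1 / measure lebesgue (ball x r) powr \<mu>) *
             (\<integral>\<^sup>+ y \<in> ball x r \<inter> \<Omega>. ennreal (\<bar>f y\<bar> powr q) \<partial>lebesgue)) (1 / q) \<le> ennreal L
      \<longleftrightarrow> D.morrey_mass q f x r \<le> ennreal (L powr q * (V * r ^ n) powr \<mu>)" if "r > 0" for x r
  proof -
    have pos: "(V * r ^ n) powr \<mu> > 0" using D.V_pos that by simp
    have "D.morrey_mass q f x r = (\<integral>\<^sup>+y. ennreal (\<bar>f y\<bar> powr q) * indicator (ball x r) y * indicator \<Omega> y \<partial>lebesgue)"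
      unfolding D.morrey_mass_def using D.dom_sets by (intro nn_integral_restrict_space) auto
    also have "\<dots> = (\<integral>\<^sup>+ y \<in> ball x r \<inter> \<Omega>. ennreal (\<bar>f y\<bar> powr q) \<partial>lebesgue)"
      by (intro nn_integral_cong) (auto simp: indicator_def)
    finally show ?thesis
      using ennreal_powr_le_iff[OF q pos L] that by (simp only: measure_ball_eq less_imp_le)
  qed
  then show ?thesis unfolding morrey_norm_def SUP_le_iff by auto
qed

text \<open>The norm only tests radii up to the diameter; larger balls meet \<open>\<Omega>\<close> in the same set.\<close>

lemma morrey_mass_all_radii:
  assumes q: "q > 0" and L: "L \<ge> 0" and \<mu>: "\<mu> \<ge> 0" and le: "morrey_norm \<Omega> q \<mu> f \<le> ennreal L"
    and x: "x \<in> \<Omega>" and r: "r > 0"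
  shows "D.morrey_mass q f x r \<le> ennreal (L powr q * (V * r ^ n) powr \<mu>)"
proof -
  have dless: "dist x y < diameter \<Omega>" if "y \<in> \<Omega>" for y
    by (rule open_bounded_dist_less_diameter[OF D.open_dom D.bounded_dom x that])
  have d: "diameter \<Omega> > 0" using dless[OF x] by simp
  show ?thesis
  proof (cases "r \<le> diameter \<Omega>")
    case True
    then show ?thesis using le x r unfolding morrey_norm_le_iff[OF q L] by auto
  next
    case False
    have "D.morrey_mass q f x r = D.morrey_mass q f x (diameter \<Omega>)"
      unfolding D.morrey_mass_def using False
      by (intro nn_integral_cong) (auto simp: indicator_def dest: dless)
    also have "\<dots> \<le> ennreal (L powr q * (V * diameter \<Omega> ^ n) powr \<mu>)"
      using le x d unfolding morrey_norm_le_iff[OF q L] by auto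
    also have "\<dots> \<le> ennreal (L powr q * (V * r ^ n) powr \<mu>)"
      using False d D.V_pos \<mu> by (intro ennreal_leI mult_left_mono powr_mono2 power_mono) auto
    finally show ?thesis .
  qed
qed

lemma morrey_finite_imp_powint:
  assumes q: "q > 0" and \<mu>: "\<mu> \<ge> 0" and fin: "morrey_norm \<Omega> q \<mu> f < \<infinity>"
  shows "powint D.M q f < \<infinity>"
proof (cases "\<Omega> = {}")
  case True
  then show ?thesis by (simp add: powint_def nn_integral_empty)
next
  case False
  then obtain x where x: "x \<in> \<Omega>" by blast
  obtain L where L: "morrey_norm \<Omega> q \<mu> f = ennreal L" "L \<ge> 0" using fin by (cases "morrey_norm \<Omega> q \<mu> f") auto
  have dless: "dist x y < diameter \<Omega>" if "y \<in> \<Omega>" for y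
    by (rule open_bounded_dist_less_diameter[OF D.open_dom D.bounded_dom x that])
  have "powint D.M q f = D.morrey_mass q f x (diameter \<Omega>)"
    unfolding powint_def D.morrey_mass_def by (intro nn_integral_cong) (auto simp: dless)
  also have "\<dots> \<le> ennreal (L powr q * (V * diameter \<Omega> ^ n) powr \<mu>)"
    using dless[OF x] L by (intro morrey_mass_all_radii q \<mu> x) auto
  finally show ?thesis by (auto intro: order_le_less_trans)
qed

text \<open>Hoelder on each ball. The exponent \<open>\<tau>\<close> of the volume that remains lies in \<open>[0,1]\<close>, so one constant serves
  all parameters.\<close>

lemma morrey_norm_embedding:
  assumes q: "1 < q2" "q2 < q1" and \<mu>: "0 \<le> \<mu>2" "\<mu>2 \<le> \<mu>1" "\<mu>1 < 1" and [measurable]: "g \<in> borel_measurable D.M"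
  shows "morrey_norm \<Omega> q2 \<mu>2 g \<le> ennreal (max 1 (V * diameter \<Omega> ^ n)) * morrey_norm \<Omega> q1 \<mu>1 g"
proof (cases "morrey_norm \<Omega> q1 \<mu>1 g")
  case top
  then show ?thesis by (simp add: ennreal_mult_top)
next
  case (real L)
  let ?B = "max 1 (V * diameter \<Omega> ^ n)"
  have "morrey_norm \<Omega> q2 \<mu>2 g \<le> ennreal (?B * L)"
  proof (subst morrey_norm_le_iff, goal_cases)
    case 3
    show ?case
    proof (intro ballI)
      fix x r assume x: "x \<in> \<Omega>" and r: "r \<in> {0<..diameter \<Omega>}"
      let ?v = "V * r ^ n" and ?s = "q1 / q2"
      let ?u = "L powr q2 * ?v powr ((\<mu>1 - 1) / ?s)"
      have v: "?v > 0" using D.V_pos r by simp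
      have s: "?s > 1" using q by simp
      have "(\<integral>\<^sup>+y\<in>ball x r. ennreal \<bar>\<bar>g y\<bar> powr q2\<bar> \<partial>D.M) \<le> ennreal (?u * ?v)"
      proof (rule D.local_L1_le[OF _ s])
        have "(\<integral>\<^sup>+y\<in>ball x r. ennreal (\<bar>\<bar>g y\<bar> powr q2\<bar> powr ?s) \<partial>D.M) = D.morrey_mass q1 g x r"
          using q by (simp add: D.morrey_mass_def powr_powr)
        also have "\<dots> \<le> ennreal (L powr q1 * ?v powr \<mu>1)"
          using real r \<mu> q by (intro morrey_mass_all_radii x) auto
        also have "L powr q1 * ?v powr \<mu>1 = ?u powr ?s * ?v"
        proof -
          have "?u powr ?s = (L powr q2) powr ?s * (?v powr ((\<mu>1 - 1) / ?s)) powr ?s"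
            by (rule powr_mult)
          also have "\<dots> = L powr q1 * ?v powr (\<mu>1 - 1)" using q by (simp add: powr_powr)
          finally have "?u powr ?s * ?v powr 1 = L powr q1 * (?v powr (\<mu>1 - 1) * ?v powr 1)" by simp
          also have "?v powr (\<mu>1 - 1) * ?v powr 1 = ?v powr \<mu>1" by (subst powr_add[symmetric]) simp
          finally show ?thesis using v by simp
        qed
        finally show "(\<integral>\<^sup>+y\<in>ball x r. ennreal (\<bar>\<bar>g y\<bar> powr q2\<bar> powr ?s) \<partial>D.M) \<le> ennreal (?u powr ?s * ?v)" .
        show "D.dm x r \<le> ?v" using r by (intro D.dm_le) auto
      qed (use r real in auto)
      then have "D.morrey_mass q2 g x r \<le> ennreal (?u * ?v)" by (simp add: D.morrey_mass_def)
      also have "\<dots> \<le> ennreal ((?B * L) powr q2 * ?v powr \<mu>2)"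
      proof (rule ennreal_leI)
        define \<tau> where "\<tau> = (1 - \<mu>2) / q2 - (1 - \<mu>1) / q1"
        have "(1 - \<mu>1) / q1 \<le> (1 - \<mu>2) / q2" using q \<mu> by (intro frac_le) auto
        then have \<tau>0: "\<tau> \<ge> 0" by (simp add: \<tau>_def)
        have "(1 - \<mu>2) / q2 \<le> 1" using q \<mu> by simp
        moreover have "(1 - \<mu>1) / q1 \<ge> 0" using q \<mu> by simp
        ultimately have \<tau>1: "\<tau> \<le> 1" unfolding \<tau>_def by linarith
        have "?v powr \<tau> \<le> ?B"
        proof -
          have "?v powr \<tau> \<le> (max 1 ?v) powr \<tau>" using v \<tau>0 by (intro powr_mono2) auto
          also have "\<dots> \<le> (max 1 ?v) powr 1" using \<tau>1 by (intro powr_mono) auto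
          also have "\<dots> = max 1 ?v" by (simp add: max_def)
          also have "\<dots> \<le> ?B" using r D.V_pos by (intro max.mono mult_left_mono power_mono) auto
          finally show ?thesis .
        qed
        then have "(?v powr \<tau>) powr q2 \<le> ?B powr q2" using q by (intro powr_mono2) auto
        then have "?v powr (\<tau> * q2) \<le> ?B powr q2" by (simp add: powr_powr)
        then have "?v powr (\<tau> * q2) * (L powr q2 * ?v powr \<mu>2) \<le> ?B powr q2 * (L powr q2 * ?v powr \<mu>2)"
          by (intro mult_right_mono) auto
        moreover have "?u * ?v = ?v powr (\<tau> * q2) * (L powr q2 * ?v powr \<mu>2)"
        proof -
          have "(\<mu>1 - 1) / ?s + 1 = \<tau> * q2 + \<mu>2" using q by (simp add: \<tau>_def field_simps)
          then have "?v powr ((\<mu>1 - 1) / ?s) * ?v powr 1 = ?v powr (\<tau> * q2) * ?v powr \<mu>2" by (simp only: powr_add[symmetric])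
          then show ?thesis using v by (simp add: mult_ac)
        qed
        moreover have "(?B * L) powr q2 = ?B powr q2 * L powr q2" by (rule powr_mult)
        ultimately show "?u * ?v \<le> (?B * L) powr q2 * ?v powr \<mu>2"
          by (simp only: mult.assoc)
      qed
      finally show "D.morrey_mass q2 g x r \<le> ennreal ((?B * L) powr q2 * ?v powr \<mu>2)" .
    qed
  qed (use q real in auto)
  also have "\<dots> = ennreal ?B * morrey_norm \<Omega> q1 \<mu>1 g" using real by (simp add: ennreal_mult)
  finally show ?thesis .
qed

lemma has_pv_iff:
  assumes x: "x \<in> \<Omega>" and f: "integrable D.M f"
  shows "has_pv \<Omega> K f x L \<longleftrightarrow> ((\<lambda>\<epsilon>. D.trunc \<epsilon> f x) \<longlongrightarrow> L) (at_right 0)"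
proof -
  have eq: "(\<lambda>y. indicator (\<Omega> - ball x \<epsilon>) y *\<^sub>R (K x y * f y)) = (\<lambda>y. indicator \<Omega> y *\<^sub>R (D.Kt \<epsilon> x y * f y))"
    if "\<epsilon> > 0" for \<epsilon> using that x by (auto simp: fun_eq_iff D.Kt_def indicator_def)
  have int: "set_integrable lebesgue (\<Omega> - ball x \<epsilon>) (\<lambda>y. K x y * f y)" if "\<epsilon> > 0" for \<epsilon>
    unfolding set_integrable_def eq[OF that] using D.Kt_integrable[OF f, of \<epsilon> x] D.dom_sets
    by (subst (asm) integrable_restrict_space) auto
  have val: "set_lebesgue_integral lebesgue (\<Omega> - ball x \<epsilon>) (\<lambda>y. K x y * f y) = D.trunc \<epsilon> f x" if "\<epsilon> > 0" for \<epsilon>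
    unfolding set_lebesgue_integral_def eq[OF that] D.trunc_def using D.dom_sets
    by (subst integral_restrict_space) auto
  have "((\<lambda>\<epsilon>. set_lebesgue_integral lebesgue (\<Omega> - ball x \<epsilon>) (\<lambda>y. K x y * f y)) \<longlongrightarrow> L) (at_right 0)
     \<longleftrightarrow> ((\<lambda>\<epsilon>. D.trunc \<epsilon> f x) \<longlongrightarrow> L) (at_right 0)"
    by (intro tendsto_cong) (auto simp: eventually_at_right_field val intro: exI[of _ 1])
  then show ?thesis using int by (simp add: has_pv_def)
qed

lemma pv_operator_eq:
  assumes "x \<in> \<Omega>" "integrable D.M f" "((\<lambda>\<epsilon>. D.trunc \<epsilon> f x) \<longlongrightarrow> L) (at_right 0)"
  shows "pv_operator \<Omega> K f x = L"
  unfolding pv_operator_def has_pv_iff[OF assms(1,2)]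
  using assms(3) tendsto_unique[OF trivial_limit_at_right_real] by blast

lemma pv_operator_limit:
  assumes f: "integrable D.M f" and pv: "AE x in D.M. \<exists>L. has_pv \<Omega> K f x L"
  shows "AE x in D.M. ((\<lambda>\<epsilon>. D.trunc \<epsilon> f x) \<longlongrightarrow> pv_operator \<Omega> K f x) (at_right 0)"
  using pv AE_space
proof eventually_elim
  case (elim x)
  then obtain L where "((\<lambda>\<epsilon>. D.trunc \<epsilon> f x) \<longlongrightarrow> L) (at_right 0)" using has_pv_iff[OF _ f] by auto
  then show ?case using pv_operator_eq[OF _ f] elim by auto
qed

text \<open>The operator is arbitrary where the limit fails to exist, but this happens only in a null set, and
  Lebesgue measure is complete.\<close>

lemma pv_operator_measurable:
  assumes f: "integrable D.M f" and pv: "AE x in D.M. \<exists>L. has_pv \<Omega> K f x L"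
  shows "pv_operator \<Omega> K f \<in> borel_measurable D.M"
proof -
  have [measurable]: "f \<in> borel_measurable D.M" using f by auto
  let ?e = "\<lambda>k::nat. 1 / real (Suc k)"
  have e: "filterlim ?e (at_right 0) sequentially"
    unfolding filterlim_at using LIMSEQ_inverse_real_of_nat by (auto simp: inverse_eq_divide)
  obtain N where N: "N \<in> null_sets D.M" "{x\<in>space D.M. \<not> ((\<lambda>\<epsilon>. D.trunc \<epsilon> f x) \<longlongrightarrow> pv_operator \<Omega> K f x) (at_right 0)} \<subseteq> N"
    using pv_operator_limit[OF f pv] by (auto elim!: AE_E2 simp: eventually_ae_filter)
  define g where "g x = (if x \<in> N then 0 else pv_operator \<Omega> K f x)" for x
  have Nm: "N \<in> sets D.M" using N by auto
  have "g \<in> borel_measurable D.M"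
  proof (rule borel_measurable_LIMSEQ_real)
    fix x assume x: "x \<in> space D.M"
    show "(\<lambda>k. if x \<in> N then 0 else D.trunc (?e k) f x) \<longlonglongrightarrow> g x"
    proof (cases "x \<in> N")
      case False
      then have "((\<lambda>\<epsilon>. D.trunc \<epsilon> f x) \<longlongrightarrow> pv_operator \<Omega> K f x) (at_right 0)" using N x by auto
      from filterlim_compose[OF this e] show ?thesis using False by (simp add: g_def)
    qed (simp add: g_def)
  next
    show "(\<lambda>x. if x \<in> N then 0 else D.trunc (?e k) f x) \<in> borel_measurable D.M" for k
      using Nm by (intro measurable_If_set) (auto intro: sets.Int)
  qed
  show ?thesis
  proof (rule borel_measurableI)
    fix S :: "real set" assume S: "open S"
    have "g -` S \<inter> space D.M \<in> sets D.M" using \<open>g \<in> borel_measurable D.M\<close> S by (intro measurable_sets) auto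
    then have A: "g -` S \<inter> space D.M - N \<in> sets D.M" using Nm by auto
    have "pv_operator \<Omega> K f -` S \<inter> space D.M \<inter> N \<in> sets D.M"
    proof -
      have "N \<in> sets lebesgue" "emeasure lebesgue N = 0"
        using N sets.sets_into_space[OF Nm] by (auto simp: null_sets_def sets_restrict_space_iff emeasure_restrict_space)
      then have "pv_operator \<Omega> K f -` S \<inter> space D.M \<inter> N \<in> sets lebesgue"
        by (intro null_sets_completion_subset[of _ N, THEN null_setsD2]) (auto simp: null_sets_def)
      then show ?thesis by (auto simp: sets_restrict_space_iff)
    qed
    moreover have "pv_operator \<Omega> K f -` S \<inter> space D.M = (g -` S \<inter> space D.M - N) \<union> (pv_operator \<Omega> K f -` S \<inter> space D.M \<inter> N)"
      by (auto simp: g_def)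
    ultimately show "pv_operator \<Omega> K f -` S \<inter> space D.M \<in> sets D.M" using A by (metis sets.Un)
  qed
qed

lemma powint_2_eq_L2_norm:
  assumes [measurable]: "h \<in> borel_measurable D.M" and fin: "powint D.M 2 h < \<infinity>"
  shows "h \<in> L2_space \<Omega>" "powint D.M 2 h = ennreal ((L2_norm \<Omega> h)\<^sup>2)"
proof -
  have p: "powint D.M 2 h = (\<integral>\<^sup>+x. ennreal ((h x)\<^sup>2) \<partial>D.M)"
    unfolding powint_def by (intro nn_integral_cong) simp
  have int: "integrable D.M (\<lambda>x. (h x)\<^sup>2)"
    by (rule integrableI_nonneg) (use fin p in auto)
  show "h \<in> L2_space \<Omega>" using int by (simp add: L2_space_def)
  show "powint D.M 2 h = ennreal ((L2_norm \<Omega> h)\<^sup>2)"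
    unfolding p L2_norm_def using int by (simp add: nn_integral_eq_integral)
qed

lemma L2_space_powint:
  assumes "h \<in> L2_space \<Omega>"
  shows "h \<in> borel_measurable D.M" "powint D.M 2 h < \<infinity>"
proof -
  show m: "h \<in> borel_measurable D.M" using assms by (simp add: L2_space_def)
  have "powint D.M 2 h = (\<integral>\<^sup>+x. ennreal ((h x)\<^sup>2) \<partial>D.M)"
    unfolding powint_def by (intro nn_integral_cong) simp
  then show "powint D.M 2 h < \<infinity>"
    using assms by (simp add: L2_space_def nn_integral_eq_integral)
qed

lemma strong_type_2_of_operator:
  assumes T: "calderon_zygmund_operator \<Omega> K T"
  obtains A where "D.strong_type 2 A"
proof -
  have T_eq: "T = pv_operator \<Omega> K" using T by (simp add: calderon_zygmund_operator_def)
  have pv: "AE x in D.M. \<exists>L. has_pv \<Omega> K f x L" if "f \<in> L2_space \<Omega>" for f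
    using T that by (simp add: calderon_zygmund_operator_def)
  obtain c where c: "\<And>f. f \<in> L2_space \<Omega> \<Longrightarrow> T f \<in> L2_space \<Omega> \<and> L2_norm \<Omega> (T f) \<le> c * L2_norm \<Omega> f"
    using T by (auto simp: calderon_zygmund_operator_def)
  have "D.strong_type 2 (3 * c\<^sup>2 + 3 * (c\<^sup>2 + (C * V * real (3 * n) ^ n)\<^sup>2) * 3 ^ n)"
  proof (rule D.strong_type_2_of_pv[of _ T])
    fix h assume h: "h \<in> borel_measurable D.M" "powint D.M 2 h < \<infinity>"
    note hL = powint_2_eq_L2_norm[OF h]
    have Th: "T h \<in> L2_space \<Omega>" using c hL by blast
    show "T h \<in> borel_measurable D.M" by (rule L2_space_powint[OF Th])
    show "AE x in D.M. ((\<lambda>\<epsilon>. D.trunc \<epsilon> h x) \<longlongrightarrow> T h x) (at_right 0)"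
      unfolding T_eq using h by (intro pv_operator_limit pv hL D.powint_finite_imp_integrable[of h 2]) auto
    have "powint D.M 2 (T h) = ennreal ((L2_norm \<Omega> (T h))\<^sup>2)" by (rule powint_2_eq_L2_norm[OF L2_space_powint[OF Th]])
    also have "\<dots> \<le> ennreal ((c * L2_norm \<Omega> h)\<^sup>2)"
      using c[OF hL(1)] by (intro ennreal_leI power_mono) (auto simp: L2_norm_def)
    also have "\<dots> = ennreal (c\<^sup>2) * powint D.M 2 h" unfolding hL(2) by (simp add: power_mult_distrib ennreal_mult)
    finally show "powint D.M 2 (T h) \<le> ennreal (c\<^sup>2) * powint D.M 2 h" .
  qed simp
  then show thesis by (rule that)
qed

text \<open>The constant depends on \<open>q0\<close>, \<open>p\<close> and \<open>lam\<close>, but not on \<open>q\<close> and \<open>\<mu>\<close>; this is what the supremum over \<open>\<epsilon>\<close>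
  in the grand norm requires.\<close>

lemma morrey_operator_bound:
  assumes T: "calderon_zygmund_operator \<Omega> K T" and q0: "1 < q0" "q0 \<le> p" and lam: "0 \<le> lam" "lam < 1"
  obtains B where "B > 0"
    "\<And>q \<mu> f. q0 \<le> q \<Longrightarrow> q \<le> p \<Longrightarrow> 0 \<le> \<mu> \<Longrightarrow> \<mu> \<le> lam \<Longrightarrow> f \<in> borel_measurable D.M \<Longrightarrow> morrey_norm \<Omega> q \<mu> f < \<infinity> \<Longrightarrow>
       (AE x in D.M. \<exists>L. has_pv \<Omega> K f x L) \<and> T f \<in> borel_measurable D.M \<and>
       morrey_norm \<Omega> q \<mu> (T f) \<le> ennreal B * morrey_norm \<Omega> q \<mu> f"
proof -
  have T_eq: "T = pv_operator \<Omega> K" using T by (simp add: calderon_zygmund_operator_def)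
  have pv2: "AE x in D.M. \<exists>L. has_pv \<Omega> K f x L" if "f \<in> L2_space \<Omega>" for f
    using T that by (simp add: calderon_zygmund_operator_def)
  obtain A where A: "D.strong_type 2 A" by (rule strong_type_2_of_operator[OF T])
  obtain A' where A': "\<And>q. q0 \<le> q \<Longrightarrow> q \<le> p \<Longrightarrow> D.strong_type q A'"
    using D.strong_type_uniform[OF A q0] by metis
  define \<kappa>0 where "\<kappa>0 = (1 - lam) / p"
  have \<kappa>0: "\<kappa>0 > 0" using lam q0 by (simp add: \<kappa>0_def)
  let ?B = "D.morrey_const A' \<kappa>0"
  have A'0: "A' \<ge> 0" using A'[of q0] q0 by (simp add: D.strong_type_def)
  have B: "?B > 0" using D.tail_const_nonneg[OF \<kappa>0] A'0 unfolding D.morrey_const_def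
    by (intro mult_pos_pos add_nonneg_pos add_nonneg_nonneg) auto
  show thesis
  proof (rule that[OF B])
    fix q \<mu> f
    assume q: "q0 \<le> q" "q \<le> p" and \<mu>: "0 \<le> \<mu>" "\<mu> \<le> lam" and fm [measurable]: "f \<in> borel_measurable D.M"
      and fin: "morrey_norm \<Omega> q \<mu> f < \<infinity>"
    have q1: "q > 1" using q q0 by simp
    have fq: "powint D.M q f < \<infinity>" using q1 by (intro morrey_finite_imp_powint[OF _ \<mu>(1) fin]) simp
    have f: "integrable D.M f" using D.powint_finite_imp_integrable[OF fm fq] q1 by simp
    have "AE x in D.M. \<exists>L. ((\<lambda>\<epsilon>. D.trunc \<epsilon> f x) \<longlongrightarrow> L) (at_right 0)"
    proof (rule D.pv_exists[OF q1 A'[OF q] _ fm fq])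
      fix h :: "real ^ 'n \<Rightarrow> real" and c assume h: "h \<in> borel_measurable D.M" "\<And>x. \<bar>h x\<bar> \<le> c"
      have h2: "powint D.M 2 h < \<infinity>" by (rule D.bounded_powint_finite[of _ c]) (use h in auto)
      have hi: "integrable D.M h" using D.powint_finite_imp_integrable[OF h(1) h2] by simp
      show "AE x in D.M. \<exists>L. ((\<lambda>\<epsilon>. D.trunc \<epsilon> h x) \<longlongrightarrow> L) (at_right 0)"
        using pv_operator_limit[OF hi pv2[OF powint_2_eq_L2_norm(1)[OF h(1) h2]]]
        by eventually_elim blast
    qed
    then have pv: "AE x in D.M. \<exists>L. has_pv \<Omega> K f x L"
      using AE_space by eventually_elim (use has_pv_iff[OF _ f] in auto)
    have Tm: "T f \<in> borel_measurable D.M" unfolding T_eq by (rule pv_operator_measurable[OF f pv])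
    have lim: "AE x in D.M. ((\<lambda>\<epsilon>. D.trunc \<epsilon> f x) \<longlongrightarrow> T f x) (at_right 0)"
      unfolding T_eq by (rule pv_operator_limit[OF f pv])
    obtain L where L: "morrey_norm \<Omega> q \<mu> f = ennreal L" "L \<ge> 0" using fin by (cases "morrey_norm \<Omega> q \<mu> f") auto
    have "\<kappa>0 \<le> (1 - \<mu>) / q" unfolding \<kappa>0_def using q q1 \<mu> lam by (intro frac_le) auto
    then have "D.morrey_mass q (T f) x r \<le> ennreal ((?B * L) powr q * (V * r ^ n) powr \<mu>)"
      if x: "x \<in> \<Omega>" and r: "r > 0" for x r
      using q1 \<mu> lam L(2) \<kappa>0 morrey_mass_all_radii[OF _ L(2) \<mu>(1) _ x, of q f] L(1)
      by (intro D.morrey_limit[OF _ fm Tm lim] D.morrey_trunc[OF q1 \<kappa>0 _ \<mu>(1) _ L(2) A'[OF q] fm fq x r]) auto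
    then have "morrey_norm \<Omega> q \<mu> (T f) \<le> ennreal (?B * L)"
      using q1 B L by (subst morrey_norm_le_iff) auto
    also have "\<dots> = ennreal ?B * morrey_norm \<Omega> q \<mu> f" using B L by (simp add: ennreal_mult)
    finally show "(AE x in D.M. \<exists>L. has_pv \<Omega> K f x L) \<and> T f \<in> borel_measurable D.M \<and>
       morrey_norm \<Omega> q \<mu> (T f) \<le> ennreal ?B * morrey_norm \<Omega> q \<mu> f" using pv Tm by blast
  qed
qed

end

section \<open>Grand grand Morrey spaces\<close>

lemma cz_kernel_imp_domain:
  fixes \<Omega> :: "(real ^ 'n) set"
  assumes op: "open \<Omega>" and bd: "bounded \<Omega>" and K: "cz_kernel \<Omega> K"
  obtains b C \<omega> where "cz_kernel_domain \<Omega> b (unit_ball_vol (real CARD('n))) CARD('n) K C \<omega>"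
proof -
  obtain C w where C: "C > 0" and w: "dini_modulus w"
    and size: "\<And>x y. x \<in> \<Omega> \<Longrightarrow> y \<in> \<Omega> \<Longrightarrow> x \<noteq> y \<Longrightarrow> \<bar>K x y\<bar> \<le> C / norm (x - y) ^ CARD('n)"
    and reg: "\<And>x1 x2 y. x1 \<in> \<Omega> \<Longrightarrow> x2 \<in> \<Omega> \<Longrightarrow> y \<in> \<Omega> \<Longrightarrow> x1 \<noteq> x2 \<Longrightarrow> x1 \<noteq> y \<Longrightarrow> norm (x2 - y) > C * norm (x1 - x2) \<Longrightarrow>
           \<bar>K x1 y - K x2 y\<bar> + \<bar>K y x1 - K y x2\<bar> \<le> C * w (norm (x2 - x1) / norm (x2 - y)) * (1 / norm (x2 - y) ^ CARD('n))"
    using K unfolding cz_kernel_def by metis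
  \<comment> \<open>Distances above \<open>b \<rho>\<close> then lie beyond the threshold of the regularity condition.\<close>
  define b where "b = max 5 (C + 1)"
  have b: "b \<ge> 5" "b > C" "b > 1" by (auto simp: b_def)
  define \<omega> where "\<omega> k = C * w (1 / b ^ Suc k)" for k
  have wpos: "w t > 0" if "t > 0" for t using w that by (simp add: dini_modulus_def)
  have wmono: "w s \<le> w t" if "0 < s" "s \<le> t" for s t
    using w that unfolding dini_modulus_def by (auto dest!: mono_onD[of _ _ s t])
  have \<omega>0: "\<omega> k \<ge> 0" for k unfolding \<omega>_def using wpos[of "1 / b ^ Suc k"] C b by simp
  have both: "\<bar>K x y - K z y\<bar> \<le> \<omega> k / dist x y ^ CARD('n) \<and> \<bar>K y x - K y z\<bar> \<le> \<omega> k / dist x y ^ CARD('n)"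
    if xyz: "x \<in> \<Omega>" "z \<in> \<Omega>" "y \<in> \<Omega>" and \<rho>: "\<rho> > 0" "dist x z \<le> \<rho>" "b ^ Suc k * \<rho> \<le> dist x y" for x z y k \<rho>
  proof (cases "x = z")
    case True then show ?thesis using \<omega>0[of k] by simp
  next
    case False
    have "b ^ 1 \<le> b ^ Suc k" using b by (intro power_increasing) auto
    then have "b * \<rho> \<le> b ^ Suc k * \<rho>" using \<rho> by (intro mult_right_mono) auto
    then have b\<rho>: "b * \<rho> \<le> dist x y" using \<rho> by linarith
    have "1 * \<rho> < b * \<rho>" using b \<rho> by (intro mult_strict_right_mono) auto
    then have zy: "z \<noteq> y" using b\<rho> \<rho>(2) by (intro notI) simp
    have "C * dist x z \<le> C * \<rho>" using C \<rho> by (intro mult_left_mono) auto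
    also have "\<dots> < b * \<rho>" using b \<rho> by (intro mult_strict_right_mono) auto
    finally have far: "norm (x - y) > C * norm (z - x)" using b\<rho> by (simp add: dist_norm norm_minus_commute)
    have xy: "dist x y > 0" using b\<rho> \<open>1 * \<rho> < b * \<rho>\<close> \<rho> by linarith
    have "dist x z / dist x y \<le> \<rho> / (b ^ Suc k * \<rho>)"
      using \<rho> b xy by (intro frac_le) auto
    also have "\<dots> = 1 / b ^ Suc k" using \<rho> by simp
    finally have "w (dist x z / dist x y) \<le> w (1 / b ^ Suc k)" using False xy by (intro wmono) auto
    then have "C * w (dist x z / dist x y) * (1 / dist x y ^ CARD('n)) \<le> \<omega> k * (1 / dist x y ^ CARD('n))"
      unfolding \<omega>_def using C by (intro mult_right_mono mult_left_mono) auto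
    moreover have "\<bar>K z y - K x y\<bar> + \<bar>K y z - K y x\<bar> \<le> C * w (dist x z / dist x y) * (1 / dist x y ^ CARD('n))"
      using reg[of z x y] xyz False zy far by (simp add: dist_norm)
    ultimately have "\<bar>K z y - K x y\<bar> + \<bar>K y z - K y x\<bar> \<le> \<omega> k / dist x y ^ CARD('n)" by simp
    then show ?thesis by linarith
  qed
  have "cz_kernel_domain \<Omega> b (unit_ball_vol (real CARD('n))) CARD('n) K C \<omega>"
  proof unfold_locales
    show "summable \<omega>" unfolding \<omega>_def by (intro summable_mult dini_modulus_summable w b)
    show "\<bar>K x y\<bar> \<le> C / dist x y ^ CARD('n)" if "x \<in> \<Omega>" "y \<in> \<Omega>" "x \<noteq> y" for x y
      using size[OF that] by (simp add: dist_norm)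
    show "CARD('n) = DIM(real ^ 'n)" by simp
  qed (use op bd b C \<omega>0 both in auto)
  then show thesis by (rule that)
qed

text \<open>The estimate for \<open>\<epsilon> \<le> \<sigma>\<close> is \<open>morrey_operator_bound\<close> for \<open>q = p - \<epsilon>\<close>. For \<open>\<epsilon> > \<sigma>\<close> the weight \<open>\<epsilon>\<^sup>\<theta>\<^sup>/\<^sup>(\<^sup>p\<^sup>-\<^sup>\<epsilon>\<^sup>)\<close> is at
  most \<open>p\<^sup>\<theta>\<close>, and the constant \<open>G\<close> collects the losses from replacing \<open>\<epsilon>\<close> by \<open>\<sigma>\<close>. The bound for \<open>\<epsilon> = \<sigma>\<close> also
  shows that \<open>T f\<close> is defined almost everywhere.\<close>

theorem theorem4p5:
  fixes \<Omega> :: "(real ^ 'n) set"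
    and K :: "real ^ 'n \<Rightarrow> real ^ 'n \<Rightarrow> real"
    and T :: "(real ^ 'n \<Rightarrow> real) \<Rightarrow> (real ^ 'n \<Rightarrow> real)"
    and p \<theta> \<alpha> lam :: real
  assumes "open \<Omega>" and "bounded \<Omega>"
    and "1 < p" and "\<theta> > 0" and "\<alpha> \<ge> 0" and "0 < lam" and "lam < 1"
    and "calderon_zygmund_operator \<Omega> K T"
  shows "\<exists>C::real. \<forall>f \<in> grand_morrey_space \<Omega> p lam \<theta> \<alpha>.
           (AE x in lebesgue_on \<Omega>. \<exists>L. has_pv \<Omega> K f x L) \<and>
           T f \<in> grand_morrey_space \<Omega> p lam \<theta> \<alpha> \<and>
           grand_morrey_norm \<Omega> p lam \<theta> \<alpha> (T f) \<le> ennreal C * grand_morrey_norm \<Omega> p lam \<theta> \<alpha> f"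
proof -
  have "cz_kernel \<Omega> K" using assms(8) by (simp add: calderon_zygmund_operator_def)
  then obtain b C \<omega> where D: "cz_kernel_domain \<Omega> b (unit_ball_vol (real CARD('n))) CARD('n) K C \<omega>"
    using cz_kernel_imp_domain[OF assms(1,2)] by metis
  \<comment> \<open>Any exponent strictly between \<open>1\<close> and \<open>p\<close> would do.\<close>
  define q0 where "q0 = (1 + p) / 2"
  have q0: "1 < q0" "q0 < p" using assms(3) by (auto simp: q0_def)
  obtain B where B: "B > 0" and bound:
    "\<And>q \<mu> f. q0 \<le> q \<Longrightarrow> q \<le> p \<Longrightarrow> 0 \<le> \<mu> \<Longrightarrow> \<mu> \<le> lam \<Longrightarrow> f \<in> borel_measurable (lebesgue_on \<Omega>) \<Longrightarrow> morrey_norm \<Omega> q \<mu> f < \<infinity> \<Longrightarrow>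
       (AE x in lebesgue_on \<Omega>. \<exists>L. has_pv \<Omega> K f x L) \<and> T f \<in> borel_measurable (lebesgue_on \<Omega>) \<and>
       morrey_norm \<Omega> q \<mu> (T f) \<le> ennreal B * morrey_norm \<Omega> q \<mu> f"
    using morrey_operator_bound[OF D assms(8) q0(1) less_imp_le[OF q0(2)] less_imp_le[OF assms(6)] assms(7)] by metis
  let ?s = "s_max p lam \<alpha>"
  have s: "?s > 0" "?s \<le> p - 1" using assms by (auto simp: s_max_def)
  have \<mu>: "0 \<le> lam - \<alpha> * \<epsilon>" "lam - \<alpha> * \<epsilon> \<le> lam" if "0 < \<epsilon>" "\<epsilon> < ?s" for \<epsilon>
    using that assms(5,6) by (auto simp: s_max_def field_simps split: if_splits)
  define \<sigma> where "\<sigma> = min (p - q0) (?s / 2)"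
  have \<sigma>: "0 < \<sigma>" "\<sigma> < ?s" "\<sigma> \<le> p - q0" using s q0 by (auto simp: \<sigma>_def)
  let ?E = "max 1 (unit_ball_vol (real CARD('n)) * diameter \<Omega> ^ CARD('n))"
  let ?w = "\<lambda>\<epsilon>. \<epsilon> powr (\<theta> / (p - \<epsilon>))"
  define G where "G = p powr \<theta> * ?E / ?w \<sigma>"
  have G: "G \<ge> 0" unfolding G_def by simp
  have "(AE x in lebesgue_on \<Omega>. \<exists>L. has_pv \<Omega> K f x L) \<and> T f \<in> grand_morrey_space \<Omega> p lam \<theta> \<alpha> \<and>
       grand_morrey_norm \<Omega> p lam \<theta> \<alpha> (T f) \<le> ennreal ((1 + G) * B) * grand_morrey_norm \<Omega> p lam \<theta> \<alpha> f"
    if f: "f \<in> grand_morrey_space \<Omega> p lam \<theta> \<alpha>" for f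
  proof -
    let ?N = "grand_morrey_norm \<Omega> p lam \<theta> \<alpha> f"
    let ?m = "\<lambda>\<epsilon> g. morrey_norm \<Omega> (p - \<epsilon>) (lam - \<alpha> * \<epsilon>) g"
    have fm: "f \<in> borel_measurable (lebesgue_on \<Omega>)" and fin: "?N < \<infinity>"
      using f by (auto simp: grand_morrey_space_def)
    have le_N: "ennreal (?w \<epsilon>) * ?m \<epsilon> f \<le> ?N" if "0 < \<epsilon>" "\<epsilon> < ?s" for \<epsilon>
      unfolding grand_morrey_norm_def by (rule SUP_upper) (use that in auto)
    have mfin: "?m \<epsilon> f < \<infinity>" if "0 < \<epsilon>" "\<epsilon> < ?s" for \<epsilon>
    proof (rule ccontr)
      assume "\<not> ?thesis"
      then have "?m \<epsilon> f = top" by (simp add: less_top[symmetric])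
      then have "ennreal (?w \<epsilon>) * ?m \<epsilon> f = top" using that by (simp add: ennreal_mult_top)
      then show False using le_N[OF that] fin by (simp add: top_unique)
    qed
    have small: "(AE x in lebesgue_on \<Omega>. \<exists>L. has_pv \<Omega> K f x L) \<and> T f \<in> borel_measurable (lebesgue_on \<Omega>) \<and>
       ?m \<epsilon> (T f) \<le> ennreal B * ?m \<epsilon> f" if "0 < \<epsilon>" "\<epsilon> \<le> \<sigma>" for \<epsilon>
      using that \<sigma> by (intro bound fm mfin \<mu>) auto
    have Tm: "T f \<in> borel_measurable (lebesgue_on \<Omega>)" using small[of \<sigma>] \<sigma> by auto
    have each: "ennreal (?w \<epsilon>) * ?m \<epsilon> (T f) \<le> ennreal ((1 + G) * B) * ?N" if \<epsilon>: "0 < \<epsilon>" "\<epsilon> < ?s" for \<epsilon>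
    proof (cases "\<epsilon> \<le> \<sigma>")
      case True
      have "ennreal (?w \<epsilon>) * ?m \<epsilon> (T f) \<le> ennreal (?w \<epsilon>) * (ennreal B * ?m \<epsilon> f)"
        using small[OF \<epsilon>(1) True] by (intro mult_left_mono) auto
      also have "\<dots> = ennreal B * (ennreal (?w \<epsilon>) * ?m \<epsilon> f)" by (simp add: mult_ac)
      also have "\<dots> \<le> ennreal B * ?N" by (intro mult_left_mono le_N \<epsilon>) auto
      also have "\<dots> \<le> ennreal ((1 + G) * B) * ?N"
        using G B by (intro mult_right_mono ennreal_leI) auto
      finally show ?thesis .
    next
      case False
      have "?w \<epsilon> \<le> p powr (\<theta> / (p - \<epsilon>))" using \<epsilon> s assms by (intro powr_mono2) auto
      also have "\<dots> \<le> p powr \<theta>" using \<epsilon> s assms by (intro powr_mono) (auto simp: divide_le_eq)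
      finally have w: "?w \<epsilon> \<le> p powr \<theta>" .
      have emb: "?m \<epsilon> (T f) \<le> ennreal ?E * ?m \<sigma> (T f)"
        using False \<epsilon> \<sigma> s \<mu>[OF \<epsilon>] \<mu>[OF \<sigma>(1,2)] order_le_less_trans[OF \<mu>(2)[OF \<sigma>(1,2)] assms(7)] assms
        by (intro morrey_norm_embedding[OF D] Tm) (auto intro!: mult_left_mono)
      have w\<sigma>: "?w \<sigma> > 0" using \<sigma> by simp
      have "ennreal (?w \<epsilon>) * ?m \<epsilon> (T f) \<le> ennreal (p powr \<theta>) * (ennreal ?E * (ennreal B * ?m \<sigma> f))"
        using small[of \<sigma>] \<sigma> by (intro mult_mono ennreal_leI w order_trans[OF emb] mult_left_mono) auto
      also have "\<dots> = ennreal (p powr \<theta> * ?E * B) * ?m \<sigma> f"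
        using B by (simp add: ennreal_mult mult.assoc)
      also have "p powr \<theta> * ?E * B = G * B * ?w \<sigma>" using w\<sigma> by (simp add: G_def)
      also have "ennreal (G * B * ?w \<sigma>) * ?m \<sigma> f = ennreal (G * B) * (ennreal (?w \<sigma>) * ?m \<sigma> f)"
        using G B by (simp add: ennreal_mult mult.assoc)
      also have "\<dots> \<le> ennreal (G * B) * ?N" by (intro mult_left_mono le_N \<sigma>) auto
      also have "\<dots> \<le> ennreal ((1 + G) * B) * ?N"
        using G B by (intro mult_right_mono ennreal_leI) auto
      finally show ?thesis .
    qed
    then have le: "grand_morrey_norm \<Omega> p lam \<theta> \<alpha> (T f) \<le> ennreal ((1 + G) * B) * ?N"
      unfolding grand_morrey_norm_def[of _ _ _ _ _ "T f"] by (intro SUP_least) auto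
    also have "\<dots> < \<infinity>" using fin by (simp add: ennreal_mult_less_top)
    finally show ?thesis using le Tm small[of \<sigma>] \<sigma> by (auto simp: grand_morrey_space_def)
  qed
  then show ?thesis by blast
qed

end
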